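(* Let $\{X_i\}_{i\ge 1}$ be a strictly stationary $m$-dependent sequence of random vectors in $\mathbb{R}^d$ with marginal density $p$, satisfying Assumption $\mathcal{A}$. Assume $p\in H_2^{(\alpha)}(K)$ for some $0<\alpha\le 1$ and $K>0$, and let $\epsilon=\epsilon(n)>0$ with $\epsilon(n)\to 0$ and $n^2\epsilon^d\to\infty$ as $n\to\infty$. For $0<\beta<1$ put $C_\beta:=\beta/(2-\beta)$. (i) If $\alpha>(d/4)C_\beta$ for some $0<\beta<1$ and $\epsilon\sim c\,n^{-(2-\beta)/d}$ for some $c>0$, then $$n^{\beta/2}c^{d/2}(\tilde Q_n-q_2)/u_n\to N(0,1)\quad\text{and}\quad n^{\beta/2}c^{d/2}\,\tilde Q_n(\tilde H_n-h_2)/u_n\to N(0,1)$$ in distribution as $n\to\infty$. (ii) If $\epsilon\sim L(n)n^{-2/d}$, where $L(n)$, $n\ge1$, is a slowly varying function as $n\to\infty$, then $$L(n)(\tilde Q_n-q_2)/u_n\to N(0,1)\quad\text{and}\quad L(n)\,\tilde Q_n(\tilde H_n-h_2)/u_n\to N(0,1)$$ in distribution as $n\to\infty$.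
   Context: $m\ge 0$ is a fixed integer. $\{X_i\}$ is $m$-dependent if the families $\{X_{a-r},\dots,X_a\}$ and $\{X_b,\dots,X_{b+s}\}$ are independent whenever $b-a>m$. $\|\cdot\|$ is the Euclidean norm on $\mathbb{R}^d$ and $I(D)$ is the indicator of $D$. $q_2:=\int_{\mathbb{R}^d}p(x)^2\,dx$ and $h_2:=-\log q_2$ (natural logarithm). $b_1(d)=2\pi^{d/2}/(d\,\Gamma(d/2))$ and $b_\epsilon(d)=\epsilon^d b_1(d)$ is the volume of a ball of radius $\epsilon$ in $\mathbb{R}^d$. For numerical sequences, $\sim$ means that the ratio tends to $1$ as $n\to\infty$. Estimators: $N_n:=\sum_{1\le i<j\le n} I(\|X_i-X_j\|\le\epsilon(n))$, $\tilde Q_n:=\binom{n}{2}^{-1}N_n/b_{\epsilon(n)}(d)$, $\tilde H_n:=-\log(\max(\tilde Q_n,1/n))$, and $u_n>0$ is given by $u_n^2:=2\max(\tilde Q_n,1/n)/b_1(d)$. Assumption $\mathcal{A}$: $p\in L_3(\mathbb{R}^d)$, and for each $4$-tuple of distinct positive integers $\mathbf{t}=(t_1,t_2,t_3,t_4)$ the vector $(X_{t_1},X_{t_2},X_{t_3},X_{t_4})$ has a density $p_{\mathbf{t}}(x_1,x_2,x_3,x_4)$ in $\mathbb{R}^{4d}$ such that $g_{\mathbf{t}}(x_1,x_2):=\left(\int_{\mathbb{R}^{2d}}p_{\mathbf{t}}(x_1,x_2,x_3,x_4)^2\,dx_3\,dx_4\right)^{1/2}$ belongs to $L_1(\mathbb{R}^{2d})$.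 $H_2^{(\alpha)}(K)$ is the class of functions $p$ on $\mathbb{R}^d$ satisfying $\left(\int_{\mathbb{R}^d}(p(x+h)-p(x))^2\,dx\right)^{1/2}\le K\|h\|^\alpha$ for all $h\in\mathbb{R}^d$ with $\|h\|\le 1$.
   Formalization: In (ii) the condition ε ~ L(n)n^{-2/d} is replaced by ε ~ L(n)^{2/d}n^{-2/d}: as printed, (ii) fails for every d≠2, since nε^{d/2} ~ L(n)^{d/2} with L(n)→∞ while the norming is L(n); for d=2 the two conditions agree. *)

theory Defs
  imports "HOL-Probability.Probability"
begin

definition has_density :: "'s measure \<Rightarrow> ('s \<Rightarrow> 'v::euclidean_space) \<Rightarrow> ('v \<Rightarrow> real) \<Rightarrow> bool" where
  "has_density M Y f \<longleftrightarrow>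
     f \<in> borel_measurable borel \<and> (\<forall>x. 0 \<le> f x) \<and> distributed M lborel Y (\<lambda>x. ennreal (f x))"

(* Sequences of random vectors are indexed by i >= 1; the value at index 0 is never used. *)

definition strictly_stationary :: "'s measure \<Rightarrow> (nat \<Rightarrow> 's \<Rightarrow> 'v::euclidean_space) \<Rightarrow> bool" where
  "strictly_stationary M X \<longleftrightarrow>
     (\<forall>k h. distr M (PiM {1..k} (\<lambda>_. borel)) (\<lambda>\<omega>. \<lambda>i\<in>{1..k}. X (i + h) \<omega>) =
            distr M (PiM {1..k} (\<lambda>_. borel)) (\<lambda>\<omega>. \<lambda>i\<in>{1..k}. X i \<omega>))"

definition m_dependent :: "nat \<Rightarrow> 's measure \<Rightarrow> (nat \<Rightarrow> 's \<Rightarrow> 'v::euclidean_space) \<Rightarrow> bool" where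
  "m_dependent m M X \<longleftrightarrow>
     (\<forall>a b r s. r < a \<and> a + m < b \<longrightarrow>
        prob_space.indep_var M
          (PiM {a - r..a} (\<lambda>_. borel)) (\<lambda>\<omega>. \<lambda>i\<in>{a - r..a}. X i \<omega>)
          (PiM {b..b + s} (\<lambda>_. borel)) (\<lambda>\<omega>. \<lambda>i\<in>{b..b + s}. X i \<omega>))"

(* Integrability of the inner function for almost every (x1, x2) says that
   g_t(x1, x2) is finite almost everywhere; it has to be demanded explicitly because
   the Bochner integral of a non-integrable function is 0. *)

definition assumption_A ::
    "'s measure \<Rightarrow> (nat \<Rightarrow> 's \<Rightarrow> 'v::euclidean_space) \<Rightarrow> ('v \<Rightarrow> real) \<Rightarrow> bool" where
  "assumption_A M X p \<longleftrightarrow>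
     p \<in> borel_measurable borel \<and>
     integrable lborel (\<lambda>x. \<bar>p x\<bar> ^ 3) \<and>
     (\<forall>t1 t2 t3 t4. distinct [t1, t2, t3, t4] \<and> (\<forall>t\<in>{t1, t2, t3, t4}. 1 \<le> t) \<longrightarrow>
        (\<exists>pt. has_density M (\<lambda>\<omega>. (X t1 \<omega>, X t2 \<omega>, X t3 \<omega>, X t4 \<omega>)) pt \<and>
           (AE (x1, x2) in lborel. integrable lborel (\<lambda>(x3, x4). (pt (x1, x2, x3, x4))\<^sup>2)) \<and>
           integrable lborel
             (\<lambda>(x1, x2). sqrt (LINT (x3, x4)|lborel. (pt (x1, x2, x3, x4))\<^sup>2))))"

definition H2_class :: "real \<Rightarrow> real \<Rightarrow> ('v::euclidean_space \<Rightarrow> real) set" where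
  "H2_class \<alpha> K =
     {p. \<forall>h. norm h \<le> 1 \<longrightarrow>
           integrable lborel (\<lambda>x. (p (x + h) - p x)\<^sup>2) \<and>
           sqrt (LINT x|lborel. (p (x + h) - p x)\<^sup>2) \<le> K * norm h powr \<alpha>}"

definition q2 :: "('v::euclidean_space \<Rightarrow> real) \<Rightarrow> real" where
  "q2 p = (LINT x|lborel. (p x)\<^sup>2)"

definition h2 :: "('v::euclidean_space \<Rightarrow> real) \<Rightarrow> real" where
  "h2 p = - ln (q2 p)"

definition b1 :: "nat \<Rightarrow> real" where
  "b1 d = 2 * pi powr (real d / 2) / (real d * Gamma (real d / 2))"

definition ball_vol :: "real \<Rightarrow> nat \<Rightarrow> real" where
  "ball_vol e d = e ^ d * b1 d"

definition N_stat ::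
    "(nat \<Rightarrow> 's \<Rightarrow> 'v::euclidean_space) \<Rightarrow> (nat \<Rightarrow> real) \<Rightarrow> nat \<Rightarrow> 's \<Rightarrow> real" where
  "N_stat X \<epsilon> n \<omega> =
     (\<Sum>(i, j)\<in>{(i, j). 1 \<le> i \<and> i < j \<and> j \<le> n}. of_bool (norm (X i \<omega> - X j \<omega>) \<le> \<epsilon> n))"

definition Q_est ::
    "(nat \<Rightarrow> 's \<Rightarrow> 'v::euclidean_space) \<Rightarrow> (nat \<Rightarrow> real) \<Rightarrow> nat \<Rightarrow> 's \<Rightarrow> real" where
  "Q_est X \<epsilon> n \<omega> = inverse (real (n choose 2)) * N_stat X \<epsilon> n \<omega> / ball_vol (\<epsilon> n) DIM('v)"

definition H_est ::
    "(nat \<Rightarrow> 's \<Rightarrow> 'v::euclidean_space) \<Rightarrow> (nat \<Rightarrow> real) \<Rightarrow> nat \<Rightarrow> 's \<Rightarrow> real" where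
  "H_est X \<epsilon> n \<omega> = - ln (max (Q_est X \<epsilon> n \<omega>) (1 / real n))"

definition u_est ::
    "(nat \<Rightarrow> 's \<Rightarrow> 'v::euclidean_space) \<Rightarrow> (nat \<Rightarrow> real) \<Rightarrow> nat \<Rightarrow> 's \<Rightarrow> real" where
  "u_est X \<epsilon> n \<omega> = sqrt (2 * max (Q_est X \<epsilon> n \<omega>) (1 / real n) / b1 DIM('v))"

(* Slow variation at infinity in the sense of Karamata; measurability is part of the notion. *)

definition slowly_varying :: "(real \<Rightarrow> real) \<Rightarrow> bool" where
  "slowly_varying L \<longleftrightarrow>
     L \<in> borel_measurable (restrict_space borel {1..}) \<and>
     (\<forall>x\<ge>1. 0 < L x) \<and>
     (\<forall>a>0. ((\<lambda>x. L (a * x) / L x) \<longlongrightarrow> 1) at_top)"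

definition conv_to_std_normal :: "'s measure \<Rightarrow> (nat \<Rightarrow> 's \<Rightarrow> real) \<Rightarrow> bool" where
  "conv_to_std_normal M Y \<longleftrightarrow> weak_conv_m (\<lambda>n. distr M borel (Y n)) std_normal_distribution"

end

theory Submission
  imports Defs
begin

text \<open>
  Why the theorem holds. The statistic \<open>N\<close> counts the pairs of observations at distance at most
  \<open>\<epsilon>\<close>. For indices far apart such an event has a probability of order \<open>\<epsilon>^d\<close>, there are about \<open>n^2 / 2\<close> pairs, and in
  both regimes \<open>n * \<epsilon>^d\<close> tends to \<open>0\<close> while \<open>n^2 * \<epsilon>^d\<close> tends to infinity. In this sparse setting two
  close pairs rarely share an observation, so the count behaves like a Poisson variable whose mean
  \<open>\<lambda>\<close> tends to infinity, and a centred Poisson variable divided by \<open>sqrt \<lambda>\<close> is asymptotically normal.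

  The Poisson approximation is proved with characteristic functions in the spirit of Chen and Stein
  (\<open>char_local_dependence_poisson\<close>). If the indicator of each pair is independent of the indicators
  of all pairs to which it is not linked, then \<open>\<phi>(s) = E exp (i s N)\<close> satisfies the differential
  equation \<open>\<phi>' = i \<lambda> exp (i s) \<phi>\<close> of the Poisson law up to an error of size \<open>\<bar>s\<bar>\<close> times a sum over
  linked pairs of pairs. Only first and second moments enter, which is why an \<open>L_3\<close> density suffices.

  Only far pairs, with indices more than \<open>3 m\<close> apart, are treated in this way. By \<open>m\<close>-dependence
  (\<open>indep_var_separated\<close>) such a pair is linked to at most \<open>O(n)\<close> others, in two kinds
  (\<open>expectation_two_close_linked\<close>). If only one index of the second pair is near the first pair,
  conditioning on the two neighbouring observations gives the second moment of the mass of a random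
  ball, of order \<open>\<epsilon>^(2 d)\<close> because the density lies in \<open>L_3\<close>. If both indices are near, there are
  only boundedly many such pairs, and the joint probability is \<open>o(\<epsilon>^d)\<close>: for four distinct
  indices this is the square integrability of the four-point densities in Assumption A, used through
  the Cauchy-Schwarz inequality and dominated convergence (\<open>two_close_pairs_ratio_tendsto_0\<close>). The same fact, applied to
  a pair and an independent copy of it, shows that the near pairs contribute \<open>o(n * \<epsilon>^(d / 2))\<close> to
  the count, which is less than its standard deviation.

  The mean of a far indicator is \<open>\<integral>\<integral> p(x) p(x + h)\<close> over the ball of radius \<open>\<epsilon>\<close> in \<open>h\<close>, and the
  identity \<open>2 p(x) p(x + h) = p(x)^2 + p(x + h)^2 - (p(x + h) - p(x))^2\<close> together with the smoothness
  class bounds the bias of the estimator by a multiple of \<open>\<epsilon>^(2 \<alpha>)\<close>. In the first regime the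
  lower bound on \<open>\<alpha>\<close> makes this bias negligible; in the second one it is negligible because a slowly
  varying function grows more slowly than every power (\<open>slowly_varying_powr_bound\<close>).
  Finally the random normalisation and the logarithm are handled by Slutsky's theorem: the error of
  the entropy estimate, multiplied by \<open>Q\<close>, is to first order \<open>-1\<close> times the
  error of \<open>Q\<close>, and the normal law is symmetric.
\<close>

section \<open>Convergence in probability and a Slutsky theorem\<close>

text \<open>Measurability belongs to the notion, since the probabilities in it are otherwise uninformative.\<close>

definition (in prob_space) tendsto_prob :: "(nat \<Rightarrow> 'a \<Rightarrow> real) \<Rightarrow> real \<Rightarrow> bool" where
  "tendsto_prob Z c \<longleftrightarrow>
     (\<forall>n. random_variable borel (Z n)) \<and>
     (\<forall>e>0. (\<lambda>n. prob {\<omega> \<in> space M. e < \<bar>Z n \<omega> - c\<bar>}) \<longlonglongrightarrow> 0)"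

context prob_space
begin

lemma tendsto_probD_measurable: "tendsto_prob Z c \<Longrightarrow> random_variable borel (Z n)"
  by (auto simp: tendsto_prob_def)

lemma tendsto_probD: "tendsto_prob Z c \<Longrightarrow> 0 < e \<Longrightarrow> (\<lambda>n. prob {\<omega> \<in> space M. e < \<bar>Z n \<omega> - c\<bar>}) \<longlonglongrightarrow> 0"
  by (auto simp: tendsto_prob_def)

lemma tendsto_prob_squeeze:
  assumes "\<And>n. random_variable borel (Z n)"
    and "\<And>e. 0 < e \<Longrightarrow> \<exists>f. f \<longlonglongrightarrow> 0 \<and> (\<forall>\<^sub>F n in sequentially. prob {\<omega> \<in> space M. e < \<bar>Z n \<omega> - c\<bar>} \<le> f n)"
  shows "tendsto_prob Z c"
  unfolding tendsto_prob_def
proof (intro conjI allI impI assms(1))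
  fix e :: real assume "0 < e"
  then obtain f where "f \<longlonglongrightarrow> 0" "\<forall>\<^sub>F n in sequentially. prob {\<omega> \<in> space M. e < \<bar>Z n \<omega> - c\<bar>} \<le> f n"
    using assms(2) by blast
  then show "(\<lambda>n. prob {\<omega> \<in> space M. e < \<bar>Z n \<omega> - c\<bar>}) \<longlonglongrightarrow> 0"
    by (rule tendsto_sandwich[OF always_eventually[OF allI[OF measure_nonneg]] _ tendsto_const, rotated])
qed

text \<open>Continuity at one point is enough: near the limit the function moves little, and away from it
  the arguments are only with vanishing probability. Sums, products and quotients are instances.\<close>

lemma tendsto_prob_isCont2:
  fixes g :: "real \<times> real \<Rightarrow> real"
  assumes Z: "tendsto_prob Z a" and W: "tendsto_prob W b"
    and g: "isCont g (a, b)"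
    and meas: "\<And>n. random_variable borel (\<lambda>\<omega>. g (Z n \<omega>, W n \<omega>))"
  shows "tendsto_prob (\<lambda>n \<omega>. g (Z n \<omega>, W n \<omega>)) (g (a, b))"
proof (rule tendsto_prob_squeeze[OF meas])
  fix e :: real assume "0 < e"
  then obtain d where d: "0 < d" "\<And>x. dist x (a, b) < d \<Longrightarrow> dist (g x) (g (a, b)) < e"
    using g unfolding continuous_at_eps_delta by blast
  define f where "f n = prob {\<omega> \<in> space M. d/3 < \<bar>Z n \<omega> - a\<bar>} + prob {\<omega> \<in> space M. d/3 < \<bar>W n \<omega> - b\<bar>}" for n
  note [measurable] = tendsto_probD_measurable[OF Z] tendsto_probD_measurable[OF W] meas
  have "f \<longlonglongrightarrow> 0"
    unfolding f_def using tendsto_add[OF tendsto_probD[OF Z, of "d/3"] tendsto_probD[OF W, of "d/3"]] d by simp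
  moreover have "prob {\<omega> \<in> space M. e < \<bar>g (Z n \<omega>, W n \<omega>) - g (a, b)\<bar>} \<le> f n" for n
  proof -
    have "prob {\<omega> \<in> space M. e < \<bar>g (Z n \<omega>, W n \<omega>) - g (a, b)\<bar>}
       \<le> prob ({\<omega> \<in> space M. d/3 < \<bar>Z n \<omega> - a\<bar>} \<union> {\<omega> \<in> space M. d/3 < \<bar>W n \<omega> - b\<bar>})"
    proof (rule finite_measure_mono)
      show "{\<omega> \<in> space M. e < \<bar>g (Z n \<omega>, W n \<omega>) - g (a, b)\<bar>}
         \<subseteq> {\<omega> \<in> space M. d/3 < \<bar>Z n \<omega> - a\<bar>} \<union> {\<omega> \<in> space M. d/3 < \<bar>W n \<omega> - b\<bar>}"
      proof (rule subsetI, rule ccontr)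
        fix \<omega> assume \<omega>: "\<omega> \<in> {\<omega> \<in> space M. e < \<bar>g (Z n \<omega>, W n \<omega>) - g (a, b)\<bar>}"
          "\<omega> \<notin> {\<omega> \<in> space M. d/3 < \<bar>Z n \<omega> - a\<bar>} \<union> {\<omega> \<in> space M. d/3 < \<bar>W n \<omega> - b\<bar>}"
        have "dist (Z n \<omega>, W n \<omega>) (a, b) \<le> \<bar>Z n \<omega> - a\<bar> + \<bar>W n \<omega> - b\<bar>"
          unfolding dist_Pair_Pair dist_real_def by (rule sqrt_sum_squares_le_sum_abs[THEN order_trans]) simp
        also have "\<dots> < d" using \<omega> d by auto
        finally show False using d(2) \<omega>(1) by (force simp: dist_real_def)
      qed
    qed measurable
    also have "\<dots> \<le> f n"
      unfolding f_def by (rule measure_Un_le) measurable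
    finally show ?thesis .
  qed
  ultimately show "\<exists>f. f \<longlonglongrightarrow> 0 \<and> (\<forall>\<^sub>F n in sequentially. prob {\<omega> \<in> space M. e < \<bar>g (Z n \<omega>, W n \<omega>) - g (a, b)\<bar>} \<le> f n)"
    by (intro exI[of _ f]) auto
qed

lemma tendsto_prob_const:
  assumes c: "c \<longlonglongrightarrow> l"
  shows "tendsto_prob (\<lambda>n \<omega>. c n) l"
  unfolding tendsto_prob_def
proof (intro conjI allI impI)
  fix e :: real assume e: "0 < e"
  have "\<forall>\<^sub>F n in sequentially. \<bar>c n - l\<bar> < e"
    using tendstoD[OF c e] by (simp add: dist_real_def)
  then have "\<forall>\<^sub>F n in sequentially. 0 = prob {\<omega> \<in> space M. e < \<bar>c n - l\<bar>}"
  proof eventually_elim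
    case (elim n)
    then have "{\<omega> \<in> space M. e < \<bar>c n - l\<bar>} = {}" by auto
    then show ?case by (metis measure_empty)
  qed
  then show "(\<lambda>n. prob {\<omega> \<in> space M. e < \<bar>c n - l\<bar>}) \<longlonglongrightarrow> 0"
    by (rule Lim_transform_eventually[OF tendsto_const])
qed (rule measurable_const, simp)

lemma tendsto_prob_isCont:
  fixes g :: "real \<Rightarrow> real"
  assumes Z: "tendsto_prob Z a" and g: "isCont g a"
    and meas: "\<And>n. random_variable borel (\<lambda>\<omega>. g (Z n \<omega>))"
  shows "tendsto_prob (\<lambda>n \<omega>. g (Z n \<omega>)) (g a)"
proof -
  have "isCont (\<lambda>x. g (fst x)) (a, 0 :: real)"
    using isCont_o2[of "(a, 0 :: real)" fst g] g by (simp add: continuous_fst)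
  from tendsto_prob_isCont2[where g = "\<lambda>x. g (fst x)", OF Z tendsto_prob_const[of "\<lambda>_. 0" 0, OF tendsto_const] this] show ?thesis
    unfolding fst_conv using meas .
qed

lemma tendsto_prob_add:
  assumes "tendsto_prob Z a" "tendsto_prob W b"
  shows "tendsto_prob (\<lambda>n \<omega>. Z n \<omega> + W n \<omega>) (a + b)"
proof -
  note [measurable] = tendsto_probD_measurable[OF assms(1)] tendsto_probD_measurable[OF assms(2)]
  have 1: "isCont (\<lambda>x :: real \<times> real. fst x + snd x) (a, b)"
    by (intro isCont_add isCont_mult continuous_fst continuous_snd continuous_ident)
  have 2: "random_variable borel (\<lambda>\<omega>. fst (Z n \<omega>, W n \<omega>) + snd (Z n \<omega>, W n \<omega>))" for n
    unfolding fst_conv snd_conv by measurable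
  show ?thesis
    by (rule tendsto_prob_isCont2[where g = "\<lambda>x. fst x + snd x", OF assms 1 2, unfolded fst_conv snd_conv])
qed

lemma tendsto_prob_mult:
  assumes "tendsto_prob Z a" "tendsto_prob W b"
  shows "tendsto_prob (\<lambda>n \<omega>. Z n \<omega> * W n \<omega>) (a * b)"
proof -
  note [measurable] = tendsto_probD_measurable[OF assms(1)] tendsto_probD_measurable[OF assms(2)]
  have 1: "isCont (\<lambda>x :: real \<times> real. fst x * snd x) (a, b)"
    by (intro isCont_add isCont_mult continuous_fst continuous_snd continuous_ident)
  have 2: "random_variable borel (\<lambda>\<omega>. fst (Z n \<omega>, W n \<omega>) * snd (Z n \<omega>, W n \<omega>))" for n
    unfolding fst_conv snd_conv by measurable
  show ?thesis
    by (rule tendsto_prob_isCont2[where g = "\<lambda>x. fst x * snd x", OF assms 1 2, unfolded fst_conv snd_conv])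
qed

lemma tendsto_prob_divide:
  assumes "tendsto_prob Z a" "tendsto_prob W b" "b \<noteq> 0"
  shows "tendsto_prob (\<lambda>n \<omega>. Z n \<omega> / W n \<omega>) (a / b)"
proof -
  note [measurable] = tendsto_probD_measurable[OF assms(1)] tendsto_probD_measurable[OF assms(2)]
  have 1: "isCont (\<lambda>x :: real \<times> real. fst x / snd x) (a, b)"
    using assms(3) by (intro isCont_divide continuous_fst continuous_snd continuous_ident) simp
  have 2: "random_variable borel (\<lambda>\<omega>. fst (Z n \<omega>, W n \<omega>) / snd (Z n \<omega>, W n \<omega>))" for n
    unfolding fst_conv snd_conv by measurable
  show ?thesis
    by (rule tendsto_prob_isCont2[where g = "\<lambda>x. fst x / snd x", OF assms(1,2) 1 2, unfolded fst_conv snd_conv])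
qed

text \<open>By Markov's inequality.\<close>

lemma tendsto_prob_of_expectation:
  assumes int: "\<And>n. integrable M (Z n)" and nonneg: "\<And>n \<omega>. 0 \<le> Z n \<omega>"
    and lim: "(\<lambda>n. expectation (Z n)) \<longlonglongrightarrow> 0"
  shows "tendsto_prob Z 0"
proof (rule tendsto_prob_squeeze)
  show "random_variable borel (Z n)" for n using int by (rule borel_measurable_integrable)
  note [measurable] = this
  fix e :: real assume e: "0 < e"
  have "prob {\<omega> \<in> space M. e < \<bar>Z n \<omega> - 0\<bar>} \<le> expectation (Z n) / e" for n
  proof -
    have "prob {\<omega> \<in> space M. e < \<bar>Z n \<omega> - 0\<bar>} \<le> prob {\<omega> \<in> space M. e \<le> Z n \<omega>}"
      using nonneg by (intro finite_measure_mono) auto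
    also have "\<dots> \<le> expectation (Z n) / e"
      by (rule integral_Markov_inequality_measure[OF int sets.empty_sets]) (use nonneg e in auto)
    finally show ?thesis .
  qed
  then show "\<exists>f. f \<longlonglongrightarrow> 0 \<and> (\<forall>\<^sub>F n in sequentially. prob {\<omega> \<in> space M. e < \<bar>Z n \<omega> - 0\<bar>} \<le> f n)"
    using tendsto_divide[OF lim tendsto_const[of e]] e by (intro exI[of _ "\<lambda>n. expectation (Z n) / e"]) auto
qed

lemma tendsto_prob_eventually:
  assumes Z: "tendsto_prob Z c" and meas: "\<And>n. random_variable borel (W n)"
    and eq: "\<forall>\<^sub>F n in sequentially. \<forall>\<omega>\<in>space M. W n \<omega> = Z n \<omega>"
  shows "tendsto_prob W c"
proof (rule tendsto_prob_squeeze[OF meas])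
  fix e :: real assume e: "0 < e"
  have "\<forall>\<^sub>F n in sequentially. prob {\<omega> \<in> space M. e < \<bar>W n \<omega> - c\<bar>} \<le> prob {\<omega> \<in> space M. e < \<bar>Z n \<omega> - c\<bar>}"
    using eq
  proof eventually_elim
    case (elim n)
    then have "{\<omega> \<in> space M. e < \<bar>W n \<omega> - c\<bar>} = {\<omega> \<in> space M. e < \<bar>Z n \<omega> - c\<bar>}" by auto
    then show ?case by simp
  qed
  then show "\<exists>f. f \<longlonglongrightarrow> 0 \<and> (\<forall>\<^sub>F n in sequentially. prob {\<omega> \<in> space M. e < \<bar>W n \<omega> - c\<bar>} \<le> f n)"
    using tendsto_probD[OF Z e] by blast
qed

text \<open>The distribution function of the normal law is continuous and has limits \<open>0\<close> and \<open>1\<close>, so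
  convergence of distribution functions at two points \<open>-K\<close> and \<open>K\<close> controls both tails.\<close>

lemma conv_to_std_normal_tight:
  assumes meas: "\<And>n. random_variable borel (Y n)" and Y: "conv_to_std_normal M Y" and \<eta>: "0 < \<eta>"
  shows "\<exists>K>0. \<forall>\<^sub>F n in sequentially. prob {\<omega> \<in> space M. K < \<bar>Y n \<omega>\<bar>} < \<eta>"
proof -
  interpret N: real_distribution std_normal_distribution by (rule real_dist_normal_dist)
  define \<Phi> where "\<Phi> = cdf std_normal_distribution"
  have cont: "isCont \<Phi> x" for x
  proof -
    have "AE y in lborel. y \<in> {x} \<longrightarrow> ennreal (std_normal_density y) = 0"
      using AE_lborel_singleton[of x] by eventually_elim simp
    then have "{x} \<in> null_sets std_normal_distribution"
      by (intro null_sets_density_iff[THEN iffD2] conjI) auto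
    then show ?thesis
      unfolding \<Phi>_def N.isCont_cdf by (simp add: measure_def null_setsD1)
  qed
  have lim: "(\<lambda>n. cdf (distr M borel (Y n)) x) \<longlonglongrightarrow> \<Phi> x" for x
    using Y cont unfolding conv_to_std_normal_def weak_conv_m_def weak_conv_def \<Phi>_def by blast
  have "\<forall>\<^sub>F x in at_top. \<Phi> x > 1 - \<eta> / 3"
    using order_tendstoD(1)[OF N.cdf_lim_at_top_prob, of "1 - \<eta>/3"] \<eta> unfolding \<Phi>_def by simp
  moreover have "\<forall>\<^sub>F x in at_top. \<Phi> (- x) < \<eta> / 3"
  proof -
    have "\<forall>\<^sub>F x in at_bot. \<Phi> x < \<eta> / 3"
      using order_tendstoD(2)[OF N.cdf_lim_at_bot, of "\<eta>/3"] \<eta> unfolding \<Phi>_def by simp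
    then show ?thesis unfolding at_bot_mirror eventually_filtermap .
  qed
  ultimately have "\<forall>\<^sub>F x in at_top. 0 < x \<and> \<Phi> x > 1 - \<eta> / 3 \<and> \<Phi> (- x) < \<eta> / 3"
    using eventually_gt_at_top[of "0::real"] by eventually_elim auto
  then obtain K where K: "0 < K" "\<Phi> K > 1 - \<eta> / 3" "\<Phi> (- K) < \<eta> / 3"
    using eventually_happens'[OF trivial_limit_at_top_linorder] by blast
  have "\<forall>\<^sub>F n in sequentially. cdf (distr M borel (Y n)) K > 1 - \<eta> / 3"
    using order_tendstoD(1)[OF lim K(2)] .
  moreover have "\<forall>\<^sub>F n in sequentially. cdf (distr M borel (Y n)) (- K) < \<eta> / 3"
    using order_tendstoD(2)[OF lim K(3)] .
  ultimately have "\<forall>\<^sub>F n in sequentially. prob {\<omega> \<in> space M. K < \<bar>Y n \<omega>\<bar>} < \<eta>"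
  proof eventually_elim
    case (elim n)
    note [measurable] = meas[of n]
    have c: "cdf (distr M borel (Y n)) x = prob {\<omega> \<in> space M. Y n \<omega> \<le> x}" for x
      unfolding cdf_def by (subst measure_distr) (auto intro!: arg_cong[where f = prob])
    have "prob {\<omega> \<in> space M. K < \<bar>Y n \<omega>\<bar>} \<le> prob ({\<omega> \<in> space M. Y n \<omega> \<le> - K} \<union> (space M - {\<omega> \<in> space M. Y n \<omega> \<le> K}))"
      by (rule finite_measure_mono) (auto simp: abs_if split: if_splits)
    also have "\<dots> \<le> prob {\<omega> \<in> space M. Y n \<omega> \<le> - K} + prob (space M - {\<omega> \<in> space M. Y n \<omega> \<le> K})"
      by (rule measure_Un_le) measurable
    also have "prob (space M - {\<omega> \<in> space M. Y n \<omega> \<le> K}) = 1 - prob {\<omega> \<in> space M. Y n \<omega> \<le> K}"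
      by (rule prob_compl) measurable
    finally show ?case using elim \<eta> unfolding c by simp
  qed
  with K(1) show ?thesis by blast
qed

lemma tendsto_prob_mult_tight:
  assumes A: "tendsto_prob A 0"
    and meas: "\<And>n. random_variable borel (Y n)" and Y: "conv_to_std_normal M Y"
  shows "tendsto_prob (\<lambda>n \<omega>. A n \<omega> * Y n \<omega>) 0"
  unfolding tendsto_prob_def
proof (intro conjI allI impI)
  note [measurable] = tendsto_probD_measurable[OF A] meas
  show "random_variable borel (\<lambda>\<omega>. A n \<omega> * Y n \<omega>)" for n by measurable
  fix e :: real assume e: "0 < e"
  show "(\<lambda>n. prob {\<omega> \<in> space M. e < \<bar>A n \<omega> * Y n \<omega> - 0\<bar>}) \<longlonglongrightarrow> 0"
  proof (rule LIMSEQ_I)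
    fix r :: real assume r: "0 < r"
    obtain K where K: "0 < K" "\<forall>\<^sub>F n in sequentially. prob {\<omega> \<in> space M. K < \<bar>Y n \<omega>\<bar>} < r / 2"
      using conv_to_std_normal_tight[OF meas Y, of "r/2"] r by auto
    have "\<forall>\<^sub>F n in sequentially. prob {\<omega> \<in> space M. e / K < \<bar>A n \<omega> - 0\<bar>} < r / 2"
      using order_tendstoD(2)[OF tendsto_probD[OF A, of "e / K"], of "r / 2"] e K r by auto
    with K(2) have "\<forall>\<^sub>F n in sequentially. prob {\<omega> \<in> space M. e < \<bar>A n \<omega> * Y n \<omega> - 0\<bar>} < r"
    proof eventually_elim
      case (elim n)
      have "prob {\<omega> \<in> space M. e < \<bar>A n \<omega> * Y n \<omega> - 0\<bar>}
        \<le> prob ({\<omega> \<in> space M. K < \<bar>Y n \<omega>\<bar>} \<union> {\<omega> \<in> space M. e / K < \<bar>A n \<omega> - 0\<bar>})"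
      proof (rule finite_measure_mono)
        show "{\<omega> \<in> space M. e < \<bar>A n \<omega> * Y n \<omega> - 0\<bar>}
          \<subseteq> {\<omega> \<in> space M. K < \<bar>Y n \<omega>\<bar>} \<union> {\<omega> \<in> space M. e / K < \<bar>A n \<omega> - 0\<bar>}"
        proof (rule subsetI, rule ccontr)
          fix \<omega> assume \<omega>: "\<omega> \<in> {\<omega> \<in> space M. e < \<bar>A n \<omega> * Y n \<omega> - 0\<bar>}"
            "\<omega> \<notin> {\<omega> \<in> space M. K < \<bar>Y n \<omega>\<bar>} \<union> {\<omega> \<in> space M. e / K < \<bar>A n \<omega> - 0\<bar>}"
          have "\<bar>A n \<omega> * Y n \<omega>\<bar> \<le> (e / K) * K"
            unfolding abs_mult using \<omega> K e by (intro mult_mono) auto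
          then show False using \<omega>(1) K by auto
        qed
      qed measurable
      also have "\<dots> \<le> prob {\<omega> \<in> space M. K < \<bar>Y n \<omega>\<bar>} + prob {\<omega> \<in> space M. e / K < \<bar>A n \<omega> - 0\<bar>}"
        by (rule measure_Un_le) measurable
      finally show ?case using elim by simp
    qed
    then show "\<exists>no. \<forall>n\<ge>no. norm (prob {\<omega> \<in> space M. e < \<bar>A n \<omega> * Y n \<omega> - 0\<bar>} - 0) < r"
      by (simp add: eventually_sequentially)
  qed
qed

lemma conv_to_std_normal_iff_char:
  assumes meas: "\<And>n. random_variable borel (Y n)"
  shows "conv_to_std_normal M Y \<longleftrightarrow>
     (\<forall>t. (\<lambda>n. \<integral>\<omega>. iexp (t * Y n \<omega>) \<partial>M) \<longlonglongrightarrow> of_real (exp (- (t\<^sup>2) / 2)))"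
proof -
  have rd: "real_distribution (distr M borel (Y n))" for n
    using meas by (rule real_distribution_distr)
  have ch: "char (distr M borel (Y n)) t = (\<integral>\<omega>. iexp (t * Y n \<omega>) \<partial>M)" for n t
    unfolding char_def using meas[of n] by (subst integral_distr) auto
  show ?thesis
  proof
    assume "conv_to_std_normal M Y"
    from levy_continuity1[OF rd real_dist_normal_dist this[unfolded conv_to_std_normal_def]]
    show "\<forall>t. (\<lambda>n. \<integral>\<omega>. iexp (t * Y n \<omega>) \<partial>M) \<longlonglongrightarrow> of_real (exp (- (t\<^sup>2) / 2))"
      unfolding ch char_std_normal_distribution by blast
  next
    assume "\<forall>t. (\<lambda>n. \<integral>\<omega>. iexp (t * Y n \<omega>) \<partial>M) \<longlonglongrightarrow> of_real (exp (- (t\<^sup>2) / 2))"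
    then show "conv_to_std_normal M Y"
      unfolding conv_to_std_normal_def
      by (intro levy_continuity rd real_dist_normal_dist) (simp add: ch char_std_normal_distribution)
  qed
qed

text \<open>The function \<open>x \<mapsto> exp (i t x)\<close> is Lipschitz: where the perturbation is small the integrands
  differ little, and elsewhere they differ by at most \<open>2\<close>.\<close>

lemma conv_to_std_normal_add_null:
  assumes meas: "\<And>n. random_variable borel (Y n)" and Y: "conv_to_std_normal M Y"
    and D: "tendsto_prob D 0"
  shows "conv_to_std_normal M (\<lambda>n \<omega>. Y n \<omega> + D n \<omega>)"
proof -
  note [measurable] = meas tendsto_probD_measurable[OF D]
  have "(\<lambda>n. \<integral>\<omega>. iexp (t * (Y n \<omega> + D n \<omega>)) \<partial>M) \<longlonglongrightarrow> of_real (exp (- (t\<^sup>2) / 2))" for t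
  proof (rule Lim_transform)
    show "(\<lambda>n. \<integral>\<omega>. iexp (t * Y n \<omega>) \<partial>M) \<longlonglongrightarrow> of_real (exp (- (t\<^sup>2) / 2))"
      using Y conv_to_std_normal_iff_char[of Y, OF meas] by blast
    show "(\<lambda>n. (\<integral>\<omega>. iexp (t * (Y n \<omega> + D n \<omega>)) \<partial>M) - (\<integral>\<omega>. iexp (t * Y n \<omega>) \<partial>M)) \<longlonglongrightarrow> 0"
    proof (rule LIMSEQ_I)
      fix r :: real assume r: "0 < r"
      define e where "e = r / (2 * (\<bar>t\<bar> + 1))"
      have e: "0 < e" "\<bar>t\<bar> * e < r / 2"
        using r by (auto simp: e_def field_simps)
      have "\<forall>\<^sub>F n in sequentially. prob {\<omega> \<in> space M. e < \<bar>D n \<omega> - 0\<bar>} < r / 4"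
        using order_tendstoD(2)[OF tendsto_probD[OF D e(1)], of "r / 4"] r by auto
      then have "\<forall>\<^sub>F n in sequentially. norm ((\<integral>\<omega>. iexp (t * (Y n \<omega> + D n \<omega>)) \<partial>M) - (\<integral>\<omega>. iexp (t * Y n \<omega>) \<partial>M)) < r"
      proof eventually_elim
        case (elim n)
        define A where "A = {\<omega> \<in> space M. e < \<bar>D n \<omega> - 0\<bar>}"
        have [measurable]: "A \<in> events" unfolding A_def by measurable
        have "norm ((\<integral>\<omega>. iexp (t * (Y n \<omega> + D n \<omega>)) \<partial>M) - (\<integral>\<omega>. iexp (t * Y n \<omega>) \<partial>M))
          = norm (\<integral>\<omega>. iexp (t * (Y n \<omega> + D n \<omega>)) - iexp (t * Y n \<omega>) \<partial>M)"
          by (subst Bochner_Integration.integral_diff) (auto intro!: integrable_iexp)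
        also have "\<dots> \<le> (\<integral>\<omega>. \<bar>t\<bar> * e + 2 * indicator A \<omega> \<partial>M)"
        proof (rule order_trans[OF integral_norm_bound], rule integral_mono)
          show "integrable M (\<lambda>\<omega>. norm (iexp (t * (Y n \<omega> + D n \<omega>)) - iexp (t * Y n \<omega>)))"
            by (intro integrable_norm Bochner_Integration.integrable_diff integrable_iexp) auto
          show "integrable M (\<lambda>\<omega>. \<bar>t\<bar> * e + 2 * indicator A \<omega>)"
            by (intro Bochner_Integration.integrable_add integrable_mult_right) (auto simp: emeasure_eq_measure)
          fix \<omega> assume \<omega>: "\<omega> \<in> space M"
          have "iexp (t * (Y n \<omega> + D n \<omega>)) = iexp (t * Y n \<omega>) * iexp (t * D n \<omega>)"
            by (simp add: distrib_left exp_add)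
          then have eq: "iexp (t * (Y n \<omega> + D n \<omega>)) - iexp (t * Y n \<omega>) = iexp (t * Y n \<omega>) * (iexp (t * D n \<omega>) - 1)"
            by (simp add: right_diff_distrib)
          show "norm (iexp (t * (Y n \<omega> + D n \<omega>)) - iexp (t * Y n \<omega>)) \<le> \<bar>t\<bar> * e + 2 * indicator A \<omega>"
          proof (cases "\<omega> \<in> A")
            case True
            have "norm (iexp (t * (Y n \<omega> + D n \<omega>)) - iexp (t * Y n \<omega>)) \<le> 2"
              by (rule order_trans[OF norm_triangle_ineq4]) simp
            moreover have "0 \<le> \<bar>t\<bar> * e" using e by simp
            ultimately show ?thesis using True by (simp only: indicator_simps)
          next
            case False
            have "norm (iexp (t * D n \<omega>) - 1) \<le> \<bar>t * D n \<omega>\<bar>"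
              using iexp_approx1[of "t * D n \<omega>" 0] by simp
            also have "\<dots> \<le> \<bar>t\<bar> * e"
              unfolding abs_mult using False \<omega> by (intro mult_left_mono) (auto simp: A_def)
            finally show ?thesis unfolding eq using False by (simp add: norm_mult)
          qed
        qed
        also have "\<dots> = \<bar>t\<bar> * e + 2 * prob A"
          by (subst Bochner_Integration.integral_add) (auto simp: prob_space emeasure_eq_measure)
        finally show ?case using elim e unfolding A_def by simp
      qed
      then show "\<exists>no. \<forall>n\<ge>no. norm ((\<integral>\<omega>. iexp (t * (Y n \<omega> + D n \<omega>)) \<partial>M) - (\<integral>\<omega>. iexp (t * Y n \<omega>) \<partial>M) - 0) < r"
        by (simp add: eventually_sequentially)
    qed
  qed
  then show ?thesis by (subst conv_to_std_normal_iff_char) auto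
qed

lemma conv_to_std_normal_uminus:
  assumes meas: "\<And>n. random_variable borel (Y n)" and Y: "conv_to_std_normal M Y"
  shows "conv_to_std_normal M (\<lambda>n \<omega>. - Y n \<omega>)"
proof -
  have "(\<lambda>n. \<integral>\<omega>. iexp (- t * Y n \<omega>) \<partial>M) \<longlonglongrightarrow> of_real (exp (- ((- t)\<^sup>2) / 2))" for t
    using Y conv_to_std_normal_iff_char[of Y, OF meas] by blast
  then show ?thesis
    using meas by (subst conv_to_std_normal_iff_char) auto
qed

text \<open>The coefficient may converge to \<open>-1\<close> as well as to \<open>1\<close> because the normal law is symmetric.
  The sign \<open>-1\<close> occurs for the entropy estimator.\<close>

lemma slutsky_std_normal:
  assumes meas: "\<And>n. random_variable borel (Y n)" and Y: "conv_to_std_normal M Y"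
    and A: "tendsto_prob A a" and a: "\<bar>a\<bar> = 1" and D: "tendsto_prob D 0"
  shows "conv_to_std_normal M (\<lambda>n \<omega>. A n \<omega> * Y n \<omega> + D n \<omega>)"
proof -
  have aY: "conv_to_std_normal M (\<lambda>n \<omega>. a * Y n \<omega>)"
  proof -
    have "a = 1 \<or> a = -1" using a by auto
    then show ?thesis using Y conv_to_std_normal_uminus[OF meas Y] by auto
  qed
  have "tendsto_prob (\<lambda>n \<omega>. A n \<omega> + (- a)) (a + (- a))"
    by (intro tendsto_prob_add A tendsto_prob_const tendsto_const)
  then have "tendsto_prob (\<lambda>n \<omega>. (A n \<omega> + (- a)) * Y n \<omega>) 0"
    by (intro tendsto_prob_mult_tight meas Y) simp
  from tendsto_prob_add[OF this D]
  have "conv_to_std_normal M (\<lambda>n \<omega>. a * Y n \<omega> + ((A n \<omega> + (- a)) * Y n \<omega> + D n \<omega>))"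
    using meas by (intro conv_to_std_normal_add_null aY) auto
  then show ?thesis by (simp add: algebra_simps)
qed

lemma conv_to_std_normal_eventually:
  assumes meas: "\<And>n. random_variable borel (Y n)" "\<And>n. random_variable borel (Z n)"
    and Y: "conv_to_std_normal M Y"
    and eq: "\<forall>\<^sub>F n in sequentially. \<forall>\<omega>\<in>space M. Z n \<omega> = Y n \<omega>"
  shows "conv_to_std_normal M Z"
  unfolding conv_to_std_normal_iff_char[OF meas(2)]
proof
  fix t
  have "\<forall>\<^sub>F n in sequentially. (\<integral>\<omega>. iexp (t * Y n \<omega>) \<partial>M) = (\<integral>\<omega>. iexp (t * Z n \<omega>) \<partial>M)"
    using eq by eventually_elim (rule Bochner_Integration.integral_cong, auto)
  with Y show "(\<lambda>n. \<integral>\<omega>. iexp (t * Z n \<omega>) \<partial>M) \<longlonglongrightarrow> of_real (exp (- (t\<^sup>2) / 2))"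
    unfolding conv_to_std_normal_iff_char[OF meas(1)] by (blast intro: Lim_transform_eventually)
qed

end

section \<open>Poisson approximation under local dependence\<close>

lemma norm_iexp_minus_one_le: "norm (iexp x - 1) \<le> \<bar>x\<bar>"
  using iexp_approx1[of x 0] by simp

lemma one_minus_cos_le: "1 - cos x \<le> x\<^sup>2 / 2" for x :: real
proof -
  have "1 - cos x = 2 * (sin (x / 2))\<^sup>2"
    using cos_double_sin[of "x / 2"] by simp
  also have "(sin (x / 2))\<^sup>2 \<le> (x / 2)\<^sup>2"
    using abs_sin_x_le_abs_x[of "x / 2"] abs_le_square_iff by blast
  finally show ?thesis by (simp add: power2_eq_square)
qed

text \<open>Writing the expectation as a finite sum makes the characteristic function of a count a trigonometric
  polynomial, which can be differentiated term by term.\<close>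

lemma (in prob_space) expectation_of_nat_range:
  fixes N :: "'a \<Rightarrow> real" and g :: "real \<Rightarrow> complex"
  assumes N [measurable]: "random_variable borel N"
    and range: "\<And>\<omega>. \<omega> \<in> space M \<Longrightarrow> N \<omega> \<in> real ` {..K}"
  shows "(\<integral>\<omega>. g (N \<omega>) \<partial>M) = (\<Sum>k\<le>K. of_real (prob {\<omega> \<in> space M. N \<omega> = real k}) * g (real k))"
proof -
  define E where "E k = {\<omega> \<in> space M. N \<omega> = real k}" for k
  have E [measurable]: "E k \<in> events" for k
    unfolding E_def by measurable
  have "(\<integral>\<omega>. g (N \<omega>) \<partial>M) = (\<integral>\<omega>. (\<Sum>k\<le>K. indicator (E k) \<omega> *\<^sub>R g (real k)) \<partial>M)"
  proof (rule Bochner_Integration.integral_cong [OF refl])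
    fix \<omega> assume \<omega>: "\<omega> \<in> space M"
    then obtain j where j: "j \<le> K" "N \<omega> = real j" using range by auto
    have "(\<Sum>k\<le>K. indicator (E k) \<omega> *\<^sub>R g (real k)) = (\<Sum>k\<le>K. if k = j then g (real j) else 0)"
      using \<omega> j by (intro sum.cong) (auto simp: E_def)
    then show "g (N \<omega>) = (\<Sum>k\<le>K. indicator (E k) \<omega> *\<^sub>R g (real k))"
      using j by simp
  qed
  also have "\<dots> = (\<Sum>k\<le>K. of_real (prob (E k)) * g (real k))"
    by (subst Bochner_Integration.integral_sum) (auto simp: scaleR_conv_of_real emeasure_eq_measure)
  finally show ?thesis by (simp add: E_def)
qed

text \<open>The Stein step. Where \<open>I a = 1\<close>, the count is \<open>1 + W + V\<close>, with \<open>W\<close> the contribution of the other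
  neighbours of \<open>a\<close> and \<open>V\<close> that of the rest. Dropping \<open>W\<close> costs at most \<open>\<bar>u\<bar> E (I a W)\<close>; then \<open>V\<close> is
  independent of \<open>I a\<close>, and completing \<open>V\<close> to the whole count costs at most
  \<open>\<bar>u\<bar> E (I a) E (I a + W)\<close>. Summing over \<open>a\<close> compares \<open>E (N exp (i u N))\<close> with its Poisson value.\<close>

lemma (in prob_space) iexp_sum_local_dependence_error:
  fixes I :: "'i \<Rightarrow> 'a \<Rightarrow> real" and B :: "'i \<Rightarrow> 'i set"
  assumes fin: "finite F"
    and meas: "\<And>a. a \<in> F \<Longrightarrow> random_variable borel (I a)"
    and ind: "\<And>a \<omega>. a \<in> F \<Longrightarrow> I a \<omega> = 0 \<or> I a \<omega> = 1"
    and B: "\<And>a. a \<in> F \<Longrightarrow> B a \<subseteq> F" "\<And>a. a \<in> F \<Longrightarrow> a \<in> B a"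
    and indep: "\<And>a. a \<in> F \<Longrightarrow> indep_var borel (I a) borel (\<lambda>\<omega>. \<Sum>b\<in>F - B a. I b \<omega>)"
  defines "N \<equiv> (\<lambda>\<omega>. \<Sum>a\<in>F. I a \<omega>)"
  defines "s1 \<equiv> (\<Sum>a\<in>F. \<Sum>b\<in>B a. expectation (I a) * expectation (I b))"
  defines "s2 \<equiv> (\<Sum>a\<in>F. \<Sum>b\<in>B a - {a}. expectation (\<lambda>\<omega>. I a \<omega> * I b \<omega>))"
  shows "norm ((\<integral>\<omega>. of_real (N \<omega>) * iexp (u * N \<omega>) \<partial>M)
           - of_real (expectation N) * iexp u * (\<integral>\<omega>. iexp (u * N \<omega>) \<partial>M)) \<le> \<bar>u\<bar> * (s1 + s2)"
proof -
  have I_bd: "\<bar>I a \<omega>\<bar> \<le> 1" "0 \<le> I a \<omega>" if "a \<in> F" for a \<omega>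
    using ind[OF that, of \<omega>] by auto
  have I_int: "integrable M (I a)" if "a \<in> F" for a
    using that meas I_bd by (intro integrable_const_bound[of _ 1]) auto
  have II_int: "integrable M (\<lambda>\<omega>. I a \<omega> * I b \<omega>)" if "a \<in> F" "b \<in> F" for a b
    using that meas I_bd
    by (intro integrable_const_bound[of _ 1]) (auto intro!: mult_le_one simp: abs_mult)
  have N_meas [measurable]: "random_variable borel N"
    unfolding N_def using meas by (intro borel_measurable_sum) auto
  define V where "V a = (\<lambda>\<omega>. \<Sum>b\<in>F - B a. I b \<omega>)" for a
  define W where "W a = (\<lambda>\<omega>. \<Sum>b\<in>B a - {a}. I b \<omega>)" for a
  have V_meas [measurable]: "random_variable borel (V a)" if "a \<in> F" for a
    unfolding V_def using meas by (intro borel_measurable_sum) auto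
  have W_meas [measurable]: "random_variable borel (W a)" if "a \<in> F" for a
    unfolding W_def using meas B(1)[OF that] by (intro borel_measurable_sum) auto
  have N_split: "N \<omega> = I a \<omega> + W a \<omega> + V a \<omega>" if "a \<in> F" for a \<omega>
  proof -
    have "N \<omega> = (\<Sum>b\<in>B a. I b \<omega>) + V a \<omega>"
      unfolding N_def V_def using sum.subset_diff[OF B(1)[OF that] fin, of "\<lambda>b. I b \<omega>"] by simp
    also have "(\<Sum>b\<in>B a. I b \<omega>) = I a \<omega> + W a \<omega>"
      unfolding W_def using B[OF that] fin by (intro sum.remove) (auto intro: finite_subset)
    finally show ?thesis .
  qed
  have iexp_int: "integrable M (\<lambda>\<omega>. iexp (u * Z \<omega>))" if "random_variable borel Z" for Z
    using that by (intro integrable_iexp) auto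
  have I_iexp_int: "integrable M (\<lambda>\<omega>. of_real (I a \<omega>) * iexp (u * Z \<omega>))"
    if "a \<in> F" "random_variable borel Z" for Z a
    using that meas I_bd by (intro integrable_const_bound[of _ 1]) (auto simp: norm_mult)
  have W_int: "integrable M (W a)" if "a \<in> F" for a
    unfolding W_def using I_int B(1)[OF that] by (intro Bochner_Integration.integrable_sum) auto
  have one: "norm ((\<integral>\<omega>. of_real (I a \<omega>) * iexp (u * N \<omega>) \<partial>M)
           - of_real (expectation (I a)) * iexp u * (\<integral>\<omega>. iexp (u * N \<omega>) \<partial>M))
       \<le> \<bar>u\<bar> * ((\<Sum>b\<in>B a. expectation (I a) * expectation (I b)) +
                 (\<Sum>b\<in>B a - {a}. expectation (\<lambda>\<omega>. I a \<omega> * I b \<omega>)))"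
    if a: "a \<in> F" for a
  proof -
    note [measurable] = V_meas[OF a] W_meas[OF a] meas[OF a]
    have Ba: "finite (B a)" using B(1)[OF a] fin by (rule finite_subset)
    (* only the value 1 of the indicator contributes, and there the sum is 1 + W + V *)
    have "norm ((\<integral>\<omega>. of_real (I a \<omega>) * iexp (u * N \<omega>) \<partial>M)
           - iexp u * (\<integral>\<omega>. of_real (I a \<omega>) * iexp (u * V a \<omega>) \<partial>M))
         = norm (\<integral>\<omega>. of_real (I a \<omega>) * iexp (u * N \<omega>) - iexp u * (of_real (I a \<omega>) * iexp (u * V a \<omega>)) \<partial>M)"
      using I_iexp_int a by (subst Bochner_Integration.integral_diff) auto
    also have "\<dots> \<le> (\<integral>\<omega>. \<bar>u\<bar> * (I a \<omega> * W a \<omega>) \<partial>M)"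
    proof (rule order_trans[OF integral_norm_bound], rule integral_mono)
      show "integrable M (\<lambda>\<omega>. norm (of_real (I a \<omega>) * iexp (u * N \<omega>) -
               iexp u * (of_real (I a \<omega>) * iexp (u * V a \<omega>))))"
        using I_iexp_int a by (intro integrable_norm Bochner_Integration.integrable_diff integrable_mult_right) auto
      show "integrable M (\<lambda>\<omega>. \<bar>u\<bar> * (I a \<omega> * W a \<omega>))"
        unfolding W_def sum_distrib_left using II_int B(1)[OF a] a
        by (intro Bochner_Integration.integrable_sum integrable_mult_right) auto
      fix \<omega>
      have W0: "0 \<le> W a \<omega>" unfolding W_def using I_bd B(1)[OF a] by (intro sum_nonneg) auto
      show "norm (of_real (I a \<omega>) * iexp (u * N \<omega>) - iexp u * (of_real (I a \<omega>) * iexp (u * V a \<omega>)))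
         \<le> \<bar>u\<bar> * (I a \<omega> * W a \<omega>)"
      proof (cases "I a \<omega> = 0")
        case False
        then have 1: "I a \<omega> = 1" using ind[OF a, of \<omega>] by auto
        have "iexp (u * N \<omega>) = iexp u * iexp (u * V a \<omega>) * iexp (u * W a \<omega>)"
          unfolding N_split[OF a] 1 by (simp add: algebra_simps flip: exp_add)
        then have "iexp (u * N \<omega>) - iexp u * iexp (u * V a \<omega>)
             = iexp u * iexp (u * V a \<omega>) * (iexp (u * W a \<omega>) - 1)"
          by (simp add: algebra_simps)
        then have "norm (iexp (u * N \<omega>) - iexp u * iexp (u * V a \<omega>)) = norm (iexp (u * W a \<omega>) - 1)"
          by (simp add: norm_mult)
        also have "\<dots> \<le> \<bar>u * W a \<omega>\<bar>" by (rule norm_iexp_minus_one_le)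
        finally show ?thesis using 1 W0 by (simp add: abs_mult)
      qed simp
    qed
    also have "\<dots> = \<bar>u\<bar> * (\<Sum>b\<in>B a - {a}. expectation (\<lambda>\<omega>. I a \<omega> * I b \<omega>))"
      unfolding W_def sum_distrib_left using II_int B(1)[OF a] a
      by (subst Bochner_Integration.integral_sum) auto
    finally have e1: "norm ((\<integral>\<omega>. of_real (I a \<omega>) * iexp (u * N \<omega>) \<partial>M)
           - iexp u * (\<integral>\<omega>. of_real (I a \<omega>) * iexp (u * V a \<omega>) \<partial>M))
        \<le> \<bar>u\<bar> * (\<Sum>b\<in>B a - {a}. expectation (\<lambda>\<omega>. I a \<omega> * I b \<omega>))" .
    have ind': "indep_var borel (\<lambda>\<omega>. complex_of_real (I a \<omega>)) borel (\<lambda>\<omega>. iexp (u * V a \<omega>))"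
      using indep_var_compose[OF indep[OF a], of complex_of_real borel "\<lambda>v. iexp (u * v)" borel]
      by (simp add: o_def V_def)
    have e2: "(\<integral>\<omega>. of_real (I a \<omega>) * iexp (u * V a \<omega>) \<partial>M)
        = of_real (expectation (I a)) * (\<integral>\<omega>. iexp (u * V a \<omega>) \<partial>M)"
      using indep_var_lebesgue_integral[OF ind'] I_int[OF a] iexp_int[OF V_meas[OF a]] by simp
    have "norm ((\<integral>\<omega>. iexp (u * V a \<omega>) \<partial>M) - (\<integral>\<omega>. iexp (u * N \<omega>) \<partial>M))
        = norm (\<integral>\<omega>. iexp (u * V a \<omega>) - iexp (u * N \<omega>) \<partial>M)"
      using iexp_int a by (subst Bochner_Integration.integral_diff) auto
    also have "\<dots> \<le> (\<integral>\<omega>. \<bar>u\<bar> * (I a \<omega> + W a \<omega>) \<partial>M)"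
    proof (rule order_trans[OF integral_norm_bound], rule integral_mono)
      show "integrable M (\<lambda>\<omega>. norm (iexp (u * V a \<omega>) - iexp (u * N \<omega>)))"
        using iexp_int a by (intro integrable_norm Bochner_Integration.integrable_diff) auto
      show "integrable M (\<lambda>\<omega>. \<bar>u\<bar> * (I a \<omega> + W a \<omega>))"
        using I_int[OF a] W_int[OF a] by auto
      fix \<omega>
      have IW0: "0 \<le> I a \<omega> + W a \<omega>"
        unfolding W_def using I_bd a B(1)[OF a] by (intro add_nonneg_nonneg sum_nonneg) auto
      have "iexp (u * N \<omega>) = iexp (u * V a \<omega>) * iexp (u * (I a \<omega> + W a \<omega>))"
        unfolding N_split[OF a] by (simp add: algebra_simps flip: exp_add)
      then have "norm (iexp (u * V a \<omega>) - iexp (u * N \<omega>))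
          = norm (iexp (u * V a \<omega>) * (1 - iexp (u * (I a \<omega> + W a \<omega>))))"
        by (simp add: algebra_simps)
      also have "\<dots> = norm (iexp (u * (I a \<omega> + W a \<omega>)) - 1)"
        by (simp add: norm_mult norm_minus_commute)
      also have "\<dots> \<le> \<bar>u * (I a \<omega> + W a \<omega>)\<bar>"
        by (rule norm_iexp_minus_one_le)
      finally show "norm (iexp (u * V a \<omega>) - iexp (u * N \<omega>)) \<le> \<bar>u\<bar> * (I a \<omega> + W a \<omega>)"
        using IW0 by (simp add: abs_mult)
    qed
    also have "\<dots> = \<bar>u\<bar> * (\<Sum>b\<in>B a. expectation (I b))"
    proof -
      have "expectation (W a) = (\<Sum>b\<in>B a - {a}. expectation (I b))"
        unfolding W_def using I_int B(1)[OF a] by (subst Bochner_Integration.integral_sum) auto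
      then show ?thesis
        using I_int[OF a] W_int[OF a] sum.remove[OF Ba B(2)[OF a], of "\<lambda>b. expectation (I b)"] by simp
    qed
    finally have e3: "norm ((\<integral>\<omega>. iexp (u * V a \<omega>) \<partial>M) - (\<integral>\<omega>. iexp (u * N \<omega>) \<partial>M))
        \<le> \<bar>u\<bar> * (\<Sum>b\<in>B a. expectation (I b))" .
    have p0: "0 \<le> expectation (I a)" using I_bd(2)[OF a] by (intro Bochner_Integration.integral_nonneg)
    let ?A = "\<integral>\<omega>. of_real (I a \<omega>) * iexp (u * N \<omega>) \<partial>M"
    let ?V = "\<integral>\<omega>. iexp (u * V a \<omega>) \<partial>M" and ?N = "\<integral>\<omega>. iexp (u * N \<omega>) \<partial>M"
    let ?p = "complex_of_real (expectation (I a))"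
    have "norm (?A - ?p * iexp u * ?N) \<le> norm (?A - iexp u * (?p * ?V)) + norm (iexp u * ?p * (?V - ?N))"
      by (rule order_trans[OF _ norm_triangle_ineq]) (simp add: algebra_simps)
    also have "norm (iexp u * ?p * (?V - ?N)) = expectation (I a) * norm (?V - ?N)"
      using p0 by (simp add: norm_mult)
    also have "\<dots> \<le> expectation (I a) * (\<bar>u\<bar> * (\<Sum>b\<in>B a. expectation (I b)))"
      using e3 p0 by (rule mult_left_mono)
    finally show ?thesis
      using e1 unfolding e2 by (simp add: algebra_simps sum_distrib_left)
  qed
  have "(\<integral>\<omega>. of_real (N \<omega>) * iexp (u * N \<omega>) \<partial>M) = (\<Sum>a\<in>F. \<integral>\<omega>. of_real (I a \<omega>) * iexp (u * N \<omega>) \<partial>M)"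
  proof -
    have "(\<integral>\<omega>. of_real (N \<omega>) * iexp (u * N \<omega>) \<partial>M) = (\<integral>\<omega>. (\<Sum>a\<in>F. of_real (I a \<omega>) * iexp (u * N \<omega>)) \<partial>M)"
      by (intro Bochner_Integration.integral_cong) (auto simp: N_def sum_distrib_right)
    then show ?thesis using I_iexp_int by (simp add: Bochner_Integration.integral_sum)
  qed
  moreover have "expectation N = (\<Sum>a\<in>F. expectation (I a))"
    unfolding N_def using I_int by (subst Bochner_Integration.integral_sum) auto
  ultimately have "norm ((\<integral>\<omega>. of_real (N \<omega>) * iexp (u * N \<omega>) \<partial>M)
           - of_real (expectation N) * iexp u * (\<integral>\<omega>. iexp (u * N \<omega>) \<partial>M))
     = norm (\<Sum>a\<in>F. (\<integral>\<omega>. of_real (I a \<omega>) * iexp (u * N \<omega>) \<partial>M)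
           - of_real (expectation (I a)) * iexp u * (\<integral>\<omega>. iexp (u * N \<omega>) \<partial>M))"
    by (simp add: sum_subtractf sum_distrib_right)
  also have "\<dots> \<le> (\<Sum>a\<in>F. \<bar>u\<bar> * ((\<Sum>b\<in>B a. expectation (I a) * expectation (I b)) +
                 (\<Sum>b\<in>B a - {a}. expectation (\<lambda>\<omega>. I a \<omega> * I b \<omega>))))"
    by (rule sum_norm_le) (rule one)
  also have "\<dots> = \<bar>u\<bar> * (s1 + s2)"
    by (simp add: s1_def s2_def sum.distrib flip: sum_distrib_left)
  finally show ?thesis .
qed

text \<open>The characteristic function of the count, divided by that of the Poisson law with the same mean, has
  value \<open>1\<close> at \<open>0\<close>, and the Stein step bounds its derivative along \<open>[0, s]\<close>. The exponential factor
  bounds the reciprocal of the Poisson characteristic function, through \<open>1 - cos u \<le> u^2 / 2\<close>.\<close>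

lemma (in prob_space) char_local_dependence_poisson:
  fixes I :: "'i \<Rightarrow> 'a \<Rightarrow> real" and B :: "'i \<Rightarrow> 'i set"
  assumes fin: "finite F"
    and meas: "\<And>a. a \<in> F \<Longrightarrow> random_variable borel (I a)"
    and ind: "\<And>a \<omega>. a \<in> F \<Longrightarrow> I a \<omega> = 0 \<or> I a \<omega> = 1"
    and B: "\<And>a. a \<in> F \<Longrightarrow> B a \<subseteq> F" "\<And>a. a \<in> F \<Longrightarrow> a \<in> B a"
    and indep: "\<And>a. a \<in> F \<Longrightarrow> indep_var borel (I a) borel (\<lambda>\<omega>. \<Sum>b\<in>F - B a. I b \<omega>)"
  defines "N \<equiv> (\<lambda>\<omega>. \<Sum>a\<in>F. I a \<omega>)"
  defines "s1 \<equiv> (\<Sum>a\<in>F. \<Sum>b\<in>B a. expectation (I a) * expectation (I b))"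
  defines "s2 \<equiv> (\<Sum>a\<in>F. \<Sum>b\<in>B a - {a}. expectation (\<lambda>\<omega>. I a \<omega> * I b \<omega>))"
  shows "norm ((\<integral>\<omega>. iexp (s * N \<omega>) \<partial>M) - exp (of_real (expectation N) * (iexp s - 1)))
           \<le> s\<^sup>2 * (s1 + s2) * exp (expectation N * s\<^sup>2 / 2)"
proof -
  define lam where "lam = expectation N"
  have N_meas [measurable]: "random_variable borel N"
    unfolding N_def using meas by (intro borel_measurable_sum) auto
  have I0: "0 \<le> I a \<omega>" if "a \<in> F" for a \<omega> using ind[OF that, of \<omega>] by auto
  have N0: "0 \<le> N \<omega>" for \<omega> unfolding N_def using I0 by (intro sum_nonneg)
  have lam0: "0 \<le> lam" unfolding lam_def using N0 by (intro Bochner_Integration.integral_nonneg)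
  have b0: "0 \<le> s1 + s2"
    unfolding s1_def s2_def
    using I0 B(1) by (intro add_nonneg_nonneg sum_nonneg mult_nonneg_nonneg Bochner_Integration.integral_nonneg) auto
  have N_range: "N \<omega> \<in> real ` {..card F}" for \<omega>
  proof -
    have "N \<omega> = (\<Sum>a\<in>F. of_bool (I a \<omega> = 1))"
      unfolding N_def using ind by (intro sum.cong) force+
    also have "\<dots> = real (card {a \<in> F. I a \<omega> = 1})"
      using fin by (simp add: of_bool_def sum.If_cases Int_def)
    finally show ?thesis using fin by (auto intro!: imageI card_mono)
  qed
  define P where "P k = prob {\<omega> \<in> space M. N \<omega> = real k}" for k
  have E: "(\<integral>\<omega>. g (N \<omega>) \<partial>M) = (\<Sum>k\<le>card F. of_real (P k) * g (real k))" for g :: "real \<Rightarrow> complex"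
    unfolding P_def by (rule expectation_of_nat_range) (use N_range in auto)
  define \<Phi> where "\<Phi> z = (\<Sum>k\<le>card F. of_real (P k) * exp (\<i> * z * of_nat k))" for z
  define \<Phi>' where "\<Phi>' z = (\<Sum>k\<le>card F. of_real (P k) * (\<i> * of_nat k * exp (\<i> * z * of_nat k)))" for z
  (* the quotient of the characteristic function by that of the Poisson law *)
  define \<Psi> where "\<Psi> z = \<Phi> z * exp (- (of_real lam * (exp (\<i> * z) - 1)))" for z
  define \<Psi>' where "\<Psi>' z = (\<Phi>' z - of_real lam * \<i> * exp (\<i> * z) * \<Phi> z) * exp (- (of_real lam * (exp (\<i> * z) - 1)))" for z
  have d\<Phi>: "(\<Phi> has_field_derivative \<Phi>' z) (at z)" for z
    unfolding \<Phi>_def \<Phi>'_def by (auto intro!: derivative_eq_intros sum.cong)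
  have d\<Psi>: "(\<Psi> has_field_derivative \<Psi>' z) (at z within T)" for z T
    unfolding \<Psi>_def \<Psi>'_def
    by (auto intro!: derivative_eq_intros d\<Phi> has_field_derivative_at_within[OF d\<Phi>] simp: algebra_simps)
  have \<Phi>_eq: "\<Phi> (of_real u) = (\<integral>\<omega>. iexp (u * N \<omega>) \<partial>M)" for u
    using E[of "\<lambda>x. iexp (u * x)"] by (simp add: \<Phi>_def mult_ac)
  have \<Phi>'_eq: "\<Phi>' (of_real u) = \<i> * (\<integral>\<omega>. of_real (N \<omega>) * iexp (u * N \<omega>) \<partial>M)" for u
    using E[of "\<lambda>x. of_real x * iexp (u * x)"]
    by (simp add: \<Phi>'_def mult_ac sum_distrib_left)
  have norm_exp: "norm (exp (- (of_real lam * (iexp u - 1)))) = exp (lam * (1 - cos u))" for u :: real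
    by (simp add: norm_exp_eq_Re Re_exp algebra_simps)
  have \<Psi>'_bd: "norm (\<Psi>' (of_real u)) \<le> \<bar>u\<bar> * (s1 + s2) * exp (lam * u\<^sup>2 / 2)" for u
  proof -
    let ?D = "(\<integral>\<omega>. of_real (N \<omega>) * iexp (u * N \<omega>) \<partial>M)
           - of_real lam * iexp u * (\<integral>\<omega>. iexp (u * N \<omega>) \<partial>M)"
    have "\<Psi>' (of_real u) = \<i> * ?D * exp (- (of_real lam * (iexp u - 1)))"
      unfolding \<Psi>'_def \<Phi>_eq \<Phi>'_eq by (simp add: algebra_simps)
    then have "norm (\<Psi>' (of_real u)) = norm ?D * exp (lam * (1 - cos u))"
      by (simp only: norm_mult norm_exp norm_ii mult_1)
    also have "\<dots> \<le> (\<bar>u\<bar> * (s1 + s2)) * exp (lam * u\<^sup>2 / 2)"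
    proof (rule mult_mono)
      show "norm ?D \<le> \<bar>u\<bar> * (s1 + s2)"
        unfolding lam_def N_def s1_def s2_def
        by (rule iexp_sum_local_dependence_error) (use assms in auto)
      show "exp (lam * (1 - cos u)) \<le> exp (lam * u\<^sup>2 / 2)"
        using mult_left_mono[OF one_minus_cos_le[of u] lam0] by simp
    qed (use b0 in auto)
    finally show ?thesis .
  qed
  have "norm (\<Psi> (of_real s) - \<Psi> 0) \<le> (\<bar>s\<bar> * (s1 + s2) * exp (lam * s\<^sup>2 / 2)) * norm (of_real s - (0 :: complex))"
  proof (rule field_differentiable_bound[of "closed_segment 0 (of_real s)" \<Psi> \<Psi>'])
    fix z :: complex assume "z \<in> closed_segment 0 (of_real s)"
    then obtain v where v: "0 \<le> v" "v \<le> 1" "z = of_real (v * s)"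
      by (auto simp: in_segment scaleR_conv_of_real)
    have le: "\<bar>v * s\<bar> \<le> \<bar>s\<bar>" using v by (simp add: abs_mult mult_left_le_one_le)
    then have sq: "(v * s)\<^sup>2 \<le> s\<^sup>2" using abs_le_square_iff by blast
    have "norm (\<Psi>' z) \<le> \<bar>v * s\<bar> * (s1 + s2) * exp (lam * (v * s)\<^sup>2 / 2)"
      unfolding v(3) by (rule \<Psi>'_bd)
    also have "\<dots> \<le> \<bar>s\<bar> * (s1 + s2) * exp (lam * s\<^sup>2 / 2)"
      using le sq b0 lam0 by (intro mult_mono) (auto intro!: divide_right_mono mult_left_mono)
    finally show "norm (\<Psi>' z) \<le> \<bar>s\<bar> * (s1 + s2) * exp (lam * s\<^sup>2 / 2)" .
  qed (auto intro: d\<Psi>)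
  moreover have "\<Psi> 0 = 1"
    using \<Phi>_eq[of 0] by (simp add: \<Psi>_def prob_space)
  ultimately have \<Psi>_bd: "norm (\<Psi> (of_real s) - 1) \<le> s\<^sup>2 * (s1 + s2) * exp (lam * s\<^sup>2 / 2)"
    by (simp add: power2_eq_square mult_ac)
  let ?E = "exp (of_real lam * (iexp s - 1))"
  have "exp (- w) * exp w = 1" for w :: complex
    by (simp flip: exp_add)
  then have "\<Phi> (of_real s) - ?E = (\<Psi> (of_real s) - 1) * ?E"
    by (simp only: \<Psi>_def left_diff_distrib mult.assoc mult_1_left mult_1_right)
  then have "norm (\<Phi> (of_real s) - ?E) = norm (\<Psi> (of_real s) - 1) * exp (lam * (cos s - 1))"
    by (simp add: norm_mult norm_exp_eq_Re Re_exp)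
  also have "\<dots> \<le> norm (\<Psi> (of_real s) - 1) * 1"
    using lam0 by (intro mult_left_mono) (auto simp: mult_nonneg_nonpos)
  finally show ?thesis using \<Psi>_bd by (simp add: \<Phi>_eq lam_def)
qed

context prob_space
begin

text \<open>At the point \<open>s = t / sqrt \<lambda>\<close> the exponential factor of the Poisson approximation is the constant
  \<open>exp (t^2 / 2)\<close>, so a relative error of \<open>o(1)\<close> in the linked sums suffices, and
  \<open>\<lambda> (exp (i s) - 1 - i s)\<close> tends to \<open>-t^2 / 2\<close>.\<close>

lemma conv_to_std_normal_local_dependence:
  fixes I :: "nat \<Rightarrow> 'i \<Rightarrow> 'a \<Rightarrow> real" and B :: "nat \<Rightarrow> 'i \<Rightarrow> 'i set"
  assumes fin: "\<And>n. finite (F n)"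
    and meas: "\<And>n a. a \<in> F n \<Longrightarrow> random_variable borel (I n a)"
    and ind: "\<And>n a \<omega>. a \<in> F n \<Longrightarrow> I n a \<omega> = 0 \<or> I n a \<omega> = 1"
    and B: "\<And>n a. a \<in> F n \<Longrightarrow> B n a \<subseteq> F n" "\<And>n a. a \<in> F n \<Longrightarrow> a \<in> B n a"
    and indep: "\<And>n a. a \<in> F n \<Longrightarrow> indep_var borel (I n a) borel (\<lambda>\<omega>. \<Sum>b\<in>F n - B n a. I n b \<omega>)"
    and lam: "filterlim (\<lambda>n. expectation (\<lambda>\<omega>. \<Sum>a\<in>F n. I n a \<omega>)) at_top sequentially"
    and err: "\<forall>\<^sub>F n in sequentially.
        (\<Sum>a\<in>F n. \<Sum>b\<in>B n a. expectation (I n a) * expectation (I n b))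
        + (\<Sum>a\<in>F n. \<Sum>b\<in>B n a - {a}. expectation (\<lambda>\<omega>. I n a \<omega> * I n b \<omega>))
        \<le> err n * expectation (\<lambda>\<omega>. \<Sum>a\<in>F n. I n a \<omega>)"
    and err_lim: "err \<longlonglongrightarrow> 0"
  shows "conv_to_std_normal M (\<lambda>n \<omega>.
     ((\<Sum>a\<in>F n. I n a \<omega>) - expectation (\<lambda>\<omega>. \<Sum>a\<in>F n. I n a \<omega>))
       / sqrt (expectation (\<lambda>\<omega>. \<Sum>a\<in>F n. I n a \<omega>)))"
proof -
  define N where "N n = (\<lambda>\<omega>. \<Sum>a\<in>F n. I n a \<omega>)" for n
  define l where "l n = expectation (N n)" for n
  have N_meas [measurable]: "random_variable borel (N n)" for n
    unfolding N_def using meas by (intro borel_measurable_sum) auto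
  have l_top: "filterlim l at_top sequentially" using lam unfolding l_def N_def .
  have "(\<lambda>n. \<integral>\<omega>. iexp (t * ((N n \<omega> - l n) / sqrt (l n))) \<partial>M) \<longlonglongrightarrow> of_real (exp (- (t\<^sup>2) / 2))" for t
  proof -
    define s where "s n = t / sqrt (l n)" for n
    define w where "w n = of_real (l n) * (iexp (s n) - 1 - \<i> * of_real (s n))" for n
    have lpos: "\<forall>\<^sub>F n in sequentially. 0 < l n"
      using l_top by (simp add: filterlim_at_top_dense)
    have w_lim: "w \<longlonglongrightarrow> of_real (- (t\<^sup>2) / 2)"
    proof (rule LIM_zero_cancel, rule Lim_null_comparison)
      show "\<forall>\<^sub>F n in sequentially. norm (w n - of_real (- (t\<^sup>2) / 2)) \<le> \<bar>t\<bar> ^ 3 * inverse (sqrt (l n))"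
        using lpos
      proof eventually_elim
        case (elim n)
        have ls: "l n * (s n)\<^sup>2 = t\<^sup>2" using elim by (simp add: s_def power_divide)
        have "w n - of_real (- (t\<^sup>2) / 2) = of_real (l n) * (iexp (s n) - (\<Sum>k\<le>2. (\<i> * of_real (s n)) ^ k / fact k))"
          unfolding w_def ls[symmetric]
          by (simp add: numeral_2_eq_2 algebra_simps power2_eq_square)
        then have "norm (w n - of_real (- (t\<^sup>2) / 2))
            = l n * norm (iexp (s n) - (\<Sum>k\<le>2. (\<i> * of_real (s n)) ^ k / fact k))"
          using elim by (simp only: norm_mult norm_of_real abs_of_pos)
        also have "\<dots> \<le> l n * (\<bar>s n\<bar> ^ 3 / 6)"
          using elim iexp_approx1[of "s n" 2] by (intro mult_left_mono) (auto simp: fact_numeral)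
        also have "\<dots> \<le> l n * \<bar>s n\<bar> ^ 3"
          using elim by (intro mult_left_mono) auto
        also have "\<dots> = \<bar>t\<bar> ^ 3 * inverse (sqrt (l n))"
        proof -
          have "(sqrt (l n)) ^ 3 = l n * sqrt (l n)" using elim by (simp add: power3_eq_cube)
          then show ?thesis using elim by (simp add: s_def abs_divide power_divide field_simps)
        qed
        finally show ?case .
      qed
      show "(\<lambda>n. \<bar>t\<bar> ^ 3 * inverse (sqrt (l n))) \<longlonglongrightarrow> 0"
        by (intro tendsto_mult_right_zero tendsto_inverse_0_at_top filterlim_compose[OF sqrt_at_top l_top])
    qed
    have main: "(\<lambda>n. exp (w n)) \<longlonglongrightarrow> of_real (exp (- (t\<^sup>2) / 2))"
      using tendsto_exp[OF w_lim] unfolding exp_of_real .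
    have "(\<lambda>n. (\<integral>\<omega>. iexp (t * ((N n \<omega> - l n) / sqrt (l n))) \<partial>M) - exp (w n)) \<longlonglongrightarrow> 0"
    proof (rule Lim_null_comparison)
      show "\<forall>\<^sub>F n in sequentially. norm ((\<integral>\<omega>. iexp (t * ((N n \<omega> - l n) / sqrt (l n))) \<partial>M) - exp (w n))
          \<le> t\<^sup>2 * exp (t\<^sup>2 / 2) * err n"
        using lpos err
      proof eventually_elim
        case (elim n)
        have ls: "l n * (s n)\<^sup>2 = t\<^sup>2" using elim(1) by (simp add: s_def power_divide)
        let ?S = "(\<Sum>a\<in>F n. \<Sum>b\<in>B n a. expectation (I n a) * expectation (I n b))
        + (\<Sum>a\<in>F n. \<Sum>b\<in>B n a - {a}. expectation (\<lambda>\<omega>. I n a \<omega> * I n b \<omega>))"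
        have arg: "t * ((N n \<omega> - l n) / sqrt (l n)) = s n * N n \<omega> - l n * s n" for \<omega>
          using elim(1) by (simp add: s_def field_simps)
        have "(\<integral>\<omega>. iexp (t * ((N n \<omega> - l n) / sqrt (l n))) \<partial>M)
            = (\<integral>\<omega>. iexp (s n * N n \<omega>) * iexp (- (l n * s n)) \<partial>M)"
          unfolding arg by (intro Bochner_Integration.integral_cong refl) (simp add: algebra_simps flip: exp_add)
        also have "\<dots> = (\<integral>\<omega>. iexp (s n * N n \<omega>) \<partial>M) * iexp (- (l n * s n))"
          by (rule integral_mult_left_zero)
        finally have 1: "(\<integral>\<omega>. iexp (t * ((N n \<omega> - l n) / sqrt (l n))) \<partial>M)
            = (\<integral>\<omega>. iexp (s n * N n \<omega>) \<partial>M) * iexp (- (l n * s n))" .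
        have "exp (w n) = exp (of_real (l n) * (iexp (s n) - 1) + \<i> * of_real (- (l n * s n)))"
          by (rule arg_cong[of _ _ exp]) (simp add: w_def algebra_simps)
        then have 2: "exp (w n) = exp (of_real (l n) * (iexp (s n) - 1)) * iexp (- (l n * s n))"
          by (simp only: exp_add)
        have "norm ((\<integral>\<omega>. iexp (t * ((N n \<omega> - l n) / sqrt (l n))) \<partial>M) - exp (w n))
            = norm ((\<integral>\<omega>. iexp (s n * N n \<omega>) \<partial>M) - exp (of_real (l n) * (iexp (s n) - 1)))"
          unfolding 1 2 left_diff_distrib[symmetric] norm_mult by (simp only: norm_exp_i_times mult_1_right)
        also have "\<dots> \<le> (s n)\<^sup>2 * ?S * exp (l n * (s n)\<^sup>2 / 2)"
          unfolding l_def N_def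
          by (rule char_local_dependence_poisson) (use fin meas ind B indep in auto)
        also have "\<dots> \<le> (s n)\<^sup>2 * (err n * l n) * exp (l n * (s n)\<^sup>2 / 2)"
          using elim(2) unfolding l_def N_def by (intro mult_right_mono mult_left_mono) auto
        also have "\<dots> = t\<^sup>2 * exp (t\<^sup>2 / 2) * err n"
          unfolding ls[symmetric] by simp
        finally show ?case .
      qed
      show "(\<lambda>n. t\<^sup>2 * exp (t\<^sup>2 / 2) * err n) \<longlonglongrightarrow> 0"
        using err_lim by (rule tendsto_mult_right_zero)
    qed
    from Lim_transform[OF main this] show ?thesis .
  qed
  then have "conv_to_std_normal M (\<lambda>n \<omega>. (N n \<omega> - l n) / sqrt (l n))"
    by (subst conv_to_std_normal_iff_char) auto
  then show ?thesis unfolding l_def N_def .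
qed

end

section \<open>Growth of slowly varying functions\<close>

lemma measure_lborel_translate:
  fixes a :: "'v::euclidean_space"
  assumes [measurable]: "A \<in> sets borel"
  shows "measure lborel {z. z - a \<in> A} = measure lborel A"
proof -
  have "measure lborel A = measure (distr lborel borel ((+) (- a))) A"
    by (simp add: lborel_distr_plus)
  also have "\<dots> = measure lborel {z. z - a \<in> A}"
    by (subst measure_distr) (auto simp: vimage_def)
  finally show ?thesis ..
qed

text \<open>The set where the tail of the sequence is small increases to the whole interval \<open>[0, 2]\<close>, hence
  eventually fills more than three quarters of it.\<close>

lemma measure_large_eventually_bounded:
  fixes f :: "nat \<Rightarrow> real \<Rightarrow> real"
  assumes [measurable]: "\<And>k. f k \<in> borel_measurable borel"
    and lim: "\<And>y. (\<lambda>k. f k y) \<longlonglongrightarrow> 0" and \<delta>: "0 < \<delta>"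
  shows "\<forall>\<^sub>F n in sequentially. 3/2 < measure lborel {y \<in> {0..2}. \<forall>k\<ge>n. \<bar>f k y\<bar> < \<delta>}"
proof -
  define V where "V n = {y \<in> {0..2}. \<forall>k\<ge>n. \<bar>f k y\<bar> < \<delta>}" for n
  have meas: "V n \<in> sets lborel" for n
    unfolding V_def by measurable
  have UN: "(\<Union>n. V n) = {0..2}"
  proof
    show "{0..2} \<subseteq> (\<Union>n. V n)"
    proof
      fix y :: real assume y: "y \<in> {0..2}"
      have "\<forall>\<^sub>F k in sequentially. \<bar>f k y\<bar> < \<delta>"
        using tendstoD[OF lim \<delta>, of y] by simp
      then show "y \<in> (\<Union>n. V n)" using y by (auto simp: V_def eventually_sequentially)
    qed
  qed (auto simp: V_def)
  have "(\<lambda>n. measure lborel (V n)) \<longlonglongrightarrow> measure lborel (\<Union>n. V n)"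
  proof (rule Lim_measure_incseq)
    show "incseq V" unfolding V_def by (rule incseq_SucI) auto
  qed (use meas UN in auto)
  then have "(\<lambda>n. measure lborel (V n)) \<longlonglongrightarrow> 2" unfolding UN by simp
  from order_tendstoD(1)[OF this, of "3/2"] show ?thesis unfolding V_def by simp
qed

text \<open>The uniform convergence theorem of Karamata in additive form. If it failed along \<open>x n\<close> and \<open>u n\<close>,
  most points \<open>y\<close> of \<open>[0, 2]\<close> would have \<open>h (x n + y)\<close> close to \<open>h (x n)\<close>, and most points \<open>z\<close> of
  \<open>[u n, u n + 2]\<close> would have \<open>h (x n + z)\<close> close to \<open>h (x n + u n)\<close>. A point in both sets gives a
  contradiction.\<close>

lemma slowly_varying_uniform:
  fixes h :: "real \<Rightarrow> real"
  assumes h [measurable]: "h \<in> borel_measurable borel"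
    and lim: "\<And>u. ((\<lambda>x. h (x + u) - h x) \<longlongrightarrow> 0) at_top" and \<delta>: "0 < \<delta>"
  shows "\<exists>X. \<forall>x\<ge>X. \<forall>u\<in>{0..1}. \<bar>h (x + u) - h x\<bar> < \<delta>"
proof (rule ccontr)
  assume "\<not> ?thesis"
  then have "\<forall>n::nat. \<exists>x u. real n \<le> x \<and> u \<in> {0..1} \<and> \<delta> \<le> \<bar>h (x + u) - h x\<bar>"
    by (meson not_less)
  then obtain x u where x: "\<And>n. real n \<le> x n" and u: "\<And>n. u n \<in> {0..1}"
    and far: "\<And>n. \<delta> \<le> \<bar>h (x n + u n) - h (x n)\<bar>"
    by metis
  have x_top: "filterlim x at_top sequentially"
    using x by (intro filterlim_at_top_mono[OF filterlim_real_sequentially]) auto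
  have xu_top: "filterlim (\<lambda>n. x n + u n) at_top sequentially"
    using u by (intro filterlim_at_top_mono[OF x_top]) auto
  have ev: "\<forall>\<^sub>F n in sequentially.
      3/2 < measure lborel {y \<in> {0..2}. \<forall>k\<ge>n. \<bar>h (x k + y) - h (x k)\<bar> < \<delta> / 2} \<and>
      3/2 < measure lborel {y \<in> {0..2}. \<forall>k\<ge>n. \<bar>h ((x k + u k) + y) - h (x k + u k)\<bar> < \<delta> / 2}"
    using \<delta> by (intro eventually_conj measure_large_eventually_bounded
        filterlim_compose[OF lim x_top] filterlim_compose[OF lim xu_top]) auto
  then obtain n where
    "3/2 < measure lborel {y \<in> {0..2}. \<forall>k\<ge>n. \<bar>h (x k + y) - h (x k)\<bar> < \<delta> / 2}"
    "3/2 < measure lborel {y \<in> {0..2}. \<forall>k\<ge>n. \<bar>h ((x k + u k) + y) - h (x k + u k)\<bar> < \<delta> / 2}"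
    using eventually_happens'[OF sequentially_bot ev] by blast
  define V where "V = {y \<in> {0..2}. \<forall>k\<ge>n. \<bar>h (x k + y) - h (x k)\<bar> < \<delta> / 2}"
  define W where "W = {y \<in> {0..2}. \<forall>k\<ge>n. \<bar>h ((x k + u k) + y) - h (x k + u k)\<bar> < \<delta> / 2}"
  define W' where "W' = {z. z - u n \<in> W}"
  have [measurable]: "V \<in> sets borel" "W \<in> sets borel" unfolding V_def W_def by measurable
  have [measurable]: "W' \<in> sets borel" unfolding W'_def by measurable
  have sub: "V \<subseteq> {0..3}" "W' \<subseteq> {0..3}"
    using u[of n] by (auto simp: V_def W_def W'_def)
  have big: "3/2 < measure lborel V" "3/2 < measure lborel W'"
    unfolding W'_def using measure_lborel_translate[of W "u n"]
      \<open>3/2 < measure lborel {y \<in> {0..2}. \<forall>k\<ge>n. \<bar>h (x k + y) - h (x k)\<bar> < \<delta> / 2}\<close>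
      \<open>3/2 < measure lborel {y \<in> {0..2}. \<forall>k\<ge>n. \<bar>h ((x k + u k) + y) - h (x k + u k)\<bar> < \<delta> / 2}\<close>
    by (simp_all add: V_def W_def)
  have fin: "emeasure lborel A \<noteq> \<infinity>" if "A \<subseteq> {0..3}" for A :: "real set"
    using emeasure_mono[OF that, of lborel] by (auto simp: top_unique)
  (* two subsets of an interval of length 3, each of measure more than 3/2, must meet *)
  have "V \<inter> W' \<noteq> {}"
  proof
    assume "V \<inter> W' = {}"
    then have "measure lborel V + measure lborel W' = measure lborel (V \<union> W')"
      using fin sub by (intro measure_Union[symmetric]) auto
    also have "\<dots> \<le> measure lborel {0..3::real}"
      using sub by (intro measure_mono_fmeasurable fmeasurableI) auto
    finally show False using big by simp
  qed
  then obtain z where z: "z \<in> V" "z \<in> W'" by blast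
  have "\<bar>h (x n + z) - h (x n)\<bar> < \<delta> / 2" using z(1) by (auto simp: V_def)
  moreover have "\<bar>h (x n + z) - h (x n + u n)\<bar> < \<delta> / 2"
    using z(2) by (auto simp: W'_def W_def)
  ultimately show False using far[of n] by linarith
qed

text \<open>On the logarithmic scale each unit step increases \<open>h\<close> by at most \<open>\<delta> / 2\<close> once uniformity has set in, so
  \<open>h\<close> grows at most linearly with slope \<open>\<delta> / 2\<close>.\<close>

lemma slowly_varying_powr_bound:
  assumes L: "slowly_varying L" and \<delta>: "0 < \<delta>"
  shows "((\<lambda>x. L x / x powr \<delta>) \<longlongrightarrow> 0) at_top"
proof -
  (* on the logarithmic scale slow variation is additive; max keeps the argument in the domain *)
  define h where "h x = ln (L (exp (max 0 x)))" for x
  have Lpos: "0 < L x" if "1 \<le> x" for x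
    using L that by (auto simp: slowly_varying_def)
  have h_meas: "h \<in> borel_measurable borel"
  proof -
    have "(\<lambda>x::real. exp (max 0 x)) \<in> borel \<rightarrow>\<^sub>M restrict_space borel {1..}"
      by (intro measurable_restrict_space2) auto
    from measurable_compose[OF this, of L borel] L show ?thesis
      unfolding h_def slowly_varying_def by (intro borel_measurable_ln) auto
  qed
  have h_lim: "((\<lambda>x. h (x + u) - h x) \<longlongrightarrow> 0) at_top" for u
  proof -
    have "((\<lambda>x. L (exp u * exp x) / L (exp x)) \<longlongrightarrow> 1) at_top"
      using L exp_at_top unfolding slowly_varying_def
      by (intro filterlim_compose[of "\<lambda>x. L (exp u * x) / L x" _ at_top exp]) auto
    then have "((\<lambda>x. ln (L (exp u * exp x) / L (exp x))) \<longlongrightarrow> ln 1) at_top"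
      by (intro tendsto_ln) auto
    moreover have "\<forall>\<^sub>F x in at_top. ln (L (exp u * exp x) / L (exp x)) = h (x + u) - h x"
      using eventually_ge_at_top[of "max 0 (- u)"]
    proof eventually_elim
      case (elim x)
      have "0 < L (exp x)" "0 < L (exp u * exp x)"
        using elim by (auto intro!: Lpos simp flip: exp_add)
      then show ?case using elim
        by (simp add: h_def ln_div exp_add mult.commute max_absorb2)
    qed
    ultimately show ?thesis by (simp add: filterlim_cong)
  qed
  obtain X where X: "\<And>x u. X \<le> x \<Longrightarrow> u \<in> {0..1} \<Longrightarrow> \<bar>h (x + u) - h x\<bar> < \<delta> / 2"
    using slowly_varying_uniform[OF h_meas h_lim half_gt_zero[OF \<delta>]] by blast
  have step: "h (X + real k + u) \<le> h X + \<delta> / 2 * (real k + 1)" if "u \<in> {0..1}" for k u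
    using that
  proof (induction k arbitrary: u)
    case 0
    then have "\<bar>h (X + u) - h X\<bar> < \<delta> / 2" by (intro X) auto
    then have "h (X + u) \<le> h X + \<delta> / 2" by linarith
    then show ?case by simp
  next
    case (Suc k)
    have "h (X + real (Suc k)) \<le> h X + \<delta> / 2 * (real k + 1)"
      using Suc.IH[of 1] by (simp add: add_ac)
    moreover have "\<bar>h (X + real (Suc k) + u) - h (X + real (Suc k))\<bar> < \<delta> / 2"
      using X[of "X + real (Suc k)" u] Suc.prems by simp
    ultimately have "h (X + real (Suc k) + u) \<le> h X + \<delta> / 2 * (real k + 1) + \<delta> / 2"
      by linarith
    then show ?case by (simp add: field_simps)
  qed
  have bound: "h x \<le> h X + \<delta> / 2 * (x - X + 1)" if "X \<le> x" for x
  proof -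
    define k where "k = nat \<lfloor>x - X\<rfloor>"
    have k: "real k \<le> x - X" "x - X < real k + 1" using that by (auto simp: k_def)
    then have "h x \<le> h X + \<delta> / 2 * (real k + 1)"
      using step[of "x - X - real k" k] by simp
    also have "\<dots> \<le> h X + \<delta> / 2 * (x - X + 1)" using k \<delta> by simp
    finally show ?thesis .
  qed
  define C where "C = exp (h X + \<delta> / 2 * (1 - X))"
  have "\<forall>\<^sub>F x in at_top. norm (L x / x powr \<delta>) \<le> C * x powr (- (\<delta> / 2))"
    using eventually_ge_at_top[of "max 1 (exp X)"]
  proof eventually_elim
    case (elim x)
    then have x: "1 \<le> x" "X \<le> ln x" by (auto simp: ln_ge_iff)
    have "ln (L x) = h (ln x)" using x by (simp add: h_def)
    also have "\<dots> \<le> h X + \<delta> / 2 * (ln x - X + 1)" using x by (intro bound)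
    finally have "exp (ln (L x)) \<le> exp (h X + \<delta> / 2 * (1 - X) + \<delta> / 2 * ln x)"
      by (simp add: field_simps)
    then have "L x \<le> C * x powr (\<delta> / 2)"
      using x Lpos[OF x(1)] by (simp add: C_def exp_add powr_def)
    then have "L x / x powr \<delta> \<le> C * x powr (\<delta> / 2) / x powr \<delta>"
      by (intro divide_right_mono) auto
    also have "\<dots> = C * x powr (- (\<delta> / 2))"
      using x by (simp add: powr_diff[symmetric] flip: times_divide_eq_right)
    finally show ?case using Lpos[OF x(1)] by simp
  qed
  moreover have "((\<lambda>x. C * x powr (- (\<delta> / 2))) \<longlongrightarrow> 0) at_top"
    using \<delta> by (intro tendsto_mult_right_zero tendsto_neg_powr filterlim_ident) auto
  ultimately show ?thesis by (rule Lim_null_comparison)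
qed

section \<open>Independence of separated index sets\<close>

lemma has_densityD:
  assumes "has_density M Y f"
  shows "f \<in> borel_measurable borel" "0 \<le> f x" "Y \<in> borel_measurable M"
    "distr M borel Y = density lborel (\<lambda>x. ennreal (f x))"
proof -
  have d: "distributed M lborel Y (\<lambda>x. ennreal (f x))"
    using assms by (simp add: has_density_def)
  show "f \<in> borel_measurable borel" "0 \<le> f x" using assms by (simp_all add: has_density_def)
  show "Y \<in> borel_measurable M" using distributed_measurable[OF d] by simp
  have "distr M borel Y = distr M lborel Y" by (rule distr_cong) auto
  then show "distr M borel Y = density lborel (\<lambda>x. ennreal (f x))"
    using distributed_distr_eq_density[OF d] by simp
qed

locale stationary_m_dependent = prob_space M
  for M :: "'s measure" +
  fixes X :: "nat \<Rightarrow> 's \<Rightarrow> 'v::euclidean_space" and m :: nat and p :: "'v \<Rightarrow> real"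
  assumes X_density: "\<And>i. 1 \<le> i \<Longrightarrow> has_density M (X i) p"
    and X_stationary: "strictly_stationary M X"
    and X_m_dependent: "m_dependent m M X"
    and X_assumption_A: "assumption_A M X p"
begin

lemma X_measurable: "1 \<le> i \<Longrightarrow> random_variable borel (X i)"
  using has_densityD(3)[OF X_density] .

definition separated :: "nat set \<Rightarrow> nat set \<Rightarrow> bool" where
  "separated S T \<longleftrightarrow> (\<forall>s\<in>S. \<forall>t\<in>T. s + m < t \<or> t + m < s)"

lemma separated_sym: "separated S T \<Longrightarrow> separated T S"
  by (auto simp: separated_def)

abbreviation cyl :: "(nat \<Rightarrow> 'v set) \<Rightarrow> nat set \<Rightarrow> 's set" where
  "cyl A S \<equiv> {\<omega> \<in> space M. \<forall>i\<in>S. X i \<omega> \<in> A i}"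

text \<open>Both index sets are contained in blocks of the kind that occurs in the definition of \<open>m\<close>-dependence.\<close>

lemma prob_cyl_past_future:
  assumes A: "\<And>i. A i \<in> sets borel" and fin: "finite U" "finite V"
    and pos: "\<And>u. u \<in> U \<Longrightarrow> 1 \<le> u" and gap: "\<And>u v. u \<in> U \<Longrightarrow> v \<in> V \<Longrightarrow> u + m < v"
  shows "prob (cyl A (U \<union> V)) = prob (cyl A U) * prob (cyl A V)"
proof (cases "U = {} \<or> V = {}")
  case True
  then show ?thesis by (auto simp: prob_space)
next
  case False
  define a r b s where "a = Max U" and "r = a - 1" and "b = Min V" and "s = Max V - b"
  have aU: "a \<in> U" and bV: "b \<in> V" using False fin by (auto simp: a_def b_def)
  have a1: "1 \<le> a" using pos aU .
  have b1: "a + m < b" using gap aU bV .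
  have U: "U \<subseteq> {a - r..a}" using fin False pos a1 by (auto simp: a_def r_def)
  have V: "V \<subseteq> {b..b + s}" using fin False by (auto simp: b_def s_def intro: trans_le_add1)
  let ?XU = "\<lambda>\<omega>. \<lambda>i\<in>{a - r..a}. X i \<omega>" and ?XV = "\<lambda>\<omega>. \<lambda>i\<in>{b..b + s}. X i \<omega>"
  let ?MU = "PiM {a - r..a} (\<lambda>_. borel :: 'v measure)" and ?MV = "PiM {b..b + s} (\<lambda>_. borel :: 'v measure)"
  have ind: "indep_var ?MU ?XU ?MV ?XV"
    using X_m_dependent[unfolded m_dependent_def, rule_format, of r a b s] a1 b1 by (simp add: r_def)
  define EU where "EU = {f \<in> space ?MU. \<forall>i\<in>U. f i \<in> A i}"
  define EV where "EV = {f \<in> space ?MV. \<forall>i\<in>V. f i \<in> A i}"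
  have meas: "{f \<in> space (PiM J (\<lambda>_. borel :: 'v measure)). \<forall>i\<in>I. f i \<in> A i} \<in> sets (PiM J (\<lambda>_. borel))"
    if "I \<subseteq> J" "finite I" for I J :: "nat set"
  proof (rule sets.sets_Collect_finite_All[OF _ that(2)])
    fix i assume "i \<in> I"
    then have "(\<lambda>f. f i) \<in> PiM J (\<lambda>_. borel :: 'v measure) \<rightarrow>\<^sub>M borel"
      using that by (intro measurable_component_singleton) auto
    from measurable_sets[OF this A[of i]]
    show "{f \<in> space (PiM J (\<lambda>_. borel :: 'v measure)). f i \<in> A i} \<in> sets (PiM J (\<lambda>_. borel))"
      by (simp add: vimage_def Int_def conj_commute)
  qed
  have E: "EU \<in> sets ?MU" "EV \<in> sets ?MV"
    unfolding EU_def EV_def using meas U V fin by auto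
  have eqU: "?XU -` EU \<inter> space M = cyl A U" and eqV: "?XV -` EV \<inter> space M = cyl A V"
    using U V by (auto simp: EU_def EV_def space_PiM)
  have "cyl A (U \<union> V) = cyl A U \<inter> cyl A V" by auto
  also have "\<dots> = (\<lambda>x. (?XU x, ?XV x)) -` (EU \<times> EV) \<inter> space M"
    unfolding eqU[symmetric] eqV[symmetric] by auto
  finally have "cyl A (U \<union> V) = (\<lambda>x. (?XU x, ?XV x)) -` (EU \<times> EV) \<inter> space M" .
  then show ?thesis
    using indep_varD[OF ind E] eqU eqV by simp
qed

text \<open>The definition of \<open>m\<close>-dependence separates only past from future, whereas the indices of \<open>S\<close> and \<open>T\<close>
  may interlace. If \<open>S\<close> reaches beyond the maximum of \<open>T\<close>, its part beyond that maximum is split off, both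
  from the union and from \<open>S\<close>; the rest is smaller and is handled by induction.\<close>

lemma prob_cyl_separated:
  assumes A: "\<And>i. A i \<in> sets borel" and "finite S" "finite T" "separated S T"
    and "\<And>i. i \<in> S \<union> T \<Longrightarrow> 1 \<le> i"
  shows "prob (cyl A (S \<union> T)) = prob (cyl A S) * prob (cyl A T)"
  using assms(2-)
proof (induction "card S + card T" arbitrary: S T rule: less_induct)
  case less
  have step: "prob (cyl A (S' \<union> T')) = prob (cyl A S') * prob (cyl A T')"
    if eq: "card S' + card T' = card S + card T" and fin: "finite S'" "finite T'"
      and sep: "separated S' T'" and pos: "\<And>i. i \<in> S' \<union> T' \<Longrightarrow> 1 \<le> i"
      and ne: "S' \<noteq> {}" "T' \<noteq> {}" and lt: "Max T' < Max S'" for S' T'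
  proof -
    (* cut S' at the largest element of T': what lies beyond is future for everything before *)
    define t where "t = Max T'"
    define S1 where "S1 = {s \<in> S'. s < t}"
    define S2 where "S2 = {s \<in> S'. t < s}"
    have tT: "t \<in> T'" using fin ne by (simp add: t_def)
    have "t \<notin> S'" using sep tT by (auto simp: separated_def)
    then have S': "S' = S1 \<union> S2" by (auto simp: S1_def S2_def) (metis linorder_neqE_nat)
    have "Max S' \<in> S2" using lt fin ne by (simp add: S2_def t_def)
    then have "Max S' \<in> S'" "Max S' \<notin> S1" by (simp_all add: S1_def S2_def)
    moreover have sub: "S1 \<subseteq> S'" "S2 \<subseteq> S'" by (auto simp: S1_def S2_def)
    ultimately have "S1 \<subset> S'" by blast
    then have "card S1 < card S'" using fin by (intro psubset_card_mono)
    then have "card S1 + card T' < card S + card T" using eq by simp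
    then have IH: "prob (cyl A (S1 \<union> T')) = prob (cyl A S1) * prob (cyl A T')"
    proof (rule less.hyps)
      show "finite S1" "finite T'" using fin by (simp_all add: S1_def)
      show "separated S1 T'" using sep by (simp add: S1_def separated_def)
      show "1 \<le> i" if "i \<in> S1 \<union> T'" for i using pos[of i] that by (auto simp: S1_def)
    qed
    have T_le: "x \<le> t" if "x \<in> T'" for x using fin that by (simp add: t_def)
    have gap: "t + m < v" if "v \<in> S2" for v
      using that sep tT by (force simp: S2_def separated_def)
    have fin12: "finite S1" "finite S2" using sub fin by (auto intro: finite_subset)
    have pos1: "1 \<le> i" if "i \<in> S1 \<union> T'" for i using that sub pos by blast
    have gap1: "u + m < v" if "u \<in> S1 \<union> T'" "v \<in> S2" for u v
      using gap[OF that(2)] that(1) T_le[of u] by (auto simp: S1_def)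
    have "cyl A (S' \<union> T') = cyl A ((S1 \<union> T') \<union> S2)" unfolding S' by (simp add: Un_ac)
    also have "prob \<dots> = prob (cyl A (S1 \<union> T')) * prob (cyl A S2)"
      by (rule prob_cyl_past_future[OF A]) (use fin fin12 pos1 gap1 in auto)
    finally have "prob (cyl A (S' \<union> T')) = prob (cyl A (S1 \<union> T')) * prob (cyl A S2)" .
    moreover have "prob (cyl A S') = prob (cyl A S1) * prob (cyl A S2)"
      unfolding S' by (rule prob_cyl_past_future[OF A]) (use fin12 pos1 gap1 in auto)
    ultimately show ?thesis using IH by simp
  qed
  show ?case
  proof (cases "S = {} \<or> T = {}")
    case True
    then show ?thesis by (auto simp: prob_space)
  next
    case False
    then have "Max S \<in> S" "Max T \<in> T" using less.prems by auto
    then have "Max S \<noteq> Max T"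
      using less.prems(3) unfolding separated_def by fastforce
    then consider "Max T < Max S" | "Max S < Max T" by linarith
    then show ?thesis
    proof cases
      case 1
      then show ?thesis using less.prems False by (intro step) auto
    next
      case 2
      then have "prob (cyl A (T \<union> S)) = prob (cyl A T) * prob (cyl A S)"
        using less.prems False by (intro step) (auto intro: separated_sym)
      then show ?thesis by (simp add: Un_commute mult.commute)
    qed
  qed
qed

text \<open>Cylinder events form a generator that is stable under intersections, so the product formula for them
  extends to the generated sigma-algebras.\<close>

lemma indep_var_separated:
  assumes fin: "finite S" "finite T" and sep: "separated S T"
    and pos: "\<And>i. i \<in> S \<union> T \<Longrightarrow> 1 \<le> i"
  shows "indep_var (PiM S (\<lambda>_. borel)) (\<lambda>\<omega>. \<lambda>i\<in>S. X i \<omega>) (PiM T (\<lambda>_. borel)) (\<lambda>\<omega>. \<lambda>i\<in>T. X i \<omega>)"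
proof -
  let ?X = "\<lambda>J \<omega>. \<lambda>i\<in>J. X i \<omega>"
  let ?M = "\<lambda>J::nat set. PiM J (\<lambda>_. borel :: 'v measure)"
  let ?G = "\<lambda>J. {?X J -` E \<inter> space M |E. E \<in> prod_algebra J (\<lambda>_. borel)}"
  have rv: "random_variable (?M J) (?X J)" if "\<And>i. i \<in> J \<Longrightarrow> 1 \<le> i" for J
    using that by (intro measurable_restrict X_measurable) auto
  have sets: "{?X J -` E \<inter> space M |E. E \<in> sets (?M J)} = sigma_sets (space M) (?G J)" for J
    unfolding sets_PiM by (rule sigma_sets_vimage_commute) auto
  have cyl: "\<exists>A. (\<forall>i. A i \<in> sets borel) \<and> E = cyl A J" if E: "E \<in> ?G J" and J: "finite J" for E J
  proof -
    from E obtain A where A: "A \<in> (\<Pi> j\<in>J. sets borel)" "E = ?X J -` (Pi\<^sub>E J A) \<inter> space M"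
      unfolding prod_algebra_eq_finite[OF J] by auto
    then show ?thesis
      by (intro exI[of _ "\<lambda>i. if i \<in> J then A i else UNIV"]) (auto simp: PiE_iff)
  qed
  have stable: "Int_stable (?G J)" for J
  proof (rule Int_stableI)
    fix a b assume "a \<in> ?G J" "b \<in> ?G J"
    then obtain E E' where "E \<in> prod_algebra J (\<lambda>_. borel)" "E' \<in> prod_algebra J (\<lambda>_. borel)"
      "a = ?X J -` E \<inter> space M" "b = ?X J -` E' \<inter> space M" by auto
    note E = this
    have "E \<inter> E' \<in> prod_algebra J (\<lambda>_. borel)"
      using Int_stable_prod_algebra[of J "\<lambda>_. borel"] E unfolding Int_stable_def by blast
    moreover have "a \<inter> b = ?X J -` (E \<inter> E') \<inter> space M" unfolding E by auto
    ultimately show "a \<inter> b \<in> ?G J" by (intro CollectI exI conjI)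
  qed
  have "indep_set (?G S) (?G T)"
  proof (rule indep_setI)
    have "?G J \<subseteq> events" if "\<And>i. i \<in> J \<Longrightarrow> 1 \<le> i" for J
      using measurable_sets[OF rv[OF that]] by (auto simp: sets_PiM)
    then show "?G S \<subseteq> events" "?G T \<subseteq> events" using pos by auto
    fix a b assume "a \<in> ?G S" "b \<in> ?G T"
    then have "\<exists>A. (\<forall>i. A i \<in> sets borel) \<and> a = cyl A S" "\<exists>A. (\<forall>i. A i \<in> sets borel) \<and> b = cyl A T"
      using cyl[OF _ fin(1)] cyl[OF _ fin(2)] by (simp_all only:)
    then obtain A A' where A: "\<And>i. A i \<in> sets borel" "a = cyl A S"
      and A': "\<And>i. A' i \<in> sets borel" "b = cyl A' T"
      by (elim exE conjE) blast
    have disj: "S \<inter> T = {}" using sep by (auto simp: separated_def)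
    define C where "C = (\<lambda>i. if i \<in> S then A i else A' i)"
    have "cyl C S = a" unfolding A(2) C_def by simp
    moreover have "cyl C T = b"
      unfolding A'(2) C_def using disj by (intro Collect_cong conj_cong ball_cong) auto
    moreover from calculation have "cyl C (S \<union> T) = a \<inter> b" by auto
    moreover have "prob (cyl C (S \<union> T)) = prob (cyl C S) * prob (cyl C T)"
      using A A' by (intro prob_cyl_separated fin sep pos) (auto simp: C_def)
    ultimately show "prob (a \<inter> b) = prob a * prob b" by simp
  qed
  then have "indep_set (sigma_sets (space M) (?G S)) (sigma_sets (space M) (?G T))"
    by (rule indep_set_sigma_sets[OF _ stable stable])
  moreover have "sigma_sets (space M) (sigma_sets (space M) (?G J)) = sigma_sets (space M) (?G J)" for J
    by (rule sigma_sets_sigma_sets_eq) auto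
  ultimately show ?thesis
    unfolding indep_var_eq sets using pos by (intro conjI rv) simp_all
qed

lemma indep_var_of_separated:
  assumes "finite S" "finite T" "separated S T" "\<And>i. i \<in> S \<union> T \<Longrightarrow> 1 \<le> i"
    and "f \<in> PiM S (\<lambda>_. borel) \<rightarrow>\<^sub>M N" "g \<in> PiM T (\<lambda>_. borel) \<rightarrow>\<^sub>M N'"
  shows "indep_var N (\<lambda>\<omega>. f (\<lambda>i\<in>S. X i \<omega>)) N' (\<lambda>\<omega>. g (\<lambda>i\<in>T. X i \<omega>))"
  using indep_var_compose[OF indep_var_separated[OF assms(1-4)] assms(5,6)] by (simp add: o_def)

lemma pair_law_shift:
  assumes "1 \<le> i" "1 \<le> j"
  shows "distr M borel (\<lambda>\<omega>. (X (i + h) \<omega>, X (j + h) \<omega>)) = distr M borel (\<lambda>\<omega>. (X i \<omega>, X j \<omega>))"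
proof -
  define k where "k = max i j"
  let ?P = "PiM {1..k} (\<lambda>_. borel :: 'v measure)"
  have ij: "i \<in> {1..k}" "j \<in> {1..k}" using assms by (auto simp: k_def)
  have pair: "(\<lambda>f. (f i, f j)) \<in> ?P \<rightarrow>\<^sub>M borel"
    using measurable_component_singleton[OF ij(1), of "\<lambda>_. borel :: 'v measure"]
      measurable_component_singleton[OF ij(2), of "\<lambda>_. borel :: 'v measure"]
    unfolding borel_prod[symmetric] by (rule measurable_Pair)
  have rvh: "random_variable ?P (\<lambda>\<omega>. \<lambda>i\<in>{1..k}. X (i + h) \<omega>)" for h
    by (intro measurable_restrict X_measurable) auto
  note rv0 = rvh[of 0, simplified add_0_right]
  have "distr M borel (\<lambda>\<omega>. (X (i + h) \<omega>, X (j + h) \<omega>)) =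
      distr (distr M ?P (\<lambda>\<omega>. \<lambda>i\<in>{1..k}. X (i + h) \<omega>)) borel (\<lambda>f. (f i, f j))"
    using ij by (subst distr_distr[OF pair rvh]) (simp add: o_def)
  also have "\<dots> = distr (distr M ?P (\<lambda>\<omega>. \<lambda>i\<in>{1..k}. X i \<omega>)) borel (\<lambda>f. (f i, f j))"
    using X_stationary unfolding strictly_stationary_def by metis
  also have "\<dots> = distr M borel (\<lambda>\<omega>. (X i \<omega>, X j \<omega>))"
    using ij by (subst distr_distr[OF pair rv0]) (simp add: o_def)
  finally show ?thesis .
qed

end

section \<open>Integration on Euclidean space\<close>

text \<open>The quadratic \<open>t \<mapsto> \<integral> (f + t g)^2\<close> is nonnegative.\<close>

lemma integral_Cauchy_Schwarz:
  fixes f g :: "'a \<Rightarrow> real"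
  assumes [measurable]: "f \<in> borel_measurable M" "g \<in> borel_measurable M"
    and f: "integrable M (\<lambda>x. (f x)\<^sup>2)" and g: "integrable M (\<lambda>x. (g x)\<^sup>2)"
  shows integrable_mult_square_integrable: "integrable M (\<lambda>x. f x * g x)"
    and "(\<integral>x. f x * g x \<partial>M)\<^sup>2 \<le> (\<integral>x. (f x)\<^sup>2 \<partial>M) * (\<integral>x. (g x)\<^sup>2 \<partial>M)"
proof -
  show fg: "integrable M (\<lambda>x. f x * g x)"
  proof (rule Bochner_Integration.integrable_bound[OF Bochner_Integration.integrable_add[OF f g]])
    have "\<bar>a * b\<bar> \<le> a\<^sup>2 + b\<^sup>2" for a b :: real
    proof -
      have "2 * \<bar>a\<bar> * \<bar>b\<bar> \<le> a\<^sup>2 + b\<^sup>2" using sum_squares_bound[of "\<bar>a\<bar>" "\<bar>b\<bar>"] by simp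
      moreover have "0 \<le> \<bar>a\<bar> * \<bar>b\<bar>" by simp
      ultimately show ?thesis unfolding abs_mult by linarith
    qed
    then show "AE x in M. norm (f x * g x) \<le> norm ((f x)\<^sup>2 + (g x)\<^sup>2)" by simp
  qed measurable
  define a b c where "a = (\<integral>x. (f x)\<^sup>2 \<partial>M)" and "b = (\<integral>x. f x * g x \<partial>M)" and "c = (\<integral>x. (g x)\<^sup>2 \<partial>M)"
  have quad: "0 \<le> a + 2 * t * b + t\<^sup>2 * c" for t
  proof -
    have "0 \<le> (\<integral>x. (f x + t * g x)\<^sup>2 \<partial>M)" by (rule Bochner_Integration.integral_nonneg) simp
    also have "\<dots> = (\<integral>x. (f x)\<^sup>2 + (2 * t) * (f x * g x) + t\<^sup>2 * (g x)\<^sup>2 \<partial>M)"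
      by (intro Bochner_Integration.integral_cong) (auto simp: power2_eq_square algebra_simps)
    also have "\<dots> = a + 2 * t * b + t\<^sup>2 * c"
      using f g fg by (simp add: a_def b_def c_def)
    finally show ?thesis .
  qed
  have "c \<ge> 0" unfolding c_def by (rule Bochner_Integration.integral_nonneg) simp
  show "b\<^sup>2 \<le> a * c"
  proof (cases "c = 0")
    case True
    have "b = 0"
    proof (rule ccontr)
      assume "b \<noteq> 0"
      then show False using quad[of "- (a + 1) / (2 * b)"] True by (simp add: field_simps)
    qed
    then show ?thesis using True by simp
  next
    case False
    then have c: "c > 0" using \<open>c \<ge> 0\<close> by simp
    have "0 \<le> c * (a + 2 * (- b / c) * b + (- b / c)\<^sup>2 * c)"
      using quad[of "- b / c"] c by simp
    also have "\<dots> = a * c - b\<^sup>2" using c by (simp add: field_simps power2_eq_square)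
    finally show ?thesis by simp
  qed
qed

lemma lborel_shift:
  fixes h :: "'v::euclidean_space" and f :: "'v \<Rightarrow> real"
  assumes [measurable]: "f \<in> borel_measurable borel"
  shows integrable_lborel_shift: "integrable lborel (\<lambda>x. f (x + h)) \<longleftrightarrow> integrable lborel f"
    and integral_lborel_shift: "(\<integral>x. f (x + h) \<partial>lborel) = (\<integral>x. f x \<partial>lborel)"
proof -
  have f: "f \<in> borel_measurable lborel" and plus: "(+) h \<in> lborel \<rightarrow>\<^sub>M borel" by auto
  have "integrable lborel f \<longleftrightarrow> integrable (distr lborel borel ((+) h)) f" by (simp add: lborel_distr_plus)
  also have "\<dots> \<longleftrightarrow> integrable lborel (\<lambda>x. f (x + h))"
    by (subst integrable_distr_eq[OF plus]) (auto simp: add.commute)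
  finally show "integrable lborel (\<lambda>x. f (x + h)) \<longleftrightarrow> integrable lborel f" ..
  have "(\<integral>x. f x \<partial>lborel) = (\<integral>x. f x \<partial>distr lborel borel ((+) h))" by (simp add: lborel_distr_plus)
  also have "\<dots> = (\<integral>x. f (x + h) \<partial>lborel)"
    by (subst integral_distr[OF plus]) (auto simp: add.commute)
  finally show "(\<integral>x. f (x + h) \<partial>lborel) = (\<integral>x. f x \<partial>lborel)" ..
qed

lemma nn_integral_lborel_shift:
  fixes h :: "'v::euclidean_space" and f :: "'v \<Rightarrow> ennreal"
  assumes [measurable]: "f \<in> borel_measurable borel"
  shows "(\<integral>\<^sup>+x. f (x + h) \<partial>lborel) = (\<integral>\<^sup>+x. f x \<partial>lborel)"
proof -
  have "(\<integral>\<^sup>+x. f x \<partial>lborel) = (\<integral>\<^sup>+x. f x \<partial>distr lborel borel ((+) h))" by (simp add: lborel_distr_plus)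
  also have "\<dots> = (\<integral>\<^sup>+x. f (x + h) \<partial>lborel)"
    by (subst nn_integral_distr) (auto simp: add.commute)
  finally show ?thesis ..
qed

lemma borel_measurable_compose_continuous:
  assumes "continuous_on UNIV g" "F \<in> borel_measurable borel"
  shows "(\<lambda>z. F (g z)) \<in> borel_measurable borel"
  using measurable_compose[OF borel_measurable_continuous_onI[OF assms(1)] assms(2)] .

lemma nn_integral_lborel_split3:
  fixes F :: "'a::euclidean_space \<times> 'b::euclidean_space \<times> 'c::euclidean_space \<Rightarrow> ennreal"
  assumes [measurable]: "F \<in> borel_measurable borel"
  shows "(\<integral>\<^sup>+z. F z \<partial>lborel) = (\<integral>\<^sup>+u. (\<integral>\<^sup>+y. F (fst u, snd u, y) \<partial>lborel) \<partial>lborel)"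
proof -
  have [measurable]: "F \<in> borel_measurable (lborel \<Otimes>\<^sub>M lborel)"
    by (simp add: lborel_prod)
  have [measurable]: "(\<lambda>z. F (fst (fst z), snd (fst z), snd z)) \<in> borel_measurable (lborel \<Otimes>\<^sub>M lborel)"
    using borel_measurable_compose_continuous[of "\<lambda>z. (fst (fst z), snd (fst z), snd z)" F, OF _ assms]
    by (simp add: lborel_prod continuous_on_Pair continuous_on_fst continuous_on_snd)
  have "(\<integral>\<^sup>+z. F z \<partial>lborel) = (\<integral>\<^sup>+x. (\<integral>\<^sup>+w. F (x, w) \<partial>lborel) \<partial>lborel)"
    unfolding lborel_prod[symmetric, where 'a = 'a] by (subst lborel.nn_integral_fst[symmetric]) auto
  also have "\<dots> = (\<integral>\<^sup>+x. (\<integral>\<^sup>+x'. (\<integral>\<^sup>+y. F (x, x', y) \<partial>lborel) \<partial>lborel) \<partial>lborel)"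
  proof (rule nn_integral_cong)
    fix x
    have "(\<lambda>w. F (x, w)) \<in> borel_measurable (lborel \<Otimes>\<^sub>M lborel)"
      using borel_measurable_compose_continuous[of "\<lambda>w. (x, w)" F, OF _ assms]
      by (simp add: lborel_prod continuous_on_Pair)
    then show "(\<integral>\<^sup>+w. F (x, w) \<partial>lborel) = (\<integral>\<^sup>+x'. (\<integral>\<^sup>+y. F (x, x', y) \<partial>lborel) \<partial>lborel)"
      unfolding lborel_prod[symmetric, where 'a = 'b] by (subst lborel.nn_integral_fst[symmetric]) auto
  qed
  also have "\<dots> = (\<integral>\<^sup>+u. (\<integral>\<^sup>+y. F (fst u, snd u, y) \<partial>lborel) \<partial>lborel)"
    unfolding lborel_prod[symmetric, where 'a = 'a and 'b = 'b]
    by (subst lborel.nn_integral_fst[symmetric]) auto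
  finally show ?thesis .
qed

lemma b1_eq_unit_ball_vol: "0 < d \<Longrightarrow> b1 d = unit_ball_vol (real d)"
proof -
  assume d: "0 < d"
  then have "real d / 2 \<notin> \<int>\<^sub>\<le>\<^sub>0" by (auto elim!: nonpos_Ints_cases)
  then have Gamma: "Gamma (real d / 2 + 1) = real d / 2 * Gamma (real d / 2)" by (rule Gamma_plus1)
  show "b1 d = unit_ball_vol (real d)"
    unfolding b1_def unit_ball_vol_def Gamma by simp
qed

lemma b1_pos: "0 < d \<Longrightarrow> 0 < b1 d"
  by (simp add: b1_eq_unit_ball_vol)

lemma emeasure_lborel_cball:
  fixes x :: "'v::euclidean_space"
  assumes "0 \<le> e"
  shows "emeasure lborel (cball x e) = ennreal (ball_vol e DIM('v))"
  using emeasure_cball[OF assms, of x] by (simp add: ball_vol_def b1_eq_unit_ball_vol mult.commute)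

lemma ball_vol_nonneg: "0 < d \<Longrightarrow> 0 \<le> e \<Longrightarrow> 0 \<le> ball_vol e d"
  using b1_pos[of d] by (simp add: ball_vol_def)

text \<open>For fixed \<open>(x1, x2)\<close>, the Cauchy-Schwarz inequality bounds the integral of \<open>pt\<close> over the product of the
  balls around \<open>x1\<close> and \<open>x2\<close> by \<open>V n\<close>, the square root of the volume of that product, times the square root
  of the integral of \<open>pt^2\<close> over it. The last factor tends to \<open>0\<close> as the balls shrink and is dominated by the
  integrable function of Assumption A.\<close>

lemma two_close_pairs_ratio_tendsto_0:
  fixes pt :: "'v::euclidean_space \<times> 'v \<times> 'v \<times> 'v \<Rightarrow> real" and Y1 Y2 Y3 Y4 :: "'s \<Rightarrow> 'v"
  assumes dens: "has_density M (\<lambda>\<omega>. (Y1 \<omega>, Y2 \<omega>, Y3 \<omega>, Y4 \<omega>)) pt"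
    and sq: "AE (x1, x2) in lborel. integrable lborel (\<lambda>(x3, x4). (pt (x1, x2, x3, x4))\<^sup>2)"
    and L1: "integrable lborel (\<lambda>(x1, x2). sqrt (LINT (x3, x4)|lborel. (pt (x1, x2, x3, x4))\<^sup>2))"
    and e: "\<And>n. 0 < e n" "e \<longlonglongrightarrow> 0"
  shows "(\<lambda>n. measure M {\<omega> \<in> space M. norm (Y1 \<omega> - Y3 \<omega>) \<le> e n \<and> norm (Y2 \<omega> - Y4 \<omega>) \<le> e n}
            / e n ^ DIM('v)) \<longlonglongrightarrow> 0"
proof -
  note d = has_densityD[OF dens]
  note [measurable] = d(1,3)
  define V where "V n = ball_vol (e n) DIM('v)" for n
  have V0: "0 \<le> V n" for n unfolding V_def using e(1)[of n] by (intro ball_vol_nonneg) auto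
  define q where "q u y = pt (fst u, snd u, y)" for u :: "'v \<times> 'v" and y :: "'v \<times> 'v"
  have q0: "0 \<le> q u y" for u y unfolding q_def using d(2) .
  have q_meas2 [measurable]: "(\<lambda>z. q (fst z) (snd z)) \<in> borel_measurable borel"
    unfolding q_def using d(1)
    by (intro borel_measurable_compose_continuous[of "\<lambda>z. (fst (fst z), snd (fst z), snd z)" pt] continuous_intros)
  have q_meas [measurable]: "q u \<in> borel_measurable borel" for u
    unfolding q_def using d(1)
    by (intro borel_measurable_compose_continuous[of "\<lambda>y. (fst u, snd u, y)" pt] continuous_intros)
  define C where "C n u = cball (fst u) (e n) \<times> cball (snd u) (e n)" for n and u :: "'v \<times> 'v"
  have C_meas [measurable]: "C n u \<in> sets borel" for n u
    unfolding C_def by (intro borel_closed closed_Times) auto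
  have C_vol: "emeasure lborel (C n u) = ennreal ((V n)\<^sup>2)" for n u
  proof -
    have "emeasure lborel (C n u) = emeasure (lborel \<Otimes>\<^sub>M lborel) (C n u)" by (simp add: lborel_prod)
    also have "\<dots> = ennreal (V n) * ennreal (V n)"
      unfolding C_def using e(1)[of n]
      by (subst lborel.emeasure_pair_measure_Times) (auto simp: emeasure_lborel_cball V_def)
    finally show ?thesis using V0 by (simp add: ennreal_mult power2_eq_square)
  qed
  have ind_meas2 [measurable]: "(\<lambda>z. indicator (C n (fst z)) (snd z) :: real) \<in> borel_measurable borel" for n
  proof -
    have "(\<lambda>z. indicator (C n (fst z)) (snd z) :: real) =
      (\<lambda>z :: ('v \<times> 'v) \<times> ('v \<times> 'v). indicator {z. dist (fst (fst z)) (fst (snd z)) \<le> e n \<and> dist (snd (fst z)) (snd (snd z)) \<le> e n} z)"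
      by (auto simp: fun_eq_iff C_def indicator_def mem_Times_iff)
    also have "\<dots> \<in> borel_measurable borel"
    proof (rule borel_measurable_indicator)
      have "closed {z :: ('v \<times> 'v) \<times> ('v \<times> 'v). dist (fst (fst z)) (fst (snd z)) \<le> e n \<and> dist (snd (fst z)) (snd (snd z)) \<le> e n}"
        by (intro closed_Collect_conj closed_Collect_le continuous_intros)
      then show "{z :: ('v \<times> 'v) \<times> ('v \<times> 'v). dist (fst (fst z)) (fst (snd z)) \<le> e n \<and> dist (snd (fst z)) (snd (snd z)) \<le> e n} \<in> sets borel"
        by (rule borel_closed)
    qed
    finally show ?thesis .
  qed
  define J where "J n u = (\<integral>y. (q u y)\<^sup>2 * indicator (C n u) y \<partial>lborel)" for n u
  have J0: "0 \<le> J n u" for n u unfolding J_def by (intro Bochner_Integration.integral_nonneg) auto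
  have J_meas [measurable]: "J n \<in> borel_measurable lborel" for n
    unfolding J_def
  proof (rule lborel.borel_measurable_lebesgue_integral)
    have "(\<lambda>z. (q (fst z) (snd z))\<^sup>2 * indicator (C n (fst z)) (snd z)) \<in> borel_measurable (lborel \<Otimes>\<^sub>M lborel)"
      unfolding lborel_prod by measurable
    then show "(\<lambda>(u, y). (q u y)\<^sup>2 * indicator (C n u) y) \<in> borel_measurable (lborel \<Otimes>\<^sub>M lborel)"
      by (simp add: case_prod_beta)
  qed
  define G where "G u = (\<integral>y. (q u y)\<^sup>2 \<partial>lborel)" for u
  have eta: "(\<lambda>(x3, x4). (pt (x1, x2, x3, x4))\<^sup>2) = (\<lambda>y. (pt (x1, x2, y))\<^sup>2)" for x1 x2
    by auto
  have sq': "AE u in lborel. integrable lborel (\<lambda>y. (q u y)\<^sup>2)"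
    using sq unfolding eta by (simp add: q_def case_prod_beta)
  have L1': "integrable lborel (\<lambda>u. sqrt (G u))"
  proof -
    have "(\<lambda>(x1, x2). sqrt (\<integral>y. (pt (x1, x2, y))\<^sup>2 \<partial>lborel)) = (\<lambda>u. sqrt (G u))"
      by (auto simp: fun_eq_iff G_def q_def)
    then show ?thesis using L1 unfolding eta by simp
  qed
  have sq_ind: "integrable lborel (\<lambda>y. (q u y)\<^sup>2 * indicator (C n u) y)"
    if "integrable lborel (\<lambda>y. (q u y)\<^sup>2)" for n u
    using integrable_mult_indicator[OF _ that, of "C n u"] by (simp add: mult.commute)
  have J_le: "J n u \<le> G u" if "integrable lborel (\<lambda>y. (q u y)\<^sup>2)" for n u
    unfolding J_def G_def using that by (intro integral_mono sq_ind) (auto simp: indicator_def)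
  have J_lim: "(\<lambda>n. J n u) \<longlonglongrightarrow> 0" if int: "integrable lborel (\<lambda>y. (q u y)\<^sup>2)" for u
  proof -
    have "(\<lambda>n. J n u) \<longlonglongrightarrow> (\<integral>y. 0 \<partial>(lborel :: ('v \<times> 'v) measure))"
      unfolding J_def
    proof (rule integral_dominated_convergence[OF _ _ int])
      show "AE y in lborel. (\<lambda>n. (q u y)\<^sup>2 * indicator (C n u) y) \<longlonglongrightarrow> 0"
        using AE_lborel_singleton[of u]
      proof eventually_elim
        case (elim y)
        then have "0 < max (dist (fst u) (fst y)) (dist (snd u) (snd y))"
          by (auto simp: prod_eq_iff less_max_iff_disj)
        from order_tendstoD(2)[OF e(2) this]
        have "\<forall>\<^sub>F n in sequentially. 0 = (q u y)\<^sup>2 * indicator (C n u) y"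
          by eventually_elim (auto simp: C_def indicator_def mem_Times_iff)
        then show ?case by (rule Lim_transform_eventually[OF tendsto_const])
      qed
      show "AE y in lborel. norm ((q u y)\<^sup>2 * indicator (C n u) y) \<le> (q u y)\<^sup>2" for n
        by (auto simp: indicator_def)
    qed auto
    then show ?thesis by simp
  qed
  have sqrt_int: "integrable lborel (\<lambda>u. sqrt (J n u))" for n
    using sq' J_le J0
    by (intro Bochner_Integration.integrable_bound[OF L1'])
       (auto elim!: eventually_mono intro: order_trans[OF _ abs_ge_self])
  have lim: "(\<lambda>n. \<integral>u. sqrt (J n u) \<partial>lborel) \<longlonglongrightarrow> (\<integral>u. 0 \<partial>(lborel :: ('v \<times> 'v) measure))"
  proof (rule integral_dominated_convergence[OF _ _ L1'])
    show "AE u in lborel. (\<lambda>n. sqrt (J n u)) \<longlonglongrightarrow> 0"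
      using sq'
    proof eventually_elim
      case (elim u)
      from tendsto_real_sqrt[OF J_lim[OF elim]] show ?case by simp
    qed
    show "AE u in lborel. norm (sqrt (J n u)) \<le> sqrt (G u)" for n
      using sq' by eventually_elim (use J_le J0 in auto)
  qed auto
  have bound: "measure M {\<omega> \<in> space M. norm (Y1 \<omega> - Y3 \<omega>) \<le> e n \<and> norm (Y2 \<omega> - Y4 \<omega>) \<le> e n}
      \<le> V n * (\<integral>u. sqrt (J n u) \<partial>lborel)" for n
  proof -
    define E where "E = {z :: 'v \<times> 'v \<times> 'v \<times> 'v. snd (snd z) \<in> C n (fst z, fst (snd z))}"
    have E [measurable]: "E \<in> sets borel"
    proof -
      have "E = {z. dist (fst z) (fst (snd (snd z))) \<le> e n \<and> dist (fst (snd z)) (snd (snd (snd z))) \<le> e n}"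
        by (auto simp: E_def C_def mem_Times_iff)
      also have "closed \<dots>" by (intro closed_Collect_conj closed_Collect_le continuous_intros)
      finally show ?thesis by (rule borel_closed)
    qed
    let ?Y = "\<lambda>\<omega>. (Y1 \<omega>, Y2 \<omega>, Y3 \<omega>, Y4 \<omega>)"
    have "{\<omega> \<in> space M. norm (Y1 \<omega> - Y3 \<omega>) \<le> e n \<and> norm (Y2 \<omega> - Y4 \<omega>) \<le> e n} = ?Y -` E \<inter> space M"
      by (auto simp: E_def C_def dist_norm)
    then have "emeasure M {\<omega> \<in> space M. norm (Y1 \<omega> - Y3 \<omega>) \<le> e n \<and> norm (Y2 \<omega> - Y4 \<omega>) \<le> e n}
        = emeasure (distr M borel ?Y) E"
      by (simp add: emeasure_distr)
    also have "\<dots> = (\<integral>\<^sup>+z. ennreal (pt z) * indicator E z \<partial>lborel)"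
      unfolding d(4) by (subst emeasure_density) auto
    also have "\<dots> = (\<integral>\<^sup>+u. (\<integral>\<^sup>+y. ennreal (pt (fst u, snd u, y)) * indicator E (fst u, snd u, y) \<partial>lborel) \<partial>lborel)"
      by (rule nn_integral_lborel_split3) measurable
    also have "\<dots> \<le> (\<integral>\<^sup>+u. ennreal (V n * sqrt (J n u)) \<partial>lborel)"
    proof (rule nn_integral_mono_AE, use sq' in eventually_elim)
      case (elim u)
      let ?i = "\<lambda>y. indicator (C n u) y :: real"
      have sq1: "integrable lborel (\<lambda>y. (q u y * ?i y)\<^sup>2)"
      proof -
        have "(q u y * ?i y)\<^sup>2 = (q u y)\<^sup>2 * ?i y" for y by (simp add: indicator_def)
        then show ?thesis using sq_ind[OF elim, of n] by simp
      qed
      have i_int: "integrable lborel ?i" using C_vol[of n u] by simp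
      have sq2: "integrable lborel (\<lambda>y. (?i y)\<^sup>2)"
      proof -
        have "(?i y)\<^sup>2 = ?i y" for y by (simp add: indicator_def)
        then show ?thesis using i_int by simp
      qed
      have qi: "q u y * ?i y * ?i y = q u y * ?i y" for y by (simp add: indicator_def)
      have int: "integrable lborel (\<lambda>y. q u y * ?i y)"
        using integrable_mult_square_integrable[OF _ _ sq1 sq2] unfolding qi by simp
      have "(\<integral>y. q u y * ?i y \<partial>lborel)\<^sup>2 \<le> (\<integral>y. (q u y * ?i y)\<^sup>2 \<partial>lborel) * (\<integral>y. (?i y)\<^sup>2 \<partial>lborel)"
        using integral_Cauchy_Schwarz(2)[OF _ _ sq1 sq2] unfolding qi by simp
      also have "(\<integral>y. (q u y * ?i y)\<^sup>2 \<partial>lborel) = J n u"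
        unfolding J_def by (intro Bochner_Integration.integral_cong) (auto simp: indicator_def)
      also have "(\<integral>y. (?i y)\<^sup>2 \<partial>lborel) = (\<integral>y. ?i y \<partial>lborel)"
        by (intro Bochner_Integration.integral_cong) (auto simp: indicator_def)
      also have "\<dots> = (V n)\<^sup>2" using C_vol[of n u] by (simp add: measure_def)
      finally have "(\<integral>y. q u y * ?i y \<partial>lborel)\<^sup>2 \<le> (V n * sqrt (J n u))\<^sup>2"
        using J0 by (simp add: power_mult_distrib mult.commute)
      then have le: "(\<integral>y. q u y * ?i y \<partial>lborel) \<le> V n * sqrt (J n u)"
        by (rule power2_le_imp_le) (use V0 J0 in auto)
      have "(\<integral>\<^sup>+y. ennreal (pt (fst u, snd u, y)) * indicator E (fst u, snd u, y) \<partial>lborel)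
          = (\<integral>\<^sup>+y. ennreal (q u y * ?i y) \<partial>lborel)"
        by (intro nn_integral_cong) (auto simp: q_def E_def indicator_def)
      also have "\<dots> = ennreal (\<integral>y. q u y * ?i y \<partial>lborel)"
        using int q0 by (intro nn_integral_eq_integral) auto
      also have "\<dots> \<le> ennreal (V n * sqrt (J n u))" using le by (rule ennreal_leI)
      finally show ?case .
    qed
    also have "\<dots> = ennreal (\<integral>u. V n * sqrt (J n u) \<partial>lborel)"
      using sqrt_int V0 J0 by (intro nn_integral_eq_integral) auto
    finally have "emeasure M {\<omega> \<in> space M. norm (Y1 \<omega> - Y3 \<omega>) \<le> e n \<and> norm (Y2 \<omega> - Y4 \<omega>) \<le> e n}
        \<le> ennreal (V n * (\<integral>u. sqrt (J n u) \<partial>lborel))" by simp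
    then show ?thesis unfolding measure_def
      using V0 J0 by (intro enn2real_leI) (auto intro!: mult_nonneg_nonneg Bochner_Integration.integral_nonneg)
  qed
  have V_quot: "V n / e n ^ DIM('v) = b1 DIM('v)" for n
    using e(1)[of n] by (simp add: V_def ball_vol_def)
  show ?thesis
  proof (rule tendsto_sandwich[OF always_eventually always_eventually tendsto_const])
    show "\<forall>n. 0 \<le> measure M {\<omega> \<in> space M. norm (Y1 \<omega> - Y3 \<omega>) \<le> e n \<and> norm (Y2 \<omega> - Y4 \<omega>) \<le> e n}
            / e n ^ DIM('v)"
      by (intro allI divide_nonneg_nonneg measure_nonneg zero_le_power less_imp_le[OF e(1)])
    show "\<forall>n. measure M {\<omega> \<in> space M. norm (Y1 \<omega> - Y3 \<omega>) \<le> e n \<and> norm (Y2 \<omega> - Y4 \<omega>) \<le> e n}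
            / e n ^ DIM('v) \<le> b1 DIM('v) * (\<integral>u. sqrt (J n u) \<partial>lborel)"
    proof
      fix n
      show "measure M {\<omega> \<in> space M. norm (Y1 \<omega> - Y3 \<omega>) \<le> e n \<and> norm (Y2 \<omega> - Y4 \<omega>) \<le> e n}
            / e n ^ DIM('v) \<le> b1 DIM('v) * (\<integral>u. sqrt (J n u) \<partial>lborel)"
        using divide_right_mono[OF bound[of n], of "e n ^ DIM('v)"] e(1)[of n]
        unfolding V_quot[of n, symmetric] by simp
    qed
    show "(\<lambda>n. b1 DIM('v) * (\<integral>u. sqrt (J n u) \<partial>lborel)) \<longlonglongrightarrow> 0"
      using tendsto_mult_left[OF lim, of "b1 DIM('v)"] by simp
  qed
qed

section \<open>Probabilities of close pairs\<close>

text \<open>Fubini's theorem for independent variables, with a bounded weight on the first one.\<close>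

lemma (in prob_space) expectation_indicator_indep:
  assumes ind: "indep_var N Z L W" and \<phi> [measurable]: "\<phi> \<in> borel_measurable N"
    and \<phi>_bd: "\<And>z. 0 \<le> \<phi> z" "\<And>z. \<phi> z \<le> (1::real)"
    and E [measurable]: "E \<in> sets (N \<Otimes>\<^sub>M L)"
  shows "expectation (\<lambda>\<omega>. \<phi> (Z \<omega>) * indicator E (Z \<omega>, W \<omega>))
       = expectation (\<lambda>\<omega>. \<phi> (Z \<omega>) * measure (distr M L W) (Pair (Z \<omega>) -` E))"
proof -
  have rv [measurable]: "random_variable N Z" "random_variable L W"
    and joint: "distr M N Z \<Otimes>\<^sub>M distr M L W = distr M (N \<Otimes>\<^sub>M L) (\<lambda>x. (Z x, W x))"
    using ind unfolding indep_var_distribution_eq by auto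
  interpret W: prob_space "distr M L W" by (rule prob_space_distr) (rule rv)
  have E' [measurable]: "E \<in> sets (N \<Otimes>\<^sub>M distr M L W)" "E \<in> sets (distr M N Z \<Otimes>\<^sub>M distr M L W)"
    using E by simp_all
  have sec [measurable]: "(\<lambda>z. measure (distr M L W) (Pair z -` E)) \<in> borel_measurable N"
    unfolding measure_def by (intro borel_measurable_enn2real W.measurable_emeasure_Pair E')
  have int1: "integrable M (\<lambda>\<omega>. \<phi> (Z \<omega>) * indicator E (Z \<omega>, W \<omega>))"
    using \<phi>_bd by (intro integrable_const_bound[of _ 1]) (auto simp: indicator_def)
  have int2: "integrable M (\<lambda>\<omega>. \<phi> (Z \<omega>) * measure (distr M L W) (Pair (Z \<omega>) -` E))"
    using \<phi>_bd by (intro integrable_const_bound[of _ 1]) (auto intro!: mult_le_one)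
  have "ennreal (expectation (\<lambda>\<omega>. \<phi> (Z \<omega>) * indicator E (Z \<omega>, W \<omega>)))
      = (\<integral>\<^sup>+\<omega>. ennreal (\<phi> (Z \<omega>) * indicator E (Z \<omega>, W \<omega>)) \<partial>M)"
    using int1 \<phi>_bd by (intro nn_integral_eq_integral[symmetric]) auto
  also have "\<dots> = (\<integral>\<^sup>+u. ennreal (\<phi> (fst u) * indicator E u) \<partial>distr M (N \<Otimes>\<^sub>M L) (\<lambda>x. (Z x, W x)))"
    by (subst nn_integral_distr) auto
  also have "\<dots> = (\<integral>\<^sup>+z. (\<integral>\<^sup>+w. ennreal (\<phi> z * indicator E (z, w)) \<partial>distr M L W) \<partial>distr M N Z)"
    unfolding joint[symmetric] by (subst W.nn_integral_fst[symmetric]) auto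
  also have "\<dots> = (\<integral>\<^sup>+z. ennreal (\<phi> z * measure (distr M L W) (Pair z -` E)) \<partial>distr M N Z)"
  proof (rule nn_integral_cong)
    fix z assume "z \<in> space (distr M N Z)"
    have [measurable]: "Pair z -` E \<in> sets (distr M L W)" using sets_Pair1[OF E] by simp
    have "(\<integral>\<^sup>+w. ennreal (\<phi> z * indicator E (z, w)) \<partial>distr M L W)
        = (\<integral>\<^sup>+w. ennreal (\<phi> z) * indicator (Pair z -` E) w \<partial>distr M L W)"
      by (intro nn_integral_cong) (auto simp: indicator_def)
    also have "\<dots> = ennreal (\<phi> z) * emeasure (distr M L W) (Pair z -` E)"
      by (rule nn_integral_cmult_indicator) measurable
    finally show "(\<integral>\<^sup>+w. ennreal (\<phi> z * indicator E (z, w)) \<partial>distr M L W)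
        = ennreal (\<phi> z * measure (distr M L W) (Pair z -` E))"
      using \<phi>_bd(1) by (simp add: W.emeasure_eq_measure ennreal_mult)
  qed
  also have "\<dots> = (\<integral>\<^sup>+\<omega>. ennreal (\<phi> (Z \<omega>) * measure (distr M L W) (Pair (Z \<omega>) -` E)) \<partial>M)"
    by (subst nn_integral_distr) auto
  also have "\<dots> = ennreal (expectation (\<lambda>\<omega>. \<phi> (Z \<omega>) * measure (distr M L W) (Pair (Z \<omega>) -` E)))"
    using int2 \<phi>_bd by (intro nn_integral_eq_integral) auto
  finally show ?thesis
    using \<phi>_bd by (subst (asm) ennreal_inj) (auto intro!: Bochner_Integration.integral_nonneg)
qed

context stationary_m_dependent
begin

definition mu :: "'v measure" where "mu = density lborel (\<lambda>x. ennreal (p x))"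

definition ball_mass :: "real \<Rightarrow> 'v \<Rightarrow> real" where "ball_mass e x = measure mu (cball x e)"

definition close :: "real \<Rightarrow> nat \<Rightarrow> nat \<Rightarrow> 's \<Rightarrow> real" where
  "close e i j \<omega> = of_bool (norm (X i \<omega> - X j \<omega>) \<le> e)"

text \<open>The probability that two independent observations are within \<open>e\<close> of each other.\<close>

definition mean_ball_mass :: "real \<Rightarrow> real" where
  "mean_ball_mass e = (\<integral>x. ball_mass e x \<partial>mu)"

definition mean_ball_mass_sq :: "real \<Rightarrow> real" where
  "mean_ball_mass_sq e = (\<integral>x. (ball_mass e x)\<^sup>2 \<partial>mu)"

lemma law_X: "1 \<le> i \<Longrightarrow> distr M borel (X i) = mu"
  unfolding mu_def using has_densityD(4)[OF X_density] .

lemma prob_space_mu: "prob_space mu"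
  using prob_space_distr[OF X_measurable[of 1]] law_X[of 1] by simp

lemma sets_mu [measurable_cong]: "sets mu = sets borel"
  by (simp add: mu_def)

lemma space_mu [simp]: "space mu = UNIV"
  by (simp add: mu_def)

lemma dist_le_set [measurable]: "{z :: 'v \<times> 'v. dist (fst z) (snd z) \<le> e} \<in> sets (borel \<Otimes>\<^sub>M borel)"
  unfolding borel_prod by (intro borel_closed closed_Collect_le continuous_intros)

lemma ball_mass_measurable [measurable]: "ball_mass e \<in> borel_measurable borel"
proof -
  interpret mu: prob_space mu by (rule prob_space_mu)
  have "{z :: 'v \<times> 'v. dist (fst z) (snd z) \<le> e} \<in> sets (borel \<Otimes>\<^sub>M mu)"
    using dist_le_set[of e] by (simp cong: sets_pair_measure_cong add: sets_mu)
  from borel_measurable_enn2real[OF mu.measurable_emeasure_Pair[OF this]] show ?thesis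
    by (simp add: ball_mass_def[abs_def] measure_def vimage_def cball_def)
qed

lemma ball_mass_bounds: "0 \<le> ball_mass e x" "ball_mass e x \<le> 1"
  using prob_space.prob_le_1[OF prob_space_mu] by (simp_all add: ball_mass_def)

lemma ball_mass_sq_le: "(ball_mass e x)\<^sup>2 \<le> 1"
  using ball_mass_bounds by (intro power_le_one)

lemma close_measurable: "1 \<le> i \<Longrightarrow> 1 \<le> j \<Longrightarrow> random_variable borel (close e i j)"
proof -
  assume "1 \<le> i" "1 \<le> j"
  note [measurable] = X_measurable[OF \<open>1 \<le> i\<close>] X_measurable[OF \<open>1 \<le> j\<close>]
  show ?thesis unfolding close_def[abs_def] by measurable
qed

lemma close_bounds: "0 \<le> close e i j \<omega>" "close e i j \<omega> \<le> 1"
  by (simp_all add: close_def)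

lemma close_sym: "close e i j = close e j i"
  by (simp add: close_def fun_eq_iff norm_minus_commute)

lemma expectation_X: "1 \<le> i \<Longrightarrow> f \<in> borel_measurable borel \<Longrightarrow> expectation (\<lambda>\<omega>. f (X i \<omega>)) = (\<integral>x. f x \<partial>mu)"
  for f :: "'v \<Rightarrow> real"
  unfolding law_X[of i, symmetric] by (subst integral_distr[OF X_measurable]) auto

text \<open>Conditioning on the observations in \<open>S\<close>: the observation \<open>X l\<close> is independent of them, so its closeness
  to \<open>X k\<close> may be replaced by the mass of the ball around \<open>X k\<close>.\<close>

lemma expectation_isolate:
  assumes S: "finite S" "k \<in> S" and sep: "separated S {l}" and pos: "\<And>i. i \<in> insert l S \<Longrightarrow> 1 \<le> i"
    and \<phi>: "\<phi> \<in> borel_measurable (PiM S (\<lambda>_. borel))" "\<And>f. 0 \<le> \<phi> f" "\<And>f. \<phi> f \<le> (1::real)"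
  shows "expectation (\<lambda>\<omega>. \<phi> (\<lambda>i\<in>S. X i \<omega>) * close e k l \<omega>)
       = expectation (\<lambda>\<omega>. \<phi> (\<lambda>i\<in>S. X i \<omega>) * ball_mass e (X k \<omega>))"
proof -
  let ?P = "PiM S (\<lambda>_. borel :: 'v measure)" and ?L = "PiM {l} (\<lambda>_. borel :: 'v measure)"
  let ?Xl = "\<lambda>\<omega>. \<lambda>i\<in>{l}. X i \<omega>"
  have [measurable]: "(\<lambda>f. f k) \<in> ?P \<rightarrow>\<^sub>M borel"
    using S(2) by (rule measurable_component_singleton)
  have [measurable]: "(\<lambda>f. f l) \<in> ?L \<rightarrow>\<^sub>M borel"
    by (rule measurable_component_singleton) simp
  define E where "E = {z \<in> space (?P \<Otimes>\<^sub>M ?L). (fst z k, snd z l) \<in> {z :: 'v \<times> 'v. dist (fst z) (snd z) \<le> e}}"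
  have E: "E \<in> sets (?P \<Otimes>\<^sub>M ?L)" unfolding E_def by measurable
  have ind: "indep_var ?P (\<lambda>\<omega>. \<lambda>i\<in>S. X i \<omega>) ?L ?Xl"
    using S sep pos by (intro indep_var_separated) auto
  have sp: "(\<lambda>i\<in>S. X i \<omega>) \<in> space ?P" for \<omega> by (simp add: space_PiM)
  have 1: "indicator E (\<lambda>i\<in>S. X i \<omega>, ?Xl \<omega>) = close e k l \<omega>" for \<omega>
    using S(2) sp by (simp add: E_def close_def indicator_def space_pair_measure space_PiM dist_norm)
  have 2: "measure (distr M ?L ?Xl) (Pair (\<lambda>i\<in>S. X i \<omega>) -` E) = ball_mass e (X k \<omega>)" for \<omega>
  proof -
    have sec: "Pair (\<lambda>i\<in>S. X i \<omega>) -` E = {f \<in> space ?L. f l \<in> cball (X k \<omega>) e}"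
      using S(2) sp by (auto simp: E_def space_pair_measure)
    have "measure (distr M ?L ?Xl) (Pair (\<lambda>i\<in>S. X i \<omega>) -` E)
        = prob (?Xl -` (Pair (\<lambda>i\<in>S. X i \<omega>) -` E) \<inter> space M)"
      using indep_var_rv2[OF ind] sets_Pair1[OF E] by (rule measure_distr)
    also have "?Xl -` (Pair (\<lambda>i\<in>S. X i \<omega>) -` E) \<inter> space M = X l -` cball (X k \<omega>) e \<inter> space M"
      unfolding sec by (auto simp: space_PiM)
    also have "prob \<dots> = measure (distr M borel (X l)) (cball (X k \<omega>) e)"
      using pos by (intro measure_distr[symmetric] X_measurable) auto
    also have "distr M borel (X l) = mu" by (rule law_X) (use pos in auto)
    finally show ?thesis unfolding ball_mass_def .
  qed
  show ?thesis
    using expectation_indicator_indep[OF ind \<phi> E] unfolding 1 2 .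
qed

lemma expectation_close:
  assumes "1 \<le> i" "1 \<le> j" "separated {i} {j}"
  shows "expectation (close e i j) = mean_ball_mass e"
proof -
  have "expectation (\<lambda>\<omega>. (\<lambda>_. 1) (\<lambda>i\<in>{i}. X i \<omega>) * close e i j \<omega>)
      = expectation (\<lambda>\<omega>. (\<lambda>_. 1) (\<lambda>i\<in>{i}. X i \<omega>) * ball_mass e (X i \<omega>))"
    using assms by (intro expectation_isolate) auto
  then show ?thesis
    using expectation_X[OF assms(1) ball_mass_measurable] by (simp add: mean_ball_mass_def)
qed

text \<open>First \<open>X l\<close> and then \<open>X j\<close> is integrated out. What remains is the product of the ball masses at \<open>X i\<close> and
  \<open>X k\<close>, which may be dependent; the arithmetic-geometric mean inequality removes the mixed term.\<close>

lemma expectation_two_close_single_link: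
  assumes pos: "1 \<le> i" "1 \<le> j" "1 \<le> k" "1 \<le> l"
    and sep: "separated {i, k} {j}" "separated {i, j, k} {l}"
  shows "expectation (\<lambda>\<omega>. close e i j \<omega> * close e k l \<omega>) \<le> mean_ball_mass_sq e"
proof -
  note [measurable] = X_measurable[OF pos(1)] X_measurable[OF pos(3)]
  define \<phi> where "\<phi> f = (of_bool (norm (f i - f j) \<le> e) :: real)" for f :: "nat \<Rightarrow> 'v"
  have \<phi>_meas: "\<phi> \<in> borel_measurable (PiM {i, j, k} (\<lambda>_. borel))"
  proof -
    have [measurable]: "(\<lambda>f. f i) \<in> PiM {i, j, k} (\<lambda>_. borel :: 'v measure) \<rightarrow>\<^sub>M borel"
      "(\<lambda>f. f j) \<in> PiM {i, j, k} (\<lambda>_. borel :: 'v measure) \<rightarrow>\<^sub>M borel"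
      by (rule measurable_component_singleton, simp)+
    show ?thesis unfolding \<phi>_def by measurable
  qed
  have "expectation (\<lambda>\<omega>. close e i j \<omega> * close e k l \<omega>)
      = expectation (\<lambda>\<omega>. \<phi> (\<lambda>i\<in>{i, j, k}. X i \<omega>) * close e k l \<omega>)"
    by (simp add: \<phi>_def close_def)
  also have "\<dots> = expectation (\<lambda>\<omega>. \<phi> (\<lambda>i\<in>{i, j, k}. X i \<omega>) * ball_mass e (X k \<omega>))"
    using pos sep(2) \<phi>_meas by (intro expectation_isolate) (auto simp: \<phi>_def)
  also have "\<dots> = expectation (\<lambda>\<omega>. (\<lambda>f. ball_mass e (f k)) (\<lambda>i\<in>{i, k}. X i \<omega>) * close e i j \<omega>)"
    by (simp add: \<phi>_def close_def mult.commute)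
  also have "\<dots> = expectation (\<lambda>\<omega>. (\<lambda>f. ball_mass e (f k)) (\<lambda>i\<in>{i, k}. X i \<omega>) * ball_mass e (X i \<omega>))"
  proof (rule expectation_isolate)
    have "(\<lambda>f. f k) \<in> PiM {i, k} (\<lambda>_. borel :: 'v measure) \<rightarrow>\<^sub>M borel"
      by (rule measurable_component_singleton) simp
    then show "(\<lambda>f. ball_mass e (f k)) \<in> borel_measurable (PiM {i, k} (\<lambda>_. borel))"
      by (rule measurable_compose) measurable
  qed (use pos sep(1) ball_mass_bounds in auto)
  also have "\<dots> = expectation (\<lambda>\<omega>. ball_mass e (X k \<omega>) * ball_mass e (X i \<omega>))" by simp
  also have "\<dots> \<le> expectation (\<lambda>\<omega>. (ball_mass e (X k \<omega>))\<^sup>2 / 2 + (ball_mass e (X i \<omega>))\<^sup>2 / 2)"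
  proof (rule integral_mono)
    show "integrable M (\<lambda>\<omega>. ball_mass e (X k \<omega>) * ball_mass e (X i \<omega>))"
      using ball_mass_bounds by (intro integrable_const_bound[of _ 1]) (auto intro!: mult_le_one)
    show "integrable M (\<lambda>\<omega>. (ball_mass e (X k \<omega>))\<^sup>2 / 2 + (ball_mass e (X i \<omega>))\<^sup>2 / 2)"
      by (intro Bochner_Integration.integrable_add integrable_divide integrable_const_bound[of _ 1])
         (auto simp: ball_mass_sq_le)
    show "ball_mass e (X k \<omega>) * ball_mass e (X i \<omega>) \<le> (ball_mass e (X k \<omega>))\<^sup>2 / 2 + (ball_mass e (X i \<omega>))\<^sup>2 / 2" for \<omega>
      using sum_squares_bound[of "ball_mass e (X k \<omega>)" "ball_mass e (X i \<omega>)"] by simp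
  qed
  also have "\<dots> = expectation (\<lambda>\<omega>. (ball_mass e (X k \<omega>))\<^sup>2) / 2 + expectation (\<lambda>\<omega>. (ball_mass e (X i \<omega>))\<^sup>2) / 2"
    by (subst Bochner_Integration.integral_add)
       (auto intro!: integrable_divide integrable_const_bound[of _ 1] simp: ball_mass_sq_le)
  also have "\<dots> = mean_ball_mass_sq e"
    using expectation_X[OF pos(3), of "\<lambda>x. (ball_mass e x)\<^sup>2"] expectation_X[OF pos(1), of "\<lambda>x. (ball_mass e x)\<^sup>2"]
    by (simp add: mean_ball_mass_sq_def)
  finally show ?thesis .
qed

text \<open>When the two pairs share \<open>i\<close>, the four-point densities do not apply. Instead \<open>X j\<close> and \<open>X l\<close> are forced
  to be close to each other, which is rare by itself, while integrating out \<open>X i\<close> yields a ball mass; the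
  Cauchy-Schwarz inequality combines the two gains.\<close>

lemma expectation_two_close_common_index:
  assumes pos: "1 \<le> i" "1 \<le> j" "1 \<le> l" and sep: "separated {j, l} {i}"
  shows "expectation (\<lambda>\<omega>. close e i j \<omega> * close e i l \<omega>)
     \<le> sqrt (expectation (close (2 * e) j l) * mean_ball_mass_sq e)"
proof -
  note [measurable] = X_measurable[OF pos(2)] close_measurable[OF pos(2,3)] close_measurable[OF pos(2,1)]
     close_measurable[OF pos(1,2)] close_measurable[OF pos(1,3)]
  have int: "integrable M (\<lambda>\<omega>. close a b c \<omega> * close a' b' c' \<omega>)"
    if "random_variable borel (close a b c)" "random_variable borel (close a' b' c')" for a b c a' b' c'
    using that close_bounds by (intro integrable_const_bound[of _ 1]) (auto intro!: mult_le_one)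
  define \<phi> where "\<phi> f = (of_bool (norm (f j - f l) \<le> 2 * e) :: real)" for f :: "nat \<Rightarrow> 'v"
  have \<phi>_meas: "\<phi> \<in> borel_measurable (PiM {j, l} (\<lambda>_. borel))"
  proof -
    have [measurable]: "(\<lambda>f. f j) \<in> PiM {j, l} (\<lambda>_. borel :: 'v measure) \<rightarrow>\<^sub>M borel"
      "(\<lambda>f. f l) \<in> PiM {j, l} (\<lambda>_. borel :: 'v measure) \<rightarrow>\<^sub>M borel"
      by (rule measurable_component_singleton, simp)+
    show ?thesis unfolding \<phi>_def by measurable
  qed
  (* by the triangle inequality, X j and X l are within 2 * e of each other *)
  have "expectation (\<lambda>\<omega>. close e i j \<omega> * close e i l \<omega>) \<le> expectation (\<lambda>\<omega>. close (2 * e) j l \<omega> * close e j i \<omega>)"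
  proof (rule integral_mono)
    fix \<omega>
    have "norm (X j \<omega> - X l \<omega>) \<le> norm (X i \<omega> - X j \<omega>) + norm (X i \<omega> - X l \<omega>)"
      using norm_triangle_ineq4[of "X i \<omega> - X l \<omega>" "X i \<omega> - X j \<omega>"] by simp
    then show "close e i j \<omega> * close e i l \<omega> \<le> close (2 * e) j l \<omega> * close e j i \<omega>"
      by (auto simp: close_def norm_minus_commute)
  qed (auto intro!: int)
  also have "\<dots> = expectation (\<lambda>\<omega>. \<phi> (\<lambda>i\<in>{j, l}. X i \<omega>) * close e j i \<omega>)"
    by (simp add: \<phi>_def close_def)
  also have "\<dots> = expectation (\<lambda>\<omega>. \<phi> (\<lambda>i\<in>{j, l}. X i \<omega>) * ball_mass e (X j \<omega>))"
    using pos sep \<phi>_meas by (intro expectation_isolate) (auto simp: \<phi>_def)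
  also have "\<dots> = expectation (\<lambda>\<omega>. close (2 * e) j l \<omega> * ball_mass e (X j \<omega>))"
    by (simp add: \<phi>_def close_def)
  also have "\<dots> \<le> sqrt (expectation (close (2 * e) j l) * mean_ball_mass_sq e)"
  proof (rule real_le_rsqrt)
    have sq: "(close (2 * e) j l \<omega>)\<^sup>2 = close (2 * e) j l \<omega>" for \<omega> by (simp add: close_def)
    have "(expectation (\<lambda>\<omega>. close (2 * e) j l \<omega> * ball_mass e (X j \<omega>)))\<^sup>2
       \<le> expectation (\<lambda>\<omega>. (close (2 * e) j l \<omega>)\<^sup>2) * expectation (\<lambda>\<omega>. (ball_mass e (X j \<omega>))\<^sup>2)"
    proof (rule integral_Cauchy_Schwarz(2))
      show "integrable M (\<lambda>\<omega>. (close (2 * e) j l \<omega>)\<^sup>2)"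
        unfolding sq using close_bounds by (intro integrable_const_bound[of _ 1]) auto
      show "integrable M (\<lambda>\<omega>. (ball_mass e (X j \<omega>))\<^sup>2)"
        by (intro integrable_const_bound[of _ 1]) (auto simp: ball_mass_sq_le)
    qed auto
    then show "(expectation (\<lambda>\<omega>. close (2 * e) j l \<omega> * ball_mass e (X j \<omega>)))\<^sup>2
       \<le> expectation (close (2 * e) j l) * mean_ball_mass_sq e"
      unfolding sq using expectation_X[OF pos(2), of "\<lambda>x. (ball_mass e x)\<^sup>2"]
      by (simp add: mean_ball_mass_sq_def)
  qed
  finally show ?thesis .
qed

end

context stationary_m_dependent
begin

abbreviation pair_law :: "nat \<Rightarrow> nat \<Rightarrow> ('v \<times> 'v) measure" where
  "pair_law i j \<equiv> distr M borel (\<lambda>\<omega>. (X i \<omega>, X j \<omega>))"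

lemma pair_measurable: "1 \<le> i \<Longrightarrow> 1 \<le> j \<Longrightarrow> random_variable borel (\<lambda>\<omega>. (X i \<omega>, X j \<omega>))"
  unfolding borel_prod[symmetric] by (intro measurable_Pair X_measurable)

lemma expectation_close_pair_law:
  assumes "1 \<le> i" "1 \<le> j"
  shows "expectation (close e i j) = measure (pair_law i j) {z. dist (fst z) (snd z) \<le> e}"
proof -
  have [measurable]: "{z :: 'v \<times> 'v. dist (fst z) (snd z) \<le> e} \<in> sets borel"
    by (intro borel_closed closed_Collect_le continuous_intros)
  have "expectation (close e i j) = (\<integral>\<omega>. indicator {z. dist (fst z) (snd z) \<le> e} (X i \<omega>, X j \<omega>) \<partial>M)"
    by (intro Bochner_Integration.integral_cong) (auto simp: close_def dist_norm)
  also have "\<dots> = (\<integral>z. indicator {z. dist (fst z) (snd z) \<le> e} z \<partial>pair_law i j)"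
    by (subst integral_distr[OF pair_measurable[OF assms]]) auto
  finally show ?thesis by simp
qed

lemma indep_pairs:
  assumes "1 \<le> i" "1 \<le> j" "1 \<le> k" "1 \<le> l" "separated {i, k} {j, l}"
  shows "indep_var borel (\<lambda>\<omega>. (X i \<omega>, X k \<omega>)) borel (\<lambda>\<omega>. (X j \<omega>, X l \<omega>))"
proof -
  have *: "(\<lambda>f. (f a, f b)) \<in> PiM {a, b} (\<lambda>_. borel :: 'v measure) \<rightarrow>\<^sub>M borel" for a b :: nat
    unfolding borel_prod[symmetric] by (intro measurable_Pair measurable_component_singleton) auto
  show ?thesis
    using indep_var_of_separated[of "{i, k}" "{j, l}", OF _ _ assms(5) _ * *] assms by auto
qed

lemma expectation_two_close_pair_law:
  assumes pos: "1 \<le> i" "1 \<le> j" "1 \<le> k" "1 \<le> l" and sep: "separated {i, k} {j, l}"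
  shows "expectation (\<lambda>\<omega>. close e i j \<omega> * close e k l \<omega>)
    = (\<integral>z. of_bool (dist (fst (fst z)) (fst (snd z)) \<le> e \<and> dist (snd (fst z)) (snd (snd z)) \<le> e)
        \<partial>(pair_law i k \<Otimes>\<^sub>M pair_law j l))"
proof -
  define F where "F z = (of_bool (dist (fst (fst z)) (fst (snd z)) \<le> e \<and> dist (snd (fst z)) (snd (snd z)) \<le> e) :: real)"
    for z :: "('v \<times> 'v) \<times> ('v \<times> 'v)"
  have F [measurable]: "F \<in> borel_measurable (borel \<Otimes>\<^sub>M borel)"
  proof -
    have "F = indicator {z. dist (fst (fst z)) (fst (snd z)) \<le> e \<and> dist (snd (fst z)) (snd (snd z)) \<le> e}"
      by (auto simp: F_def fun_eq_iff)
    moreover have "closed {z :: ('v \<times> 'v) \<times> ('v \<times> 'v). dist (fst (fst z)) (fst (snd z)) \<le> e \<and> dist (snd (fst z)) (snd (snd z)) \<le> e}"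
      by (intro closed_Collect_conj closed_Collect_le continuous_intros)
    ultimately show ?thesis
      unfolding borel_prod by (simp add: borel_measurable_indicator borel_closed)
  qed
  have joint: "pair_law i k \<Otimes>\<^sub>M pair_law j l
      = distr M (borel \<Otimes>\<^sub>M borel) (\<lambda>\<omega>. ((X i \<omega>, X k \<omega>), (X j \<omega>, X l \<omega>)))"
    using indep_pairs[OF assms] unfolding indep_var_distribution_eq by simp
  have "expectation (\<lambda>\<omega>. close e i j \<omega> * close e k l \<omega>) = expectation (\<lambda>\<omega>. F ((X i \<omega>, X k \<omega>), (X j \<omega>, X l \<omega>)))"
    by (intro Bochner_Integration.integral_cong) (auto simp: close_def F_def dist_norm)
  also have "\<dots> = (\<integral>z. F z \<partial>(pair_law i k \<Otimes>\<^sub>M pair_law j l))"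
    unfolding joint
    by (subst integral_distr[OF measurable_Pair[OF pair_measurable pair_measurable]]) (use pos in auto)
  finally show ?thesis unfolding F_def .
qed

text \<open>Only finitely many pair laws occur among near indices: by stationarity the smaller index may be moved to \<open>1\<close>.\<close>

lemma pair_law_representative:
  assumes "1 \<le> i" "1 \<le> k" "i \<le> k + m" "k \<le> i + m"
  obtains a b where "a \<in> {1..m + 1}" "b \<in> {1..m + 1}" "a = b \<longleftrightarrow> i = k" "pair_law i k = pair_law a b"
proof -
  define h where "h = min i k - 1"
  define a b where "a = i - h" and "b = k - h"
  have ik: "i = a + h" "k = b + h" and ab: "1 \<le> a" "1 \<le> b"
    using assms by (auto simp: a_def b_def h_def min_def)
  have "pair_law i k = pair_law a b" unfolding ik by (rule pair_law_shift[OF ab])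
  moreover have "a \<in> {1..m + 1}" "b \<in> {1..m + 1}" "a = b \<longleftrightarrow> i = k"
    using assms by (auto simp: a_def b_def h_def min_def split: if_splits)
  ultimately show thesis using that by blast
qed

text \<open>Up to shifts, the quadruples in which both indices of the second pair are near, but not equal to, those
  of the first one. Their finiteness turns pointwise limits into uniform ones.\<close>

definition near_types :: "(nat \<times> nat \<times> nat \<times> nat) set" where
  "near_types = {(a, b, c, d) \<in> {1..m + 1} \<times> {1..m + 1} \<times> {1..m + 1} \<times> {1..m + 1}. a \<noteq> b \<and> c \<noteq> d}"

definition near_pair_mean :: "real \<Rightarrow> real" where
  "near_pair_mean e = (\<Sum>s=1..3 * m. expectation (close e 1 (1 + s)))"

definition near_quad_mean :: "real \<Rightarrow> real" where
  "near_quad_mean e = (\<Sum>(a, b, c, d)\<in>near_types.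
     expectation (\<lambda>\<omega>. close e a (c + 2 * m + 1) \<omega> * close e b (d + 2 * m + 1) \<omega>))"

text \<open>A bound that serves all doubly linked pairs at once: the first summand for four distinct indices, the
  second for a common index.\<close>

definition double_link_bound :: "real \<Rightarrow> real" where
  "double_link_bound e = near_quad_mean e + sqrt (near_pair_mean (2 * e) * mean_ball_mass_sq e)"

lemma finite_near_types: "finite near_types"
  unfolding near_types_def by (rule finite_subset[of _ "{1..m + 1} \<times> {1..m + 1} \<times> {1..m + 1} \<times> {1..m + 1}"]) auto

lemma mean_ball_mass_sq_nonneg: "0 \<le> mean_ball_mass_sq e"
  unfolding mean_ball_mass_sq_def by (rule Bochner_Integration.integral_nonneg) simp

lemma expectation_close_nonneg: "0 \<le> expectation (close e i j)"
  using close_bounds(1) by (rule Bochner_Integration.integral_nonneg)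

lemma expectation_two_close_nonneg: "0 \<le> expectation (\<lambda>\<omega>. close e i j \<omega> * close e k l \<omega>)"
  by (rule Bochner_Integration.integral_nonneg) (simp add: close_bounds)

lemma near_pair_mean_nonneg: "0 \<le> near_pair_mean e"
  unfolding near_pair_mean_def by (intro sum_nonneg expectation_close_nonneg)

lemma near_quad_mean_nonneg: "0 \<le> near_quad_mean e"
  unfolding near_quad_mean_def by (intro sum_nonneg) (auto intro!: expectation_two_close_nonneg)

lemma expectation_close_near:
  assumes "1 \<le> j" "1 \<le> l" "j \<noteq> l" "j \<le> l + 3 * m" "l \<le> j + 3 * m"
  shows "expectation (close e j l) \<le> near_pair_mean e"
proof -
  have step: "expectation (close e j l) \<le> near_pair_mean e" if "1 \<le> j" "j < l" "l \<le> j + 3 * m" for j l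
  proof -
    define s where "s = l - j"
    have s: "s \<in> {1..3 * m}" and jl: "j = 1 + (j - 1)" "l = (1 + s) + (j - 1)"
      using that by (auto simp: s_def)
    have "pair_law j l = pair_law 1 (1 + s)"
      using pair_law_shift[of 1 "1 + s" "j - 1"] unfolding jl[symmetric] by simp
    then have "expectation (close e j l) = expectation (close e 1 (1 + s))"
      using that by (simp add: expectation_close_pair_law)
    also have "\<dots> \<le> near_pair_mean e"
      unfolding near_pair_mean_def
      by (rule member_le_sum[OF s]) (auto intro: expectation_close_nonneg)
    finally show ?thesis .
  qed
  show ?thesis
  proof (cases "j < l")
    case True
    then show ?thesis using assms by (intro step) auto
  next
    case False
    then have "expectation (close e l j) \<le> near_pair_mean e" using assms by (intro step) auto
    then show ?thesis using close_sym[of e l j] by simp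
  qed
qed

lemma expectation_two_close_double_link:
  assumes pos: "1 \<le> i" "1 \<le> j" "1 \<le> k" "1 \<le> l"
    and sep: "separated {i, k} {j, l}"
    and near: "i \<le> k + m" "k \<le> i + m" "j \<le> l + m" "l \<le> j + m"
    and ne: "i \<noteq> k \<or> j \<noteq> l"
  shows "expectation (\<lambda>\<omega>. close e i j \<omega> * close e k l \<omega>) \<le> double_link_bound e"
proof -
  have mono: "sqrt (expectation (close (2 * e) a b) * mean_ball_mass_sq e) \<le> double_link_bound e"
    if "1 \<le> a" "1 \<le> b" "a \<noteq> b" "a \<le> b + m" "b \<le> a + m" for a b
  proof -
    have "expectation (close (2 * e) a b) * mean_ball_mass_sq e \<le> near_pair_mean (2 * e) * mean_ball_mass_sq e"
      using that by (intro mult_right_mono expectation_close_near mean_ball_mass_sq_nonneg) auto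
    then show ?thesis
      unfolding double_link_bound_def using near_quad_mean_nonneg[of e] by (simp add: add_increasing)
  qed
  consider "i = k" "j \<noteq> l" | "i \<noteq> k" "j = l" | "i \<noteq> k" "j \<noteq> l" using ne by blast
  then show ?thesis
  proof cases
    case 1
    have "expectation (\<lambda>\<omega>. close e i j \<omega> * close e i l \<omega>) \<le> sqrt (expectation (close (2 * e) j l) * mean_ball_mass_sq e)"
      using pos sep 1 by (intro expectation_two_close_common_index) (auto simp: separated_def)
    also have "\<dots> \<le> double_link_bound e" using pos near 1 by (intro mono) auto
    finally show ?thesis using 1 by simp
  next
    case 2
    have "expectation (\<lambda>\<omega>. close e j i \<omega> * close e j k \<omega>) \<le> sqrt (expectation (close (2 * e) i k) * mean_ball_mass_sq e)"
      using pos sep 2 by (intro expectation_two_close_common_index) (auto simp: separated_def)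
    also have "\<dots> \<le> double_link_bound e" using pos near 2 by (intro mono) auto
    finally show ?thesis using 2 close_sym[of e j i] close_sym[of e j k] by simp
  next
    case 3
    obtain a b where ab: "a \<in> {1..m + 1}" "b \<in> {1..m + 1}" "a = b \<longleftrightarrow> i = k" "pair_law i k = pair_law a b"
      by (rule pair_law_representative[OF pos(1,3) near(1,2)])
    obtain c d where cd: "c \<in> {1..m + 1}" "d \<in> {1..m + 1}" "c = d \<longleftrightarrow> j = l" "pair_law j l = pair_law c d"
      by (rule pair_law_representative[OF pos(2,4) near(3,4)])
    (* the second pair is moved beyond the reach of the first, whose indices are at most m + 1 *)
    have law: "pair_law j l = pair_law (c + 2 * m + 1) (d + 2 * m + 1)"
      using pair_law_shift[of c d "2 * m + 1"] cd by (simp add: add.assoc)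
    have sep': "separated {a, b} {c + 2 * m + 1, d + 2 * m + 1}"
      using ab cd by (auto simp: separated_def)
    have pos': "1 \<le> a" "1 \<le> c + 2 * m + 1" "1 \<le> b" "1 \<le> d + 2 * m + 1"
      using ab cd by auto
    have "expectation (\<lambda>\<omega>. close e i j \<omega> * close e k l \<omega>)
        = expectation (\<lambda>\<omega>. close e a (c + 2 * m + 1) \<omega> * close e b (d + 2 * m + 1) \<omega>)"
      unfolding expectation_two_close_pair_law[OF pos sep] expectation_two_close_pair_law[OF pos' sep'] ab(4) law ..
    also have "\<dots> = (case (a, b, c, d) of (a, b, c, d) \<Rightarrow>
        expectation (\<lambda>\<omega>. close e a (c + 2 * m + 1) \<omega> * close e b (d + 2 * m + 1) \<omega>))" by simp
    also have "\<dots> \<le> near_quad_mean e"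
      unfolding near_quad_mean_def
    proof (rule member_le_sum[OF _ _ finite_near_types])
      show "(a, b, c, d) \<in> near_types" using ab cd 3 by (simp add: near_types_def)
    qed (auto intro: expectation_two_close_nonneg)
    also have "\<dots> \<le> double_link_bound e"
      unfolding double_link_bound_def
      using near_pair_mean_nonneg mean_ball_mass_sq_nonneg by simp
    finally show ?thesis .
  qed
qed

lemma tendsto_two_close_distinct:
  assumes "distinct [t1, t2, t3, t4]" "1 \<le> t1" "1 \<le> t2" "1 \<le> t3" "1 \<le> t4"
    and e: "\<And>n. 0 < e n" "e \<longlonglongrightarrow> 0"
  shows "(\<lambda>n. expectation (\<lambda>\<omega>. close (e n) t1 t3 \<omega> * close (e n) t2 t4 \<omega>) / e n ^ DIM('v)) \<longlonglongrightarrow> 0"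
proof -
  obtain pt where pt: "has_density M (\<lambda>\<omega>. (X t1 \<omega>, X t2 \<omega>, X t3 \<omega>, X t4 \<omega>)) pt"
    "AE (x1, x2) in lborel. integrable lborel (\<lambda>(x3, x4). (pt (x1, x2, x3, x4))\<^sup>2)"
    "integrable lborel (\<lambda>(x1, x2). sqrt (LINT (x3, x4)|lborel. (pt (x1, x2, x3, x4))\<^sup>2))"
    using X_assumption_A[unfolded assumption_A_def, THEN conjunct2, THEN conjunct2, rule_format, of t1 t2 t3 t4]
      assms(1-5) that by (simp del: split_paired_All) (elim exE conjE, blast)
  note [measurable] = X_measurable[OF assms(2)] X_measurable[OF assms(3)] X_measurable[OF assms(4)] X_measurable[OF assms(5)]
  have "expectation (\<lambda>\<omega>. close (e n) t1 t3 \<omega> * close (e n) t2 t4 \<omega>)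
     = prob {\<omega> \<in> space M. norm (X t1 \<omega> - X t3 \<omega>) \<le> e n \<and> norm (X t2 \<omega> - X t4 \<omega>) \<le> e n}" for n
  proof -
    have "expectation (\<lambda>\<omega>. close (e n) t1 t3 \<omega> * close (e n) t2 t4 \<omega>)
        = (\<integral>\<omega>. indicator {\<omega> \<in> space M. norm (X t1 \<omega> - X t3 \<omega>) \<le> e n \<and> norm (X t2 \<omega> - X t4 \<omega>) \<le> e n} \<omega> \<partial>M)"
      by (intro Bochner_Integration.integral_cong) (auto simp: close_def)
    then show ?thesis by (simp add: Int_def conj_commute)
  qed
  then show ?thesis using two_close_pairs_ratio_tendsto_0[OF pt e] by simp
qed

text \<open>The square of this probability is the probability that the pair and an independent copy of it are both
  close, and is therefore \<open>o(e^d)\<close>.\<close>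

lemma tendsto_close_near:
  assumes s: "1 \<le> s" and e: "\<And>n. 0 < e n" "e \<longlonglongrightarrow> 0"
  shows "(\<lambda>n. expectation (close (e n) 1 (1 + s)) / sqrt (e n ^ DIM('v))) \<longlonglongrightarrow> 0"
proof -
  (* shifting the pair by H gives an independent copy of it *)
  define H where "H = s + m + 1"
  have sq: "expectation (\<lambda>\<omega>. close r 1 (1 + s) \<omega> * close r (1 + H) (1 + s + H) \<omega>)
      = (expectation (close r 1 (1 + s)))\<^sup>2" for r
  proof -
    define f where "f a b g = (of_bool (norm (g a - g b) \<le> r) :: real)" for a b and g :: "nat \<Rightarrow> 'v"
    have f: "f a b \<in> borel_measurable (PiM {a, b} (\<lambda>_. borel))" for a b
    proof -
      have [measurable]: "(\<lambda>g. g a) \<in> PiM {a, b} (\<lambda>_. borel :: 'v measure) \<rightarrow>\<^sub>M borel"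
        "(\<lambda>g. g b) \<in> PiM {a, b} (\<lambda>_. borel :: 'v measure) \<rightarrow>\<^sub>M borel"
        by (rule measurable_component_singleton, simp)+
      show ?thesis unfolding f_def by measurable
    qed
    have "indep_var borel (\<lambda>\<omega>. f 1 (1 + s) (\<lambda>i\<in>{1, 1 + s}. X i \<omega>)) borel
        (\<lambda>\<omega>. f (1 + H) (1 + s + H) (\<lambda>i\<in>{1 + H, 1 + s + H}. X i \<omega>))"
      by (intro indep_var_of_separated f) (auto simp: separated_def H_def)
    then have ind: "indep_var borel (close r 1 (1 + s)) borel (close r (1 + H) (1 + s + H))"
      by (simp add: f_def close_def[abs_def])
    have int: "integrable M (close r a b)" if "1 \<le> a" "1 \<le> b" for a b
      using close_bounds close_measurable[OF that] by (intro integrable_const_bound[of _ 1]) auto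
    have "pair_law (1 + H) (1 + s + H) = pair_law 1 (1 + s)" by (rule pair_law_shift) auto
    then have "expectation (close r (1 + H) (1 + s + H)) = expectation (close r 1 (1 + s))"
      by (simp add: expectation_close_pair_law)
    then show ?thesis
      using indep_var_lebesgue_integral[OF ind int int] by (simp add: power2_eq_square)
  qed
  have "distinct [1, 1 + H, 1 + s, 1 + s + H]" using s by (auto simp: H_def)
  from tendsto_two_close_distinct[OF this _ _ _ _ e]
  have "(\<lambda>n. sqrt ((expectation (close (e n) 1 (1 + s)))\<^sup>2 / e n ^ DIM('v))) \<longlonglongrightarrow> sqrt 0"
    unfolding sq by (intro tendsto_real_sqrt) simp
  then show ?thesis
    by (simp add: real_sqrt_divide expectation_close_nonneg)
qed

lemma tendsto_near_pair_mean:
  assumes e: "\<And>n. 0 < e n" "e \<longlonglongrightarrow> 0"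
  shows "(\<lambda>n. near_pair_mean (e n) / sqrt (e n ^ DIM('v))) \<longlonglongrightarrow> 0"
  unfolding near_pair_mean_def sum_divide_distrib
  by (intro tendsto_null_sum tendsto_close_near e) auto

lemma tendsto_near_quad_mean:
  assumes e: "\<And>n. 0 < e n" "e \<longlonglongrightarrow> 0"
  shows "(\<lambda>n. near_quad_mean (e n) / e n ^ DIM('v)) \<longlonglongrightarrow> 0"
  unfolding near_quad_mean_def sum_divide_distrib case_prod_beta
proof (intro tendsto_null_sum)
  fix t assume t: "t \<in> near_types"
  obtain a b c d where abcd: "t = (a, b, c, d)" by (cases t)
  show "(\<lambda>n. expectation (\<lambda>\<omega>. close (e n) (fst t) (fst (snd (snd t)) + 2 * m + 1) \<omega> *
          close (e n) (fst (snd t)) (snd (snd (snd t)) + 2 * m + 1) \<omega>) / e n ^ DIM('v)) \<longlonglongrightarrow> 0"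
    using t unfolding abcd fst_conv snd_conv
    by (intro tendsto_two_close_distinct e) (auto simp: near_types_def)
qed

end

section \<open>Small balls under the marginal density\<close>

lemma cball_in_borel [measurable]: "cball x e \<in> sets borel"
  by (rule borel_closed) simp

context stationary_m_dependent
begin

lemma p_measurable [measurable]: "p \<in> borel_measurable borel"
  using has_densityD(1)[OF X_density[of 1]] by simp

lemma p_nonneg: "0 \<le> p x"
  using has_densityD(2)[OF X_density[of 1]] by simp

lemma p_nn_integral: "(\<integral>\<^sup>+x. ennreal (p x) \<partial>lborel) = 1"
  using prob_space.emeasure_space_1[OF prob_space_mu] unfolding mu_def
  by (simp add: emeasure_density)

lemma p_integrable: "integrable lborel p"
  using p_nn_integral p_nonneg by (intro integrableI_nonneg) auto

lemma p_cube_integrable: "integrable lborel (\<lambda>x. (p x) ^ 3)"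
  using X_assumption_A p_nonneg unfolding assumption_A_def by simp

text \<open>The density lies in \<open>L_1\<close> and in \<open>L_3\<close>, hence in \<open>L_2\<close>.\<close>

lemma p_square_integrable: "integrable lborel (\<lambda>x. (p x)\<^sup>2)"
proof (rule Bochner_Integration.integrable_bound[OF Bochner_Integration.integrable_add[OF p_integrable p_cube_integrable]])
  have "y\<^sup>2 \<le> y + y ^ 3" if "0 \<le> y" for y :: real
  proof (cases "y \<le> 1")
    case True
    then have "y\<^sup>2 \<le> y" using that by (simp add: power2_eq_square mult_left_le)
    then show ?thesis using zero_le_power[OF that, of 3] by linarith
  next
    case False
    then have "y\<^sup>2 \<le> y ^ 3" by (intro power_increasing) auto
    then show ?thesis using that by simp
  qed
  then show "AE x in lborel. norm ((p x)\<^sup>2) \<le> norm (p x + (p x) ^ 3)"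
    using p_nonneg by (simp add: add_nonneg_nonneg)
qed measurable

lemma q2_pos: "0 < q2 p"
proof (rule ccontr)
  assume "\<not> 0 < q2 p"
  moreover have "0 \<le> q2 p" unfolding q2_def by (rule Bochner_Integration.integral_nonneg) simp
  ultimately have "(\<integral>x. (p x)\<^sup>2 \<partial>lborel) = 0" unfolding q2_def by linarith
  then have "AE x in lborel. (p x)\<^sup>2 = 0"
    using integral_nonneg_eq_0_iff_AE[OF p_square_integrable] by simp
  then have "AE x in lborel. ennreal (p x) = 0" by eventually_elim simp
  then have "(\<integral>\<^sup>+x. ennreal (p x) \<partial>lborel) = (\<integral>\<^sup>+x. 0 \<partial>(lborel :: 'v measure))"
    by (rule nn_integral_cong_AE)
  then show False using p_nn_integral by simp
qed

lemma ball_mass_eq: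
  "ennreal (ball_mass e x) = (\<integral>\<^sup>+h. ennreal (p (x + h)) * indicator (cball 0 e) h \<partial>lborel)"
proof -
  interpret mu: prob_space mu by (rule prob_space_mu)
  have "ennreal (ball_mass e x) = emeasure mu (cball x e)"
    by (simp add: ball_mass_def mu.emeasure_eq_measure)
  also have "\<dots> = (\<integral>\<^sup>+y. ennreal (p y) * indicator (cball x e) y \<partial>lborel)"
    unfolding mu_def by (subst emeasure_density) auto
  also have "\<dots> = (\<integral>\<^sup>+h. ennreal (p (h + x)) * indicator (cball x e) (h + x) \<partial>lborel)"
    by (rule nn_integral_lborel_shift[symmetric]) measurable
  also have "\<dots> = (\<integral>\<^sup>+h. ennreal (p (x + h)) * indicator (cball 0 e) h \<partial>lborel)"
    by (intro nn_integral_cong) (auto simp: indicator_def dist_norm add.commute norm_minus_commute)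
  finally show ?thesis .
qed

text \<open>Centring the ball at the origin makes its indicator depend on the increment \<open>h\<close> alone, so that the integral
  over \<open>x\<close> can be carried out first.\<close>

lemma nn_integral_p_times_ball:
  fixes \<phi> :: "'v \<Rightarrow> real"
  assumes [measurable]: "\<phi> \<in> borel_measurable borel" and \<phi>: "\<And>x. 0 \<le> \<phi> x"
  shows "(\<integral>\<^sup>+x. ennreal (p x) * (\<integral>\<^sup>+h. ennreal (\<phi> (x + h)) * indicator (cball 0 e) h \<partial>lborel) \<partial>lborel)
       = (\<integral>\<^sup>+h. (\<integral>\<^sup>+x. ennreal (p x * \<phi> (x + h)) \<partial>lborel) * indicator (cball 0 e) h \<partial>lborel)"
proof -
  have [measurable]: "(\<lambda>z. \<phi> (fst z + snd z)) \<in> borel_measurable (lborel \<Otimes>\<^sub>M lborel)"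
    using borel_measurable_compose_continuous[of "\<lambda>z. fst z + snd z" \<phi>]
    by (simp add: lborel_prod continuous_on_add continuous_on_fst continuous_on_snd)
  have "(\<integral>\<^sup>+x. ennreal (p x) * (\<integral>\<^sup>+h. ennreal (\<phi> (x + h)) * indicator (cball 0 e) h \<partial>lborel) \<partial>lborel)
      = (\<integral>\<^sup>+x. (\<integral>\<^sup>+h. ennreal (p x * \<phi> (x + h)) * indicator (cball 0 e) h \<partial>lborel) \<partial>lborel)"
    using p_nonneg \<phi>
    by (intro nn_integral_cong, subst nn_integral_cmult[symmetric]) (auto simp: ennreal_mult mult.assoc)
  also have "\<dots> = (\<integral>\<^sup>+h. (\<integral>\<^sup>+x. ennreal (p x * \<phi> (x + h)) * indicator (cball 0 e) h \<partial>lborel) \<partial>lborel)"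
  proof (rule lborel_pair.Fubini'[symmetric])
    have "(\<lambda>z. ennreal (p (fst z) * \<phi> (fst z + snd z)) * indicator (cball 0 e) (snd z))
        \<in> borel_measurable (lborel \<Otimes>\<^sub>M lborel)" by measurable
    then show "(\<lambda>(x, h). ennreal (p x * \<phi> (x + h)) * indicator (cball 0 e) h)
        \<in> borel_measurable (lborel \<Otimes>\<^sub>M lborel)" by (simp add: case_prod_beta)
  qed
  also have "\<dots> = (\<integral>\<^sup>+h. (\<integral>\<^sup>+x. ennreal (p x * \<phi> (x + h)) \<partial>lborel) * indicator (cball 0 e) h \<partial>lborel)"
    by (intro nn_integral_cong nn_integral_multc) measurable
  finally show ?thesis .
qed

text \<open>Expanding the square and using translation invariance of Lebesgue measure. This turns the smoothness class
  into a bound on the bias.\<close>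

lemma autocorrelation:
  shows p_shift_integrable: "integrable lborel (\<lambda>x. p x * p (x + h))"
    and "(\<integral>x. p x * p (x + h) \<partial>lborel) = q2 p - (\<integral>x. (p (x + h) - p x)\<^sup>2 \<partial>lborel) / 2"
proof -
  have sh: "integrable lborel (\<lambda>x. (p (x + h))\<^sup>2)"
    using integrable_lborel_shift[of "\<lambda>x. (p x)\<^sup>2" h] p_square_integrable by simp
  show int: "integrable lborel (\<lambda>x. p x * p (x + h))"
    by (rule integrable_mult_square_integrable[OF _ _ p_square_integrable sh]) measurable
  have "(\<integral>x. (p (x + h) - p x)\<^sup>2 \<partial>lborel) = (\<integral>x. (p (x + h))\<^sup>2 + (p x)\<^sup>2 - 2 * (p x * p (x + h)) \<partial>lborel)"
    by (intro Bochner_Integration.integral_cong) (auto simp: power2_eq_square algebra_simps)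
  also have "\<dots> = 2 * q2 p - 2 * (\<integral>x. p x * p (x + h) \<partial>lborel)"
    using sh int p_square_integrable integral_lborel_shift[of "\<lambda>x. (p x)\<^sup>2" h] by (simp add: q2_def)
  finally show "(\<integral>x. p x * p (x + h) \<partial>lborel) = q2 p - (\<integral>x. (p (x + h) - p x)\<^sup>2 \<partial>lborel) / 2" by linarith
qed

lemma ennreal_mean_ball_mass:
  "ennreal (mean_ball_mass e) = (\<integral>\<^sup>+h. ennreal (\<integral>x. p x * p (x + h) \<partial>lborel) * indicator (cball 0 e) h \<partial>lborel)"
proof -
  interpret mu: prob_space mu by (rule prob_space_mu)
  have "ennreal (mean_ball_mass e) = (\<integral>\<^sup>+x. ennreal (ball_mass e x) \<partial>mu)"
    unfolding mean_ball_mass_def using ball_mass_bounds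
    by (intro nn_integral_eq_integral[symmetric] mu.integrable_const_bound[of _ 1]) auto
  also have "\<dots> = (\<integral>\<^sup>+x. ennreal (p x) * ennreal (ball_mass e x) \<partial>lborel)"
    unfolding mu_def by (subst nn_integral_density) auto
  also have "\<dots> = (\<integral>\<^sup>+h. (\<integral>\<^sup>+x. ennreal (p x * p (x + h)) \<partial>lborel) * indicator (cball 0 e) h \<partial>lborel)"
    unfolding ball_mass_eq by (rule nn_integral_p_times_ball) (use p_nonneg in auto)
  also have "\<dots> = (\<integral>\<^sup>+h. ennreal (\<integral>x. p x * p (x + h) \<partial>lborel) * indicator (cball 0 e) h \<partial>lborel)"
    using p_shift_integrable p_nonneg
    by (intro nn_integral_cong arg_cong2[where f = "(*)"] nn_integral_eq_integral) auto
  finally show ?thesis .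
qed

lemma mean_ball_mass_upper:
  assumes "0 \<le> e"
  shows "mean_ball_mass e \<le> ball_vol e DIM('v) * q2 p"
proof -
  have le: "(\<integral>x. p x * p (x + h) \<partial>lborel) \<le> q2 p" for h
    unfolding autocorrelation(2) by (simp add: Bochner_Integration.integral_nonneg)
  have "ennreal (mean_ball_mass e) \<le> (\<integral>\<^sup>+h. ennreal (q2 p) * indicator (cball 0 e) h \<partial>(lborel :: 'v measure))"
    unfolding ennreal_mean_ball_mass using le
    by (intro nn_integral_mono mult_right_mono ennreal_leI) auto
  also have "\<dots> = ennreal (q2 p) * ennreal (ball_vol e DIM('v))"
    by (subst nn_integral_cmult_indicator) (auto simp: emeasure_lborel_cball[OF assms])
  also have "\<dots> = ennreal (ball_vol e DIM('v) * q2 p)"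
    using q2_pos ball_vol_nonneg[OF DIM_positive[where 'a = 'v] assms] by (simp add: ennreal_mult mult.commute)
  finally show ?thesis
    using q2_pos ball_vol_nonneg[OF DIM_positive[where 'a = 'v] assms] by (subst (asm) ennreal_le_iff) auto
qed

lemma mean_ball_mass_nonneg: "0 \<le> mean_ball_mass e"
  unfolding mean_ball_mass_def using ball_mass_bounds by (intro Bochner_Integration.integral_nonneg)

lemma mean_ball_mass_lower:
  assumes e: "0 \<le> e" "e \<le> 1" and \<alpha>: "0 < \<alpha>" and K: "0 < K" and p: "p \<in> H2_class \<alpha> K"
  shows "ball_vol e DIM('v) * (q2 p - (K * e powr \<alpha>)\<^sup>2 / 2) \<le> mean_ball_mass e"
proof -
  (* truncation at 0 keeps the bound meaningful for extended nonnegative integrals *)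
  define c where "c = max 0 (q2 p - (K * e powr \<alpha>)\<^sup>2 / 2)"
  have ge: "c \<le> (\<integral>x. p x * p (x + h) \<partial>lborel)" if h: "norm h \<le> e" for h
  proof -
    let ?D = "\<integral>x. (p (x + h) - p x)\<^sup>2 \<partial>lborel"
    have "sqrt ?D \<le> K * norm h powr \<alpha>"
      using p h e by (auto simp: H2_class_def)
    also have "\<dots> \<le> K * e powr \<alpha>"
      using h K \<alpha> by (intro mult_left_mono powr_mono2) auto
    finally have "?D \<le> (K * e powr \<alpha>)\<^sup>2" by (rule sqrt_le_D)
    then have "q2 p - (K * e powr \<alpha>)\<^sup>2 / 2 \<le> (\<integral>x. p x * p (x + h) \<partial>lborel)"
      unfolding autocorrelation(2) by simp
    moreover have "0 \<le> (\<integral>x. p x * p (x + h) \<partial>lborel)"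
      using p_nonneg by (intro Bochner_Integration.integral_nonneg) simp
    ultimately show ?thesis by (simp add: c_def)
  qed
  have V: "0 \<le> ball_vol e DIM('v)" by (rule ball_vol_nonneg[OF DIM_positive e(1)])
  have "ennreal (ball_vol e DIM('v) * c) = ennreal c * ennreal (ball_vol e DIM('v))"
    using V by (simp add: ennreal_mult mult.commute c_def)
  also have "\<dots> = (\<integral>\<^sup>+h. ennreal c * indicator (cball 0 e) h \<partial>(lborel :: 'v measure))"
    by (subst nn_integral_cmult_indicator) (auto simp: emeasure_lborel_cball[OF e(1)])
  also have "\<dots> \<le> ennreal (mean_ball_mass e)"
    unfolding ennreal_mean_ball_mass
    using ge by (intro nn_integral_mono) (auto simp: indicator_def ennreal_leI)
  finally have "ball_vol e DIM('v) * c \<le> mean_ball_mass e"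
    using mean_ball_mass_nonneg by (simp add: ennreal_le_iff)
  moreover have "ball_vol e DIM('v) * (q2 p - (K * e powr \<alpha>)\<^sup>2 / 2) \<le> ball_vol e DIM('v) * c"
    using V by (intro mult_left_mono) (auto simp: c_def)
  ultimately show ?thesis by linarith
qed

text \<open>The Cauchy-Schwarz inequality on the ball gives \<open>(ball_mass e x)^2 \<le> V * (\<integral> p^2)\<close> with the integral over the ball around
  \<open>x\<close>; the remaining mixed integral of \<open>p x * (p (x + h))^2\<close> is at most twice the integral of \<open>p^3\<close>.\<close>

lemma mean_ball_mass_sq_upper:
  assumes e: "0 \<le> e"
  shows "mean_ball_mass_sq e \<le> (ball_vol e DIM('v))\<^sup>2 * (2 * (\<integral>x. (p x) ^ 3 \<partial>lborel))"
proof -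
  interpret mu: prob_space mu by (rule prob_space_mu)
  define V where "V = ball_vol e DIM('v)"
  have V: "0 \<le> V" unfolding V_def by (rule ball_vol_nonneg[OF DIM_positive e])
  define c3 where "c3 = (\<integral>x. (p x) ^ 3 \<partial>lborel)"
  have c3: "0 \<le> c3" unfolding c3_def using p_nonneg by (intro Bochner_Integration.integral_nonneg) simp
  let ?i = "indicator (cball 0 e) :: 'v \<Rightarrow> real"
  have i_int: "integrable lborel ?i" using emeasure_lborel_cball[OF e, of "0 :: 'v"] by simp
  have i_sq: "(?i h)\<^sup>2 = ?i h" for h by (simp add: indicator_def)
  have ps: "integrable lborel (\<lambda>h. (p (x + h))\<^sup>2)" for x
    using integrable_lborel_shift[of "\<lambda>x. (p x)\<^sup>2" x] p_square_integrable by (simp add: add.commute)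
  have psi: "integrable lborel (\<lambda>h. (p (x + h))\<^sup>2 * ?i h)" for x
    using integrable_mult_indicator[OF _ ps, of "cball 0 e" x] by (simp add: mult.commute)
  have mass_le: "ennreal ((ball_mass e x)\<^sup>2) \<le> ennreal V * (\<integral>\<^sup>+h. ennreal ((p (x + h))\<^sup>2) * indicator (cball 0 e) h \<partial>lborel)" for x
  proof -
    have fsq: "(p (x + h) * ?i h)\<^sup>2 = (p (x + h))\<^sup>2 * ?i h" for h by (simp add: indicator_def)
    have ffg: "p (x + h) * ?i h * ?i h = p (x + h) * ?i h" for h by (simp add: indicator_def)
    have int: "integrable lborel (\<lambda>h. p (x + h) * ?i h)"
      using integrable_mult_square_integrable[of "\<lambda>h. p (x + h) * ?i h" lborel ?i] psi[of x] i_int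
      unfolding fsq ffg i_sq by simp
    have cs: "(\<integral>h. p (x + h) * ?i h \<partial>lborel)\<^sup>2 \<le> (\<integral>h. (p (x + h))\<^sup>2 * ?i h \<partial>lborel) * (\<integral>h. ?i h \<partial>lborel)"
      using integral_Cauchy_Schwarz(2)[of "\<lambda>h. p (x + h) * ?i h" lborel ?i] psi[of x] i_int
      unfolding fsq ffg i_sq by simp
    have "ennreal (ball_mass e x) = (\<integral>\<^sup>+h. ennreal (p (x + h) * ?i h) \<partial>lborel)"
      unfolding ball_mass_eq by (intro nn_integral_cong) (auto simp: indicator_def)
    also have "\<dots> = ennreal (\<integral>h. p (x + h) * ?i h \<partial>lborel)"
      using int p_nonneg by (intro nn_integral_eq_integral) auto
    finally have bm: "ball_mass e x = (\<integral>h. p (x + h) * ?i h \<partial>lborel)"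
      using ball_mass_bounds p_nonneg by (subst (asm) ennreal_inj) (auto intro!: Bochner_Integration.integral_nonneg)
    have vol: "(\<integral>h. ?i h \<partial>lborel) = V"
      using emeasure_lborel_cball[OF e, of "0 :: 'v"] V by (simp add: measure_def V_def)
    have "ennreal ((ball_mass e x)\<^sup>2) \<le> ennreal (V * (\<integral>h. (p (x + h))\<^sup>2 * ?i h \<partial>lborel))"
      using cs unfolding bm vol by (intro ennreal_leI) (simp add: mult.commute)
    also have "\<dots> = ennreal V * ennreal (\<integral>h. (p (x + h))\<^sup>2 * ?i h \<partial>lborel)"
      using V by (simp add: ennreal_mult Bochner_Integration.integral_nonneg)
    also have "ennreal (\<integral>h. (p (x + h))\<^sup>2 * ?i h \<partial>lborel) = (\<integral>\<^sup>+h. ennreal ((p (x + h))\<^sup>2 * ?i h) \<partial>lborel)"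
      using psi by (intro nn_integral_eq_integral[symmetric]) auto
    also have "\<dots> = (\<integral>\<^sup>+h. ennreal ((p (x + h))\<^sup>2) * indicator (cball 0 e) h \<partial>lborel)"
      by (intro nn_integral_cong) (auto simp: indicator_def)
    finally show ?thesis .
  qed
  have cross: "(\<integral>\<^sup>+x. ennreal (p x * (p (x + h))\<^sup>2) \<partial>lborel) \<le> ennreal (2 * c3)" for h
  proof -
    have sh: "integrable lborel (\<lambda>x. (p (x + h)) ^ 3)"
      using integrable_lborel_shift[of "\<lambda>x. (p x) ^ 3" h] p_cube_integrable by simp
    have amgm: "a * b\<^sup>2 \<le> a ^ 3 + b ^ 3" if "0 \<le> a" "0 \<le> b" for a b :: real
    proof (cases "a \<le> b")
      case True
      then have "a * b\<^sup>2 \<le> b * b\<^sup>2" using that by (intro mult_right_mono) auto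
      then show ?thesis using zero_le_power[OF that(1), of 3] by (simp add: power3_eq_cube power2_eq_square)
    next
      case False
      then have "a * b\<^sup>2 \<le> a * a\<^sup>2" using that by (intro mult_left_mono power_mono) auto
      then show ?thesis using zero_le_power[OF that(2), of 3] by (simp add: power3_eq_cube power2_eq_square)
    qed
    have "(\<integral>\<^sup>+x. ennreal (p x * (p (x + h))\<^sup>2) \<partial>lborel) \<le> (\<integral>\<^sup>+x. ennreal ((p x) ^ 3 + (p (x + h)) ^ 3) \<partial>lborel)"
      using amgm p_nonneg by (intro nn_integral_mono ennreal_leI) auto
    also have "\<dots> = ennreal (\<integral>x. (p x) ^ 3 + (p (x + h)) ^ 3 \<partial>lborel)"
      using sh p_cube_integrable p_nonneg by (intro nn_integral_eq_integral) auto
    also have "(\<integral>x. (p x) ^ 3 + (p (x + h)) ^ 3 \<partial>lborel) = 2 * c3"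
      using sh p_cube_integrable integral_lborel_shift[of "\<lambda>x. (p x) ^ 3" h] by (simp add: c3_def)
    finally show ?thesis .
  qed
  have "ennreal (mean_ball_mass_sq e) = (\<integral>\<^sup>+x. ennreal ((ball_mass e x)\<^sup>2) \<partial>mu)"
    unfolding mean_ball_mass_sq_def
    by (intro nn_integral_eq_integral[symmetric] mu.integrable_const_bound[of _ 1]) (auto simp: ball_mass_sq_le)
  also have "\<dots> = (\<integral>\<^sup>+x. ennreal (p x) * ennreal ((ball_mass e x)\<^sup>2) \<partial>lborel)"
    unfolding mu_def by (subst nn_integral_density) auto
  also have "\<dots> \<le> (\<integral>\<^sup>+x. ennreal V * (ennreal (p x) * (\<integral>\<^sup>+h. ennreal ((p (x + h))\<^sup>2) * indicator (cball 0 e) h \<partial>lborel)) \<partial>lborel)"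
  proof (rule nn_integral_mono)
    fix x
    show "ennreal (p x) * ennreal ((ball_mass e x)\<^sup>2)
      \<le> ennreal V * (ennreal (p x) * (\<integral>\<^sup>+h. ennreal ((p (x + h))\<^sup>2) * indicator (cball 0 e) h \<partial>lborel))"
      using mult_left_mono[OF mass_le[of x], of "ennreal (p x)"] by (simp add: mult.left_commute)
  qed
  also have "\<dots> = ennreal V * (\<integral>\<^sup>+x. ennreal (p x) * (\<integral>\<^sup>+h. ennreal ((p (x + h))\<^sup>2) * indicator (cball 0 e) h \<partial>lborel) \<partial>lborel)"
  proof (rule nn_integral_cmult)
    have "(\<lambda>z. (p (fst z + snd z))\<^sup>2) \<in> borel_measurable (lborel \<Otimes>\<^sub>M lborel)"
      using borel_measurable_compose_continuous[of "\<lambda>z. fst z + snd z" "\<lambda>x. (p x)\<^sup>2"]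
      by (simp add: lborel_prod continuous_on_add continuous_on_fst continuous_on_snd)
    then have [measurable]: "(\<lambda>z. ennreal ((p (fst z + snd z))\<^sup>2) * indicator (cball 0 e) (snd z)) \<in> borel_measurable (lborel \<Otimes>\<^sub>M lborel)"
      by measurable
    have "(\<lambda>x. \<integral>\<^sup>+h. ennreal ((p (x + h))\<^sup>2) * indicator (cball 0 e) h \<partial>lborel) \<in> borel_measurable lborel"
      by (rule lborel.borel_measurable_nn_integral) (simp add: case_prod_beta)
    then show "(\<lambda>x. ennreal (p x) * (\<integral>\<^sup>+h. ennreal ((p (x + h))\<^sup>2) * indicator (cball 0 e) h \<partial>lborel)) \<in> borel_measurable lborel"
      by measurable
  qed
  also have "\<dots> = ennreal V * (\<integral>\<^sup>+h. (\<integral>\<^sup>+x. ennreal (p x * (p (x + h))\<^sup>2) \<partial>lborel) * indicator (cball 0 e) h \<partial>lborel)"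
    by (subst nn_integral_p_times_ball[of "\<lambda>x. (p x)\<^sup>2"]) auto
  also have "\<dots> \<le> ennreal V * (\<integral>\<^sup>+h. ennreal (2 * c3) * indicator (cball 0 e) h \<partial>(lborel :: 'v measure))"
    using cross by (intro mult_left_mono nn_integral_mono mult_right_mono) auto
  also have "\<dots> = ennreal V * (ennreal (2 * c3) * ennreal V)"
    by (subst nn_integral_cmult_indicator) (auto simp: emeasure_lborel_cball[OF e] V_def)
  also have "\<dots> = ennreal (V\<^sup>2 * (2 * c3))"
    using V c3 by (simp add: ennreal_mult power2_eq_square mult_ac)
  finally show ?thesis
    using V c3 unfolding V_def c3_def by (subst (asm) ennreal_le_iff) auto
qed

end

section \<open>Counting linked pairs\<close>

lemma card_ordered_pairs: "card {(i, j). 1 \<le> i \<and> i < j \<and> j \<le> (n :: nat)} = n choose 2"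
proof (induction n)
  case 0
  have "{(i, j). 1 \<le> i \<and> i < j \<and> j \<le> (0 :: nat)} = {}" by auto
  then show ?case by (simp only: card.empty) simp
next
  case (Suc n)
  have eq: "{(i, j). 1 \<le> i \<and> i < j \<and> j \<le> Suc n} = {(i, j). 1 \<le> i \<and> i < j \<and> j \<le> n} \<union> {1..n} \<times> {Suc n}"
    by auto
  have "finite {(i, j). 1 \<le> i \<and> i < j \<and> j \<le> n}"
    by (rule finite_subset[of _ "{1..n} \<times> {1..n}"]) auto
  then have "card {(i, j). 1 \<le> i \<and> i < j \<and> j \<le> Suc n} = (n choose 2) + n"
    unfolding eq by (subst card_Un_disjoint) (auto simp: Suc[simplified] card_cartesian_product)
  then show ?case by (simp add: numeral_2_eq_2)
qed

context stationary_m_dependent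
begin

text \<open>The distance \<open>3 m\<close> rather than \<open>m\<close> prevents chains: if \<open>k\<close> is near \<open>i\<close>, then \<open>k\<close> is still separated from \<open>j\<close>.\<close>

definition far_pairs :: "nat \<Rightarrow> (nat \<times> nat) set" where
  "far_pairs n = {(i, j). 1 \<le> i \<and> i + 3 * m < j \<and> j \<le> n}"

definition near_pairs :: "nat \<Rightarrow> (nat \<times> nat) set" where
  "near_pairs n = {(i, j). 1 \<le> i \<and> i < j \<and> j \<le> i + 3 * m \<and> j \<le> n}"

definition linked :: "nat \<Rightarrow> nat \<times> nat \<Rightarrow> (nat \<times> nat) set" where
  "linked n a = {b \<in> far_pairs n. \<not> separated {fst a, snd a} {fst b, snd b}}"

definition window :: "nat \<Rightarrow> nat set" where "window i = {i - m..i + m}"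

abbreviation close_pair :: "real \<Rightarrow> nat \<times> nat \<Rightarrow> 's \<Rightarrow> real" where
  "close_pair e a \<equiv> close e (fst a) (snd a)"

lemma finite_far_pairs: "finite (far_pairs n)"
  by (rule finite_subset[of _ "{1..n} \<times> {1..n}"]) (auto simp: far_pairs_def)

lemma finite_near_pairs: "finite (near_pairs n)"
  by (rule finite_subset[of _ "{1..n} \<times> {1..n}"]) (auto simp: near_pairs_def)

lemma linked_subset: "linked n a \<subseteq> far_pairs n"
  by (auto simp: linked_def)

lemma linked_refl: "a \<in> far_pairs n \<Longrightarrow> a \<in> linked n a"
  by (auto simp: linked_def separated_def)

lemma finite_linked: "finite (linked n a)"
  using finite_subset[OF linked_subset finite_far_pairs] .

lemma finite_window: "finite (window i)" by (simp add: window_def)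

lemma card_window: "card (window i) \<le> 2 * m + 1" by (simp add: window_def)

lemma card_linked: "card (linked n a) \<le> (8 * m + 4) * n"
proof -
  let ?U = "window (fst a) \<union> window (snd a)"
  have U: "card ?U \<le> 4 * m + 2"
    using card_Un_le[of "window (fst a)" "window (snd a)"] card_window[of "fst a"] card_window[of "snd a"] by linarith
  have "linked n a \<subseteq> ?U \<times> {1..n} \<union> {1..n} \<times> ?U"
    by (auto simp: linked_def far_pairs_def separated_def window_def)
  then have "card (linked n a) \<le> card (?U \<times> {1..n} \<union> {1..n} \<times> ?U)"
    by (intro card_mono) (auto simp: finite_window)
  also have "\<dots> \<le> card ?U * n + n * card ?U"
    using card_Un_le[of "?U \<times> {1..n}" "{1..n} \<times> ?U"] by (simp add: card_cartesian_product)
  also have "\<dots> \<le> (8 * m + 4) * n"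
    using mult_le_mono1[OF U, of n] by (simp add: algebra_simps)
  finally show ?thesis .
qed

definition doubly_linked :: "nat \<times> nat \<Rightarrow> (nat \<times> nat) set" where
  "doubly_linked a = window (fst a) \<times> window (snd a) \<union> window (snd a) \<times> window (fst a)"

lemma card_doubly_linked: "card (doubly_linked a) \<le> 2 * (2 * m + 1)\<^sup>2"
proof -
  have "card (doubly_linked a) \<le> card (window (fst a)) * card (window (snd a)) + card (window (snd a)) * card (window (fst a))"
    unfolding doubly_linked_def
    using card_Un_le[of "window (fst a) \<times> window (snd a)" "window (snd a) \<times> window (fst a)"]
    by (simp add: card_cartesian_product)
  also have "\<dots> \<le> (2 * m + 1) * (2 * m + 1) + (2 * m + 1) * (2 * m + 1)"
    by (intro add_mono mult_le_mono card_window)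
  finally show ?thesis by (simp add: power2_eq_square)
qed

lemma finite_doubly_linked: "finite (doubly_linked a)"
  by (simp add: doubly_linked_def finite_window)

lemma double_link_bound_nonneg: "0 \<le> double_link_bound e"
  unfolding double_link_bound_def
  using near_quad_mean_nonneg near_pair_mean_nonneg mean_ball_mass_sq_nonneg by simp

text \<open>The links \<open>i\<close>--\<open>k\<close> and, possibly, \<open>j\<close>--\<open>l\<close> are the only ones, since the partners in each pair are more than
  \<open>3 m\<close> apart.\<close>

lemma expectation_two_close_linked:
  assumes pos: "1 \<le> i" "1 \<le> j" "1 \<le> k" "1 \<le> l"
    and far: "i + 3 * m < j \<or> j + 3 * m < i" "k + 3 * m < l \<or> l + 3 * m < k"
    and near: "i \<le> k + m" "k \<le> i + m" and ne: "(i, j) \<noteq> (k, l)"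
  shows "expectation (\<lambda>\<omega>. close e i j \<omega> * close e k l \<omega>)
     \<le> mean_ball_mass_sq e + of_bool (j \<le> l + m \<and> l \<le> j + m) * double_link_bound e"
proof (cases "j \<le> l + m \<and> l \<le> j + m")
  case True
  have "separated {i, k} {j, l}" using far near True by (auto simp: separated_def)
  then have "expectation (\<lambda>\<omega>. close e i j \<omega> * close e k l \<omega>) \<le> double_link_bound e"
    using pos near True ne by (intro expectation_two_close_double_link) auto
  then show ?thesis using True mean_ball_mass_sq_nonneg[of e] by simp
next
  case False
  have "separated {i, k} {j}" "separated {i, j, k} {l}" using far near False by (auto simp: separated_def)
  then have "expectation (\<lambda>\<omega>. close e i j \<omega> * close e k l \<omega>) \<le> mean_ball_mass_sq e"
    using pos by (intro expectation_two_close_single_link)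
  then show ?thesis using False by auto
qed

lemma expectation_two_close_linked_pairs:
  assumes a: "a \<in> far_pairs n" and b: "b \<in> linked n a" and ne: "b \<noteq> a"
  shows "expectation (\<lambda>\<omega>. close_pair e a \<omega> * close_pair e b \<omega>)
     \<le> mean_ball_mass_sq e + indicator (doubly_linked a) b * double_link_bound e"
proof -
  obtain i j where ij: "a = (i, j)" by (cases a)
  obtain k l where kl: "b = (k, l)" by (cases b)
  have pos: "1 \<le> i" "1 \<le> j" "1 \<le> k" "1 \<le> l" and far: "i + 3 * m < j" "k + 3 * m < l"
    using a b unfolding ij kl by (auto simp: far_pairs_def linked_def)
  have bound: "expectation (\<lambda>\<omega>. close e i' j' \<omega> * close e k' l' \<omega>)
      \<le> mean_ball_mass_sq e + indicator (doubly_linked a) b * double_link_bound e"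
    if "1 \<le> i'" "1 \<le> j'" "1 \<le> k'" "1 \<le> l'"
      "i' + 3 * m < j' \<or> j' + 3 * m < i'" "k' + 3 * m < l' \<or> l' + 3 * m < k'"
      "i' \<le> k' + m" "k' \<le> i' + m" "(i', j') \<noteq> (k', l')"
      and dl: "j' \<le> l' + m \<and> l' \<le> j' + m \<Longrightarrow> b \<in> doubly_linked a" for i' j' k' l'
  proof -
    have "of_bool (j' \<le> l' + m \<and> l' \<le> j' + m) * double_link_bound e
        \<le> indicator (doubly_linked a) b * double_link_bound e"
      using dl double_link_bound_nonneg[of e] by (intro mult_right_mono) (auto simp: indicator_def)
    then show ?thesis using expectation_two_close_linked[OF that(1-9), of e] by linarith
  qed
  consider "i \<le> k + m" "k \<le> i + m" | "i \<le> l + m" "l \<le> i + m" | "j \<le> k + m" "k \<le> j + m" | "j \<le> l + m" "l \<le> j + m"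
    using b unfolding ij kl by (auto simp: linked_def separated_def not_less)
  then have "expectation (\<lambda>\<omega>. close e i j \<omega> * close e k l \<omega>)
      \<le> mean_ball_mass_sq e + indicator (doubly_linked a) b * double_link_bound e"
  proof cases
    case 1
    show ?thesis
      by (rule bound) (use pos far 1 ne in \<open>auto simp: ij kl doubly_linked_def window_def\<close>)
  next
    case 2
    show ?thesis unfolding close_sym[of e k l]
      by (rule bound) (use pos far 2 ne in \<open>auto simp: ij kl doubly_linked_def window_def\<close>)
  next
    case 3
    show ?thesis unfolding close_sym[of e i j]
      by (rule bound) (use pos far 3 ne in \<open>auto simp: ij kl doubly_linked_def window_def\<close>)
  next
    case 4
    show ?thesis unfolding close_sym[of e i j] close_sym[of e k l]
      by (rule bound) (use pos far 4 ne in \<open>auto simp: ij kl doubly_linked_def window_def\<close>)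
  qed
  then show ?thesis by (simp only: ij kl fst_conv snd_conv)
qed

lemma expectation_close_far: "a \<in> far_pairs n \<Longrightarrow> expectation (close_pair e a) = mean_ball_mass e"
  by (rule expectation_close) (auto simp: far_pairs_def separated_def)

lemma close_far_measurable: "a \<in> far_pairs n \<Longrightarrow> random_variable borel (close_pair e a)"
  by (rule close_measurable) (auto simp: far_pairs_def)

lemma indep_var_close_unlinked:
  assumes a: "a \<in> far_pairs n"
  shows "indep_var borel (close_pair e a) borel (\<lambda>\<omega>. \<Sum>b\<in>far_pairs n - linked n a. close_pair e b \<omega>)"
proof -
  define R where "R = far_pairs n - linked n a"
  define T where "T = fst ` R \<union> snd ` R"
  have fin: "finite R" "finite T" using finite_far_pairs by (auto simp: R_def T_def)
  define f where "f c g = (of_bool (norm (g (fst c) - g (snd c)) \<le> e) :: real)"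
    for c :: "nat \<times> nat" and g :: "nat \<Rightarrow> 'v"
  have f: "f c \<in> borel_measurable (PiM J (\<lambda>_. borel))" if "fst c \<in> J" "snd c \<in> J" for c J
  proof -
    have [measurable]: "(\<lambda>g. g (fst c)) \<in> PiM J (\<lambda>_. borel :: 'v measure) \<rightarrow>\<^sub>M borel"
      "(\<lambda>g. g (snd c)) \<in> PiM J (\<lambda>_. borel :: 'v measure) \<rightarrow>\<^sub>M borel"
      using that by (auto intro: measurable_component_singleton)
    show ?thesis unfolding f_def by measurable
  qed
  have sep: "separated {fst a, snd a} T"
    by (auto simp: T_def R_def linked_def separated_def)
  have pos: "1 \<le> i" if "i \<in> {fst a, snd a} \<union> T" for i
    using that a by (auto simp: T_def R_def far_pairs_def)
  have fsum: "(\<lambda>g. \<Sum>b\<in>R. f b g) \<in> borel_measurable (PiM T (\<lambda>_. borel))"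
    by (intro borel_measurable_sum f) (auto simp: T_def)
  have "indep_var borel (\<lambda>\<omega>. f a (\<lambda>i\<in>{fst a, snd a}. X i \<omega>)) borel (\<lambda>\<omega>. (\<lambda>g. \<Sum>b\<in>R. f b g) (\<lambda>i\<in>T. X i \<omega>))"
    by (rule indep_var_of_separated[OF _ fin(2) sep pos _ fsum]) (auto intro: f)
  moreover have "f a (\<lambda>i\<in>{fst a, snd a}. X i \<omega>) = close_pair e a \<omega>" for \<omega>
    by (simp add: f_def close_def)
  moreover have "(\<Sum>b\<in>R. f b (\<lambda>i\<in>T. X i \<omega>)) = (\<Sum>b\<in>R. close_pair e b \<omega>)" for \<omega>
    by (intro sum.cong refl) (auto simp: f_def close_def T_def)
  ultimately show ?thesis by (simp add: R_def)
qed

lemma expectation_far_count: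
  "expectation (\<lambda>\<omega>. \<Sum>a\<in>far_pairs n. close_pair e a \<omega>) = real (card (far_pairs n)) * mean_ball_mass e"
proof -
  have "integrable M (close_pair e a)" if "a \<in> far_pairs n" for a
    using close_bounds close_far_measurable[OF that] by (intro integrable_const_bound[of _ 1]) auto
  then have "expectation (\<lambda>\<omega>. \<Sum>a\<in>far_pairs n. close_pair e a \<omega>) = (\<Sum>a\<in>far_pairs n. expectation (close_pair e a))"
    by (rule Bochner_Integration.integral_sum)
  then show ?thesis by (simp add: expectation_close_far)
qed

text \<open>Each far pair is linked to \<open>O(n)\<close> others, of which only boundedly many are doubly linked.\<close>

lemma local_dependence_error_bound:
  "(\<Sum>a\<in>far_pairs n. \<Sum>b\<in>linked n a. expectation (close_pair e a) * expectation (close_pair e b))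
    + (\<Sum>a\<in>far_pairs n. \<Sum>b\<in>linked n a - {a}. expectation (\<lambda>\<omega>. close_pair e a \<omega> * close_pair e b \<omega>))
   \<le> real (card (far_pairs n)) *
      (real ((8 * m + 4) * n) * ((mean_ball_mass e)\<^sup>2 + mean_ball_mass_sq e)
       + real (2 * (2 * m + 1)\<^sup>2) * double_link_bound e)"
proof -
  have cl: "real (card (linked n a)) \<le> real ((8 * m + 4) * n)" for a
    using card_linked[of n a] by (simp only: of_nat_le_iff)
  have cd: "real (card (doubly_linked a)) \<le> real (2 * (2 * m + 1)\<^sup>2)" for a
    using card_doubly_linked[of a] by (simp only: of_nat_le_iff)
  have 1: "(\<Sum>b\<in>linked n a. expectation (close_pair e a) * expectation (close_pair e b))
      \<le> real ((8 * m + 4) * n) * (mean_ball_mass e)\<^sup>2" if a: "a \<in> far_pairs n" for a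
  proof -
    have "(\<Sum>b\<in>linked n a. expectation (close_pair e a) * expectation (close_pair e b))
        = (\<Sum>b\<in>linked n a. (mean_ball_mass e)\<^sup>2)"
    proof (intro sum.cong refl)
      fix b assume "b \<in> linked n a"
      then have "b \<in> far_pairs n" using linked_subset by blast
      then show "expectation (close_pair e a) * expectation (close_pair e b) = (mean_ball_mass e)\<^sup>2"
        using a by (simp only: expectation_close_far power2_eq_square)
    qed
    also have "\<dots> = real (card (linked n a)) * (mean_ball_mass e)\<^sup>2" by simp
    also have "\<dots> \<le> real ((8 * m + 4) * n) * (mean_ball_mass e)\<^sup>2"
      using cl by (intro mult_right_mono) auto
    finally show ?thesis .
  qed
  have 2: "(\<Sum>b\<in>linked n a - {a}. expectation (\<lambda>\<omega>. close_pair e a \<omega> * close_pair e b \<omega>))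
      \<le> real ((8 * m + 4) * n) * mean_ball_mass_sq e + real (2 * (2 * m + 1)\<^sup>2) * double_link_bound e"
    if a: "a \<in> far_pairs n" for a
  proof -
    have "(\<Sum>b\<in>linked n a - {a}. expectation (\<lambda>\<omega>. close_pair e a \<omega> * close_pair e b \<omega>))
        \<le> (\<Sum>b\<in>linked n a - {a}. mean_ball_mass_sq e + indicator (doubly_linked a) b * double_link_bound e)"
      using a by (intro sum_mono expectation_two_close_linked_pairs[of a n]) auto
    also have "\<dots> \<le> (\<Sum>b\<in>linked n a. mean_ball_mass_sq e + indicator (doubly_linked a) b * double_link_bound e)"
      using finite_linked mean_ball_mass_sq_nonneg double_link_bound_nonneg by (intro sum_mono2) auto
    also have "\<dots> = real (card (linked n a)) * mean_ball_mass_sq e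
        + real (card (linked n a \<inter> doubly_linked a)) * double_link_bound e"
    proof -
      have "(\<Sum>b\<in>linked n a. indicator (doubly_linked a) b) = real (card (linked n a \<inter> doubly_linked a))"
        using sum.inter_restrict[OF finite_linked, of "\<lambda>_. 1 :: real" n a "doubly_linked a"]
        by (simp add: indicator_def of_bool_def)
      then show ?thesis by (simp add: sum.distrib flip: sum_distrib_right)
    qed
    also have "\<dots> \<le> real ((8 * m + 4) * n) * mean_ball_mass_sq e + real (2 * (2 * m + 1)\<^sup>2) * double_link_bound e"
    proof (intro add_mono mult_right_mono cl mean_ball_mass_sq_nonneg double_link_bound_nonneg)
      have "card (linked n a \<inter> doubly_linked a) \<le> card (doubly_linked a)"
        using finite_doubly_linked by (intro card_mono) auto
      then show "real (card (linked n a \<inter> doubly_linked a)) \<le> real (2 * (2 * m + 1)\<^sup>2)"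
        using cd[of a] by linarith
    qed
    finally show ?thesis .
  qed
  have "(\<Sum>a\<in>far_pairs n. \<Sum>b\<in>linked n a. expectation (close_pair e a) * expectation (close_pair e b))
      + (\<Sum>a\<in>far_pairs n. \<Sum>b\<in>linked n a - {a}. expectation (\<lambda>\<omega>. close_pair e a \<omega> * close_pair e b \<omega>))
    \<le> (\<Sum>a\<in>far_pairs n. real ((8 * m + 4) * n) * (mean_ball_mass e)\<^sup>2)
      + (\<Sum>a\<in>far_pairs n. real ((8 * m + 4) * n) * mean_ball_mass_sq e + real (2 * (2 * m + 1)\<^sup>2) * double_link_bound e)"
    by (intro add_mono sum_mono 1 2)
  also have "\<dots> = real (card (far_pairs n)) *
      (real ((8 * m + 4) * n) * ((mean_ball_mass e)\<^sup>2 + mean_ball_mass_sq e)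
       + real (2 * (2 * m + 1)\<^sup>2) * double_link_bound e)"
    by (simp add: distrib_left)
  finally show ?thesis .
qed

lemma far_near_pairs: "{(i, j). 1 \<le> i \<and> i < j \<and> j \<le> n} = far_pairs n \<union> near_pairs n"
  "far_pairs n \<inter> near_pairs n = {}"
  by (auto simp: far_pairs_def near_pairs_def)

lemma card_far_near: "card (far_pairs n) + card (near_pairs n) = n choose 2"
  using card_Un_disjoint[OF finite_far_pairs finite_near_pairs far_near_pairs(2), of n]
  unfolding far_near_pairs(1)[symmetric] card_ordered_pairs by simp

lemma near_pairs_subset: "near_pairs n \<subseteq> (\<lambda>(i, s). (i, i + s)) ` ({1..n} \<times> {1..3 * m})"
proof
  fix a assume "a \<in> near_pairs n"
  then obtain i j where "a = (i, j)" "1 \<le> i" "i < j" "j \<le> i + 3 * m" "j \<le> n"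
    by (auto simp: near_pairs_def)
  then show "a \<in> (\<lambda>(i, s). (i, i + s)) ` ({1..n} \<times> {1..3 * m})"
    by (intro image_eqI[of _ _ "(i, j - i)"]) auto
qed

lemma card_near_pairs: "card (near_pairs n) \<le> 3 * m * n"
  using surj_card_le[OF _ near_pairs_subset, of n] by (simp add: card_cartesian_product mult.commute)

lemma expectation_near_count:
  "expectation (\<lambda>\<omega>. \<Sum>a\<in>near_pairs n. close_pair e a \<omega>) \<le> real (3 * m * n) * near_pair_mean e"
proof -
  have "integrable M (close_pair e a)" if "a \<in> near_pairs n" for a
    using that close_bounds by (intro integrable_const_bound[of _ 1] close_measurable) (auto simp: near_pairs_def)
  then have "expectation (\<lambda>\<omega>. \<Sum>a\<in>near_pairs n. close_pair e a \<omega>) = (\<Sum>a\<in>near_pairs n. expectation (close_pair e a))"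
    by (rule Bochner_Integration.integral_sum)
  also have "\<dots> \<le> (\<Sum>a\<in>near_pairs n. near_pair_mean e)"
    by (intro sum_mono expectation_close_near) (auto simp: near_pairs_def)
  also have "\<dots> \<le> real (3 * m * n) * near_pair_mean e"
    using card_near_pairs[of n] near_pair_mean_nonneg[of e]
    by (simp only: sum_constant) (intro mult_right_mono, simp_all only: of_nat_le_iff)
  finally show ?thesis .
qed

lemma N_stat_eq:
  "N_stat X e n \<omega> = (\<Sum>a\<in>far_pairs n. close_pair (e n) a \<omega>) + (\<Sum>a\<in>near_pairs n. close_pair (e n) a \<omega>)"
proof -
  have "N_stat X e n \<omega> = (\<Sum>a\<in>far_pairs n \<union> near_pairs n. close_pair (e n) a \<omega>)"
    unfolding N_stat_def far_near_pairs(1) by (simp add: close_def case_prod_beta)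
  then show ?thesis
    using sum.union_disjoint[OF finite_far_pairs finite_near_pairs far_near_pairs(2)] by simp
qed

end

section \<open>Asymptotics of the estimators\<close>

lemma (in prob_space) tendsto_prob_max_one_over:
  assumes Q: "tendsto_prob Q q" and q: "0 < q"
  shows "tendsto_prob (\<lambda>n \<omega>. max (Q n \<omega>) (1 / real n)) q"
proof -
  note [measurable] = tendsto_probD_measurable[OF Q]
  have lim: "(\<lambda>n. 1 / real n) \<longlonglongrightarrow> 0" by (rule lim_1_over_n)
  have 1: "isCont (\<lambda>x :: real \<times> real. max (fst x) (snd x)) (q, 0)"
    by (intro continuous_max continuous_fst continuous_snd continuous_ident)
  have 2: "random_variable borel (\<lambda>\<omega>. max (fst (Q n \<omega>, 1 / real n)) (snd (Q n \<omega>, 1 / real n)))" for n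
    unfolding fst_conv snd_conv by measurable
  from tendsto_prob_isCont2[where g = "\<lambda>x. max (fst x) (snd x)", OF Q tendsto_prob_const[OF lim] 1 2]
  show ?thesis using q by simp
qed

text \<open>For an estimate \<open>x = fst z\<close> of \<open>q\<close> with plug-in entropy \<open>H\<close>, this is the quotient of \<open>x * (H + ln q)\<close> by the
  error \<open>x - q\<close>. The second component is the truncation level, and the value at \<open>q\<close> is the continuous extension.\<close>

definition log_slope :: "real \<Rightarrow> real \<times> real \<Rightarrow> real" where
  "log_slope q z = (if fst z = q then - 1 else fst z * (ln q - ln (max (fst z) (snd z))) / (fst z - q))"

text \<open>Near \<open>(q, 0)\<close> the truncation is inactive, and the function is \<open>-x\<close> times a difference quotient of the
  logarithm, which tends to \<open>1 / q\<close>.\<close>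

lemma isCont_log_slope:
  assumes q: "0 < q"
  shows "isCont (log_slope q) (q, 0)"
proof -
  have "DERIV ln q :> inverse q" using q by (rule DERIV_ln)
  then obtain g where g: "\<And>z. ln z - ln q = g z * (z - q)" "isCont g q" "g q = inverse q"
    unfolding CARAT_DERIV by blast
  have "\<forall>\<^sub>F z in nhds (q, 0 :: real). log_slope q z = - (fst z * g (fst z))"
    unfolding eventually_nhds
  proof (intro exI conjI ballI)
    show "open {z :: real \<times> real. snd z < fst z}"
      by (intro open_Collect_less continuous_intros)
    show "(q, 0) \<in> {z :: real \<times> real. snd z < fst z}" using q by simp
    fix z :: "real \<times> real" assume z: "z \<in> {z. snd z < fst z}"
    show "log_slope q z = - (fst z * g (fst z))"
    proof (cases "fst z = q")
      case True
      then show ?thesis using g(3) q by (simp add: log_slope_def)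
    next
      case False
      have "ln q - ln (max (fst z) (snd z)) = - (g (fst z) * (fst z - q))"
        using z g(1)[of "fst z"] by (simp add: max_def)
      then show ?thesis using False by (simp add: log_slope_def)
    qed
  qed
  moreover have "isCont (\<lambda>z :: real \<times> real. - (fst z * g (fst z))) (q, 0)"
  proof -
    have "isCont (\<lambda>z :: real \<times> real. g (fst z)) (q, 0)"
      using isCont_o2[of "(q, 0 :: real)" fst g] g(2) by (simp add: continuous_fst)
    then show ?thesis by (intro isCont_minus isCont_mult continuous_fst continuous_ident)
  qed
  ultimately show ?thesis by (simp add: isCont_cong)
qed

lemma real_choose_two: "real (n choose 2) = real n * (real n - 1) / 2"
proof -
  have "even (n * (n - 1))" by (cases "even n") auto
  then have "2 * (n choose 2) = n * (n - 1)" unfolding choose_two by (rule dvd_mult_div_cancel)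
  then have "2 * real (n choose 2) = real (n * (n - 1))" by (metis of_nat_mult of_nat_numeral)
  then show ?thesis by (cases n) (simp_all add: algebra_simps)
qed

lemma tendsto_choose_two_ratio: "(\<lambda>n. (real n)\<^sup>2 / real (n choose 2)) \<longlonglongrightarrow> 2"
  unfolding real_choose_two by real_asymp

context stationary_m_dependent
begin

context
  fixes e :: "nat \<Rightarrow> real" and \<alpha> K :: real
  assumes e_pos: "\<And>n. 0 < e n" and e_lim: "e \<longlonglongrightarrow> 0"
    and sparse: "(\<lambda>n. real n * e n ^ DIM('v)) \<longlonglongrightarrow> 0"
    and many: "filterlim (\<lambda>n. (real n)\<^sup>2 * e n ^ DIM('v)) at_top sequentially"
    and \<alpha>: "0 < \<alpha>" and K: "0 < K" and smooth: "p \<in> H2_class \<alpha> K"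
begin

definition vol :: "nat \<Rightarrow> real" where "vol n = ball_vol (e n) DIM('v)"

definition far_count :: "nat \<Rightarrow> 's \<Rightarrow> real" where
  "far_count n \<omega> = (\<Sum>a\<in>far_pairs n. close_pair (e n) a \<omega>)"

definition near_count :: "nat \<Rightarrow> 's \<Rightarrow> real" where
  "near_count n \<omega> = (\<Sum>a\<in>near_pairs n. close_pair (e n) a \<omega>)"

definition far_mean :: "nat \<Rightarrow> real" where
  "far_mean n = real (card (far_pairs n)) * mean_ball_mass (e n)"

lemma vol_pos: "0 < vol n"
  using e_pos[of n] b1_pos[of "DIM('v)"] by (simp add: vol_def ball_vol_def)

lemma vol_eq: "vol n = e n ^ DIM('v) * b1 DIM('v)" by (simp add: vol_def ball_vol_def)

lemma e_power_lim: "(\<lambda>n. e n ^ DIM('v)) \<longlonglongrightarrow> 0"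
  using tendsto_power[OF e_lim, of "DIM('v)"] by (simp add: zero_power)

lemma mean_ball_mass_ratio_bounds:
  "mean_ball_mass (e n) / vol n \<le> q2 p"
  "e n \<le> 1 \<Longrightarrow> q2 p - (K * e n powr \<alpha>)\<^sup>2 / 2 \<le> mean_ball_mass (e n) / vol n"
proof -
  show "mean_ball_mass (e n) / vol n \<le> q2 p"
    using mean_ball_mass_upper[of "e n"] e_pos[of n] vol_pos[of n]
    by (simp add: divide_le_eq mult.commute vol_def)
  assume "e n \<le> 1"
  then show "q2 p - (K * e n powr \<alpha>)\<^sup>2 / 2 \<le> mean_ball_mass (e n) / vol n"
    using mean_ball_mass_lower[OF _ _ \<alpha> K smooth, of "e n"] e_pos[of n] vol_pos[of n]
    by (simp add: le_divide_eq mult.commute vol_def)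
qed

lemma e_powr_lim: "(\<lambda>n. e n powr \<alpha>) \<longlonglongrightarrow> 0"
  using \<alpha> e_pos by (intro tendsto_zero_powrI[OF e_lim tendsto_const]) (auto intro: always_eventually less_imp_le)

lemma e_le_1: "\<forall>\<^sub>F n in sequentially. e n \<le> 1"
  using order_tendstoD(2)[OF e_lim, of 1] by (auto elim: eventually_mono)

lemma mean_ball_mass_ratio_lim: "(\<lambda>n. mean_ball_mass (e n) / vol n) \<longlonglongrightarrow> q2 p"
proof (rule tendsto_sandwich)
  show "\<forall>\<^sub>F n in sequentially. mean_ball_mass (e n) / vol n \<le> q2 p"
    by (simp add: mean_ball_mass_ratio_bounds)
  show "\<forall>\<^sub>F n in sequentially. q2 p - (K * e n powr \<alpha>)\<^sup>2 / 2 \<le> mean_ball_mass (e n) / vol n"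
    using e_le_1 by eventually_elim (rule mean_ball_mass_ratio_bounds)
  have "(\<lambda>n. q2 p - (K * e n powr \<alpha>)\<^sup>2 / 2) \<longlonglongrightarrow> q2 p - (K * 0)\<^sup>2 / 2"
    by (intro tendsto_intros e_powr_lim) simp
  then show "(\<lambda>n. q2 p - (K * e n powr \<alpha>)\<^sup>2 / 2) \<longlonglongrightarrow> q2 p" by simp
qed simp

lemma mean_ball_mass_pos: "\<forall>\<^sub>F n in sequentially. 0 < mean_ball_mass (e n)"
proof -
  have "\<forall>\<^sub>F n in sequentially. 0 < mean_ball_mass (e n) / vol n"
    using order_tendstoD(1)[OF mean_ball_mass_ratio_lim q2_pos] .
  then show ?thesis
  proof eventually_elim
    case (elim n)
    then show ?case using vol_pos[of n] by (simp add: zero_less_divide_iff)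
  qed
qed

lemma card_far_ratio_lim: "(\<lambda>n. real (card (far_pairs n)) / real (n choose 2)) \<longlonglongrightarrow> 1"
  and card_far_ratio_bound: "2 \<le> n \<Longrightarrow> 1 - real (card (far_pairs n)) / real (n choose 2) \<le> real (3 * m * n) / real (n choose 2)"
  and card_far_ratio_le: "real (card (far_pairs n)) / real (n choose 2) \<le> 1"
proof -
  have eq: "real (card (far_pairs n)) + real (card (near_pairs n)) = real (n choose 2)" for n
    using card_far_near[of n] by (metis of_nat_add)
  have near: "real (card (near_pairs n)) \<le> real (3 * m * n)" for n
    using card_near_pairs[of n] by (simp only: of_nat_le_iff)
  show le: "real (card (far_pairs n)) / real (n choose 2) \<le> 1" for n
    using eq[of n] by (auto simp: divide_le_eq_1)
  show bound: "1 - real (card (far_pairs n)) / real (n choose 2) \<le> real (3 * m * n) / real (n choose 2)" if "2 \<le> n" for n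
  proof -
    have "1 - real (card (far_pairs n)) / real (n choose 2) = (real (n choose 2) - real (card (far_pairs n))) / real (n choose 2)"
      using that by (simp add: diff_divide_distrib)
    also have "real (n choose 2) - real (card (far_pairs n)) = real (card (near_pairs n))"
      using eq[of n] by linarith
    also have "real (card (near_pairs n)) / real (n choose 2) \<le> real (3 * m * n) / real (n choose 2)" using near by (intro divide_right_mono) auto
    finally show ?thesis .
  qed
  show "(\<lambda>n. real (card (far_pairs n)) / real (n choose 2)) \<longlonglongrightarrow> 1"
  proof (rule tendsto_sandwich)
    show "\<forall>\<^sub>F n in sequentially. 1 - real (3 * m * n) / real (n choose 2) \<le> real (card (far_pairs n)) / real (n choose 2)"
      using eventually_ge_at_top[of 2]
    proof eventually_elim
      case (elim n)
      then show ?case using bound[of n] by linarith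
    qed
    have "(\<lambda>n. 1 - 3 * real m * (real n / real (n choose 2))) \<longlonglongrightarrow> 1 - 3 * real m * 0"
      by (intro tendsto_intros) (unfold real_choose_two, real_asymp)
    then show "(\<lambda>n. 1 - real (3 * m * n) / real (n choose 2)) \<longlonglongrightarrow> 1" by simp
    show "\<forall>\<^sub>F n in sequentially. real (card (far_pairs n)) / real (n choose 2) \<le> 1"
      using le by simp
  qed simp
qed

lemma far_mean_at_top: "filterlim far_mean at_top sequentially"
proof -
  have lim: "(\<lambda>n. (real (card (far_pairs n)) / real (n choose 2)) * (mean_ball_mass (e n) / vol n) * b1 DIM('v)
       * inverse ((real n)\<^sup>2 / real (n choose 2))) \<longlonglongrightarrow> 1 * q2 p * b1 DIM('v) * inverse 2"
    by (intro tendsto_mult tendsto_const card_far_ratio_lim mean_ball_mass_ratio_lim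
         tendsto_inverse tendsto_choose_two_ratio) simp
  have pos: "0 < 1 * q2 p * b1 DIM('v) * inverse 2" using q2_pos b1_pos[of "DIM('v)"] by simp
  have "filterlim (\<lambda>n. (real (card (far_pairs n)) / real (n choose 2)) * (mean_ball_mass (e n) / vol n) * b1 DIM('v)
       * inverse ((real n)\<^sup>2 / real (n choose 2)) * ((real n)\<^sup>2 * e n ^ DIM('v))) at_top sequentially"
    by (rule filterlim_tendsto_pos_mult_at_top[OF lim pos many])
  moreover have "\<forall>\<^sub>F n in sequentially. (real (card (far_pairs n)) / real (n choose 2)) * (mean_ball_mass (e n) / vol n) * b1 DIM('v)
       * inverse ((real n)\<^sup>2 / real (n choose 2)) * ((real n)\<^sup>2 * e n ^ DIM('v)) = far_mean n"
    using eventually_ge_at_top[of 2]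
  proof eventually_elim
    case (elim n)
    have "0 < real (n choose 2)" "0 < real n" using elim by auto
    moreover have "0 < b1 DIM('v)" "0 < e n ^ DIM('v)" using b1_pos[of "DIM('v)"] e_pos by auto
    ultimately show ?case using e_pos[of n] unfolding far_mean_def vol_eq by (simp add: field_simps power2_eq_square)
  qed
  ultimately show ?thesis by (simp cong: filterlim_cong)
qed

lemma mean_ball_mass_sq_ratio: "mean_ball_mass_sq (e n) / (vol n)\<^sup>2 \<le> 2 * (\<integral>x. (p x) ^ 3 \<partial>lborel)"
  using mean_ball_mass_sq_upper[of "e n"] e_pos[of n] vol_pos[of n]
  by (simp add: divide_le_eq vol_def mult.commute)

lemma near_pair_mean_double_lim: "(\<lambda>n. near_pair_mean (2 * e n)) \<longlonglongrightarrow> 0"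
proof -
  have 1: "(\<lambda>n. near_pair_mean (2 * e n) / sqrt ((2 * e n) ^ DIM('v))) \<longlonglongrightarrow> 0"
    using tendsto_mult_right[OF e_lim, of 2] e_pos by (intro tendsto_near_pair_mean) auto
  have "(\<lambda>n. sqrt ((2 * e n) ^ DIM('v))) \<longlonglongrightarrow> sqrt ((2 * 0) ^ DIM('v))"
    by (intro tendsto_intros e_lim)
  from tendsto_mult[OF 1 this] show ?thesis using e_pos by (simp add: less_imp_neq[THEN not_sym])
qed

lemma double_link_ratio_lim: "(\<lambda>n. double_link_bound (e n) / vol n) \<longlonglongrightarrow> 0"
proof (rule Lim_null_comparison)
  define c where "c = 2 * (\<integral>x. (p x) ^ 3 \<partial>lborel)"
  show "\<forall>\<^sub>F n in sequentially. norm (double_link_bound (e n) / vol n)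
      \<le> near_quad_mean (e n) / e n ^ DIM('v) / b1 DIM('v) + sqrt (near_pair_mean (2 * e n) * c)"
  proof (rule always_eventually, rule allI)
    fix n
    have "sqrt (near_pair_mean (2 * e n) * mean_ball_mass_sq (e n)) / vol n
        = sqrt (near_pair_mean (2 * e n) * (mean_ball_mass_sq (e n) / (vol n)\<^sup>2))"
      using vol_pos[of n] by (simp add: real_sqrt_divide real_sqrt_mult)
    also have "\<dots> \<le> sqrt (near_pair_mean (2 * e n) * c)"
      using mean_ball_mass_sq_ratio[of n] near_pair_mean_nonneg[of "2 * e n"]
      by (intro real_sqrt_le_mono mult_left_mono) (auto simp: c_def)
    finally have "sqrt (near_pair_mean (2 * e n) * mean_ball_mass_sq (e n)) / vol n \<le> sqrt (near_pair_mean (2 * e n) * c)" .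
    then show "norm (double_link_bound (e n) / vol n)
      \<le> near_quad_mean (e n) / e n ^ DIM('v) / b1 DIM('v) + sqrt (near_pair_mean (2 * e n) * c)"
      using double_link_bound_nonneg[of "e n"] vol_pos[of n]
      unfolding real_norm_def abs_of_nonneg[OF divide_nonneg_pos[OF double_link_bound_nonneg vol_pos]]
      by (simp add: double_link_bound_def add_divide_distrib vol_eq)
  qed
  have "(\<lambda>n. near_quad_mean (e n) / e n ^ DIM('v) / b1 DIM('v) + sqrt (near_pair_mean (2 * e n) * c))
      \<longlonglongrightarrow> 0 / b1 DIM('v) + sqrt (0 * c)"
    using b1_pos[of "DIM('v)"]
    by (intro tendsto_add tendsto_divide tendsto_const tendsto_real_sqrt tendsto_mult near_pair_mean_double_lim
        tendsto_near_quad_mean e_pos e_lim) auto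
  then show "(\<lambda>n. near_quad_mean (e n) / e n ^ DIM('v) / b1 DIM('v) + sqrt (near_pair_mean (2 * e n) * c)) \<longlonglongrightarrow> 0"
    by simp
qed

text \<open>After division by the mean, the error of the Poisson approximation is of order
  \<open>n e^d + double_link_bound / e^d\<close>.\<close>

lemma far_count_clt: "conv_to_std_normal M (\<lambda>n \<omega>. (far_count n \<omega> - far_mean n) / sqrt (far_mean n))"
proof -
  define C D where "C = real (8 * m + 4)" and "D = real (2 * (2 * m + 1)\<^sup>2)"
  define err where "err n = (C * real n * ((mean_ball_mass (e n))\<^sup>2 + mean_ball_mass_sq (e n))
       + D * double_link_bound (e n)) / mean_ball_mass (e n)" for n
  define c where "c = 2 * (\<integral>x. (p x) ^ 3 \<partial>lborel)"
  have err_lim: "err \<longlonglongrightarrow> 0"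
  proof (rule Lim_null_comparison)
    show "\<forall>\<^sub>F n in sequentially. norm (err n)
        \<le> (C * (real n * e n ^ DIM('v)) * b1 DIM('v) * ((mean_ball_mass (e n) / vol n)\<^sup>2 + c)
            + D * (double_link_bound (e n) / vol n)) / (mean_ball_mass (e n) / vol n)"
      using mean_ball_mass_pos
    proof eventually_elim
      case (elim n)
      have V: "0 < vol n" by (rule vol_pos)
      have C0: "0 \<le> C" "0 \<le> D" by (simp_all add: C_def D_def)
      have nonneg: "0 \<le> err n"
        unfolding err_def using C0 mean_ball_mass_sq_nonneg double_link_bound_nonneg elim
        by (intro divide_nonneg_pos add_nonneg_nonneg mult_nonneg_nonneg) auto
      have "err n = (C * real n * vol n * ((mean_ball_mass (e n) / vol n)\<^sup>2 + mean_ball_mass_sq (e n) / (vol n)\<^sup>2)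
            + D * (double_link_bound (e n) / vol n)) / (mean_ball_mass (e n) / vol n)"
        unfolding err_def using V elim by (simp add: field_simps power2_eq_square)
      also have "\<dots> \<le> (C * real n * vol n * ((mean_ball_mass (e n) / vol n)\<^sup>2 + c)
            + D * (double_link_bound (e n) / vol n)) / (mean_ball_mass (e n) / vol n)"
        using V elim C0 mean_ball_mass_sq_ratio[of n] unfolding c_def
        by (intro divide_right_mono add_right_mono mult_left_mono add_left_mono) auto
      finally show ?case using nonneg by (simp add: vol_eq mult_ac)
    qed
    have "(\<lambda>n. (C * (real n * e n ^ DIM('v)) * b1 DIM('v) * ((mean_ball_mass (e n) / vol n)\<^sup>2 + c)
            + D * (double_link_bound (e n) / vol n)) / (mean_ball_mass (e n) / vol n))
        \<longlonglongrightarrow> (C * 0 * b1 DIM('v) * ((q2 p)\<^sup>2 + c) + D * 0) / q2 p"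
      using q2_pos
      by (intro tendsto_divide tendsto_add tendsto_mult tendsto_const tendsto_power sparse
          mean_ball_mass_ratio_lim double_link_ratio_lim) auto
    then show "(\<lambda>n. (C * (real n * e n ^ DIM('v)) * b1 DIM('v) * ((mean_ball_mass (e n) / vol n)\<^sup>2 + c)
            + D * (double_link_bound (e n) / vol n)) / (mean_ball_mass (e n) / vol n)) \<longlonglongrightarrow> 0" by simp
  qed
  have mean: "expectation (\<lambda>\<omega>. \<Sum>a\<in>far_pairs n. close_pair (e n) a \<omega>) = far_mean n" for n
    unfolding expectation_far_count far_mean_def ..
  have "conv_to_std_normal M (\<lambda>n \<omega>.
     ((\<Sum>a\<in>far_pairs n. close_pair (e n) a \<omega>) - expectation (\<lambda>\<omega>. \<Sum>a\<in>far_pairs n. close_pair (e n) a \<omega>))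
       / sqrt (expectation (\<lambda>\<omega>. \<Sum>a\<in>far_pairs n. close_pair (e n) a \<omega>)))"
  proof (rule conv_to_std_normal_local_dependence[where B = linked and err = err])
    show "filterlim (\<lambda>n. expectation (\<lambda>\<omega>. \<Sum>a\<in>far_pairs n. close_pair (e n) a \<omega>)) at_top sequentially"
      unfolding mean by (rule far_mean_at_top)
    show "\<forall>\<^sub>F n in sequentially.
        (\<Sum>a\<in>far_pairs n. \<Sum>b\<in>linked n a. expectation (close_pair (e n) a) * expectation (close_pair (e n) b))
        + (\<Sum>a\<in>far_pairs n. \<Sum>b\<in>linked n a - {a}. expectation (\<lambda>\<omega>. close_pair (e n) a \<omega> * close_pair (e n) b \<omega>))
        \<le> err n * expectation (\<lambda>\<omega>. \<Sum>a\<in>far_pairs n. close_pair (e n) a \<omega>)"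
      using mean_ball_mass_pos
    proof eventually_elim
      case (elim n)
      have "err n * far_mean n = real (card (far_pairs n)) *
          (real ((8 * m + 4) * n) * ((mean_ball_mass (e n))\<^sup>2 + mean_ball_mass_sq (e n))
           + real (2 * (2 * m + 1)\<^sup>2) * double_link_bound (e n))"
        using elim by (simp add: err_def far_mean_def C_def D_def)
      then show ?case unfolding mean using local_dependence_error_bound[of "e n" n] by linarith
    qed
    show "close_pair (e n) a \<omega> = 0 \<or> close_pair (e n) a \<omega> = 1" for n a \<omega> by (simp add: close_def)
  qed (rule finite_far_pairs linked_subset err_lim | erule close_far_measurable linked_refl indep_var_close_unlinked)+
  then show ?thesis unfolding mean far_count_def .
qed

lemma near_count_measurable: "random_variable borel (near_count n)"
  unfolding near_count_def by (intro borel_measurable_sum close_measurable) (auto simp: near_pairs_def)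

lemma far_count_measurable: "random_variable borel (far_count n)"
  unfolding far_count_def by (intro borel_measurable_sum close_far_measurable)

lemma Q_est_eq: "Q_est X e n \<omega> = (far_count n \<omega> + near_count n \<omega>) / (real (n choose 2) * vol n)"
  unfolding Q_est_def N_stat_eq far_count_def near_count_def vol_def by (simp add: field_simps)

lemma Q_est_measurable: "random_variable borel (Q_est X e n)"
proof -
  note [measurable] = near_count_measurable far_count_measurable
  show ?thesis unfolding Q_est_eq[abs_def] by measurable
qed

text \<open>The error of the quadratic functional splits as \<open>a (Q - q) = k Y + R\<close>: here \<open>Y\<close> is the standardised number of
  close far pairs, \<open>k\<close> is deterministic and converges, and the remainder \<open>R\<close>, made of the near pairs and
  the bias, vanishes in probability. Since \<open>a\<close> tends to infinity this also gives consistency of \<open>Q\<close>, hence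
  convergence of the random normalisation.\<close>

lemma conv_to_std_normal_estimators:
  assumes a_lim: "(\<lambda>n. a n / (real n * sqrt (e n ^ DIM('v)))) \<longlonglongrightarrow> 1"
    and bias: "(\<lambda>n. a n * (e n powr \<alpha>)\<^sup>2) \<longlonglongrightarrow> 0"
  shows "conv_to_std_normal M (\<lambda>n \<omega>. a n * (Q_est X e n \<omega> - q2 p) / u_est X e n \<omega>)"
    and "conv_to_std_normal M (\<lambda>n \<omega>. a n * (Q_est X e n \<omega> * (H_est X e n \<omega> - h2 p)) / u_est X e n \<omega>)"
proof -
  define c where "c n = real (n choose 2)" for n
  define q where "q = q2 p"
  define \<kappa> where "\<kappa> = sqrt (2 * q / b1 DIM('v))"
  have q: "0 < q" unfolding q_def by (rule q2_pos)
  have b: "0 < b1 DIM('v)" by (rule b1_pos) simp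
  have \<kappa>: "0 < \<kappa>" unfolding \<kappa>_def using q b by simp
  note [measurable] = near_count_measurable far_count_measurable Q_est_measurable
  define r where "r n = a n / (real n * sqrt (e n ^ DIM('v)))" for n
  have r_lim: "r \<longlonglongrightarrow> 1" unfolding r_def using a_lim .
  have ed: "0 < e n ^ DIM('v)" for n using e_pos by simp
  have a_eq: "a n = r n * (real n * sqrt (e n ^ DIM('v)))" if "1 \<le> n" for n
    using that ed[of n] e_pos[of n] by (simp add: r_def)
  have c_pos: "0 < c n" if "2 \<le> n" for n using that by (simp add: c_def)
  define k where "k n = a n * sqrt (far_mean n) / (c n * vol n)" for n
  (* \<kappa> is also the limit in probability of the random normalisation *)
  have k_lim: "k \<longlonglongrightarrow> \<kappa>"
  proof -
    define w where "w n = (real n)\<^sup>2 / c n * (real (card (far_pairs n)) / c n) * (mean_ball_mass (e n) / vol n) / b1 DIM('v)" for n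
    have "w \<longlonglongrightarrow> 2 * 1 * q / b1 DIM('v)"
      unfolding w_def c_def q_def using b
      by (intro tendsto_divide tendsto_mult tendsto_const tendsto_choose_two_ratio card_far_ratio_lim mean_ball_mass_ratio_lim) simp
    from tendsto_mult[OF r_lim tendsto_real_sqrt[OF this]] have "(\<lambda>n. r n * sqrt (w n)) \<longlonglongrightarrow> \<kappa>"
      by (simp add: \<kappa>_def)
    moreover have "\<forall>\<^sub>F n in sequentially. r n * sqrt (w n) = k n"
      using eventually_ge_at_top[of 2]
    proof eventually_elim
      case (elim n)
      define y where "y = real n * sqrt (e n ^ DIM('v)) * sqrt (far_mean n) / (c n * vol n)"
      have "0 \<le> y" unfolding y_def far_mean_def
        using c_pos[OF elim] vol_pos[of n] ed[of n] mean_ball_mass_nonneg[of "e n"] by simp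
      moreover have "y\<^sup>2 = w n"
      proof -
        have fm: "0 \<le> far_mean n" unfolding far_mean_def using mean_ball_mass_nonneg by simp
        have "y\<^sup>2 = (real n)\<^sup>2 * e n ^ DIM('v) * far_mean n / (c n * vol n)\<^sup>2"
          unfolding y_def power_divide power_mult_distrib using ed[of n] fm by simp
        also have "\<dots> = w n"
          using c_pos[OF elim] vol_pos[of n] ed[of n] b e_pos[of n]
          unfolding w_def far_mean_def vol_eq by (simp add: field_simps power2_eq_square)
        finally show ?thesis .
      qed
      ultimately have "sqrt (w n) = y" by (metis real_sqrt_unique)
      then show ?case using a_eq[of n] elim by (simp add: k_def y_def)
    qed
    ultimately show ?thesis by (rule Lim_transform_eventually)
  qed
  define Y where "Y n \<omega> = (far_count n \<omega> - far_mean n) / sqrt (far_mean n)" for n \<omega>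
  have Y_meas [measurable]: "random_variable borel (Y n)" for n unfolding Y_def by measurable
  have Y_clt: "conv_to_std_normal M Y" unfolding Y_def by (rule far_count_clt)
  define R1 where "R1 n \<omega> = near_count n \<omega> / (real n * sqrt (e n ^ DIM('v)))" for n \<omega>
  define s1 where "s1 n = r n * ((real n)\<^sup>2 / c n) / b1 DIM('v)" for n
  define s2 where "s2 n = a n * (far_mean n / (c n * vol n) - q)" for n
  have R1_lim: "tendsto_prob R1 0"
  proof (rule tendsto_prob_of_expectation)
    have near_int: "integrable M (near_count n)" for n
      unfolding near_count_def using close_bounds
      by (intro Bochner_Integration.integrable_sum integrable_const_bound[of _ 1] close_measurable)
         (auto simp: near_pairs_def)
    then show "integrable M (R1 n)" for n unfolding R1_def by (rule integrable_divide)
    show nonneg: "0 \<le> R1 n \<omega>" for n \<omega>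
      unfolding R1_def near_count_def using ed[of n] close_bounds
      by (intro divide_nonneg_nonneg sum_nonneg mult_nonneg_nonneg) auto
    show "(\<lambda>n. expectation (R1 n)) \<longlonglongrightarrow> 0"
    proof (rule Lim_null_comparison)
      show "\<forall>\<^sub>F n in sequentially. norm (expectation (R1 n)) \<le> real (3 * m) * (near_pair_mean (e n) / sqrt (e n ^ DIM('v)))"
        using eventually_ge_at_top[of 1]
      proof eventually_elim
        case (elim n)
        have "expectation (R1 n) = expectation (near_count n) / (real n * sqrt (e n ^ DIM('v)))"
          unfolding R1_def by simp
        also have "\<dots> \<le> real (3 * m * n) * near_pair_mean (e n) / (real n * sqrt (e n ^ DIM('v)))"
          using expectation_near_count[of "e n" n] ed[of n] unfolding near_count_def
          by (intro divide_right_mono) auto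
        also have "\<dots> = real (3 * m) * (near_pair_mean (e n) / sqrt (e n ^ DIM('v)))"
          using elim by simp
        finally show ?case using nonneg by simp
      qed
      show "(\<lambda>n. real (3 * m) * (near_pair_mean (e n) / sqrt (e n ^ DIM('v)))) \<longlonglongrightarrow> 0"
        by (intro tendsto_mult_right_zero tendsto_near_pair_mean e_pos e_lim)
    qed
  qed
  have s1_lim: "s1 \<longlonglongrightarrow> 1 * 2 / b1 DIM('v)"
    unfolding s1_def c_def using b
    by (intro tendsto_divide tendsto_mult tendsto_const r_lim tendsto_choose_two_ratio) simp
  have s2_lim: "s2 \<longlonglongrightarrow> 0"
  proof (rule Lim_null_comparison)
    show "\<forall>\<^sub>F n in sequentially. norm (s2 n)
        \<le> \<bar>r n\<bar> * sqrt (e n ^ DIM('v)) * (real (3 * m) * ((real n)\<^sup>2 / c n)) * q + K\<^sup>2 / 2 * \<bar>a n * (e n powr \<alpha>)\<^sup>2\<bar>"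
      using eventually_ge_at_top[of 2] e_le_1
    proof eventually_elim
      case (elim n)
      define f g where "f = real (card (far_pairs n)) / c n" and "g = mean_ball_mass (e n) / vol n"
      have f: "f \<le> 1" "1 - f \<le> real (3 * m * n) / c n" and g: "g \<le> q" "q - (K * e n powr \<alpha>)\<^sup>2 / 2 \<le> g" "0 \<le> g"
        using card_far_ratio_bound[OF elim(1)] card_far_ratio_le[of n] mean_ball_mass_ratio_bounds[of n] elim(2)
          mean_ball_mass_nonneg[of "e n"] vol_pos[of n]
        by (auto simp: f_def g_def c_def q_def)
      have "s2 n = a n * (f * g - q)" unfolding s2_def far_mean_def f_def g_def by simp
      moreover have "\<bar>f * g - q\<bar> \<le> (1 - f) * q + (K * e n powr \<alpha>)\<^sup>2 / 2"
      proof -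
        have "(1 - f) * g \<le> (1 - f) * q" "0 \<le> (1 - f) * g"
          using f g by (auto intro!: mult_left_mono mult_nonneg_nonneg)
        moreover have "f * g = g - (1 - f) * g" by (simp add: algebra_simps)
        ultimately show ?thesis using g by (simp add: abs_le_iff)
      qed
      moreover have "(1 - f) * q \<le> real (3 * m * n) / c n * q" using f q by (intro mult_right_mono) auto
      ultimately have "norm (s2 n) \<le> \<bar>a n\<bar> * (real (3 * m * n) / c n * q + (K * e n powr \<alpha>)\<^sup>2 / 2)"
        unfolding real_norm_def by (simp only: abs_mult) (intro mult_left_mono, auto)
      also have "\<dots> = \<bar>a n\<bar> * (real (3 * m * n) / c n * q) + K\<^sup>2 / 2 * \<bar>a n * (e n powr \<alpha>)\<^sup>2\<bar>"
        by (simp add: abs_mult power_mult_distrib algebra_simps)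
      also have "\<bar>a n\<bar> * (real (3 * m * n) / c n * q)
          = \<bar>r n\<bar> * sqrt (e n ^ DIM('v)) * (real (3 * m) * ((real n)\<^sup>2 / c n)) * q"
        using a_eq[of n] elim(1) ed[of n] by (simp add: abs_mult power2_eq_square)
      finally show ?case .
    qed
    have "(\<lambda>n. \<bar>r n\<bar> * sqrt (e n ^ DIM('v)) * (real (3 * m) * ((real n)\<^sup>2 / c n)) * q + K\<^sup>2 / 2 * \<bar>a n * (e n powr \<alpha>)\<^sup>2\<bar>)
        \<longlonglongrightarrow> \<bar>1\<bar> * sqrt 0 * (real (3 * m) * 2) * q + K\<^sup>2 / 2 * \<bar>0\<bar>"
      unfolding c_def
      by (intro tendsto_add tendsto_mult tendsto_const tendsto_rabs tendsto_real_sqrt r_lim e_power_lim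
          tendsto_choose_two_ratio bias)
    then show "(\<lambda>n. \<bar>r n\<bar> * sqrt (e n ^ DIM('v)) * (real (3 * m) * ((real n)\<^sup>2 / c n)) * q + K\<^sup>2 / 2 * \<bar>a n * (e n powr \<alpha>)\<^sup>2\<bar>)
        \<longlonglongrightarrow> 0" by simp
  qed
  (* R collects the near pairs and the bias *)
  define R where "R n \<omega> = s1 n * R1 n \<omega> + s2 n" for n \<omega>
  have R_lim: "tendsto_prob R 0"
    using tendsto_prob_add[OF tendsto_prob_mult[OF tendsto_prob_const[OF s1_lim] R1_lim] tendsto_prob_const[OF s2_lim]]
    by (simp add: R_def[abs_def])
  note [measurable] = tendsto_probD_measurable[OF R_lim]
  have fm_pos: "\<forall>\<^sub>F n in sequentially. 0 < far_mean n"
    using far_mean_at_top by (simp add: filterlim_at_top_dense)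
  have decomp: "\<forall>\<^sub>F n in sequentially. \<forall>\<omega>. a n * (Q_est X e n \<omega> - q) = k n * Y n \<omega> + R n \<omega>"
    using eventually_ge_at_top[of 2] fm_pos
  proof eventually_elim
    case (elim n)
    show ?case
    proof
      fix \<omega>
      have "a n * (Q_est X e n \<omega> - q) = a n * (far_count n \<omega> - far_mean n) / (c n * vol n)
          + a n * near_count n \<omega> / (c n * vol n) + s2 n"
        unfolding Q_est_eq s2_def c_def by (simp add: algebra_simps add_divide_distrib diff_divide_distrib)
      moreover have "k n * Y n \<omega> = a n * (far_count n \<omega> - far_mean n) / (c n * vol n)"
        using elim(2) by (simp add: k_def Y_def)
      moreover have "s1 n * R1 n \<omega> = a n * near_count n \<omega> / (c n * vol n)"
      proof -
        have sq: "sqrt (e n ^ DIM('v)) * sqrt (e n ^ DIM('v)) = e n ^ DIM('v)" using ed[of n] by simp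
        have s0: "sqrt (e n ^ DIM('v)) \<noteq> 0" using e_pos[of n] by simp
        have "s1 n * R1 n \<omega> = a n * near_count n \<omega> / (c n * ((sqrt (e n ^ DIM('v)) * sqrt (e n ^ DIM('v))) * b1 DIM('v)))"
          using elim(1) s0 unfolding s1_def R1_def r_def by (simp add: field_simps power2_eq_square)
        then show ?thesis unfolding sq vol_eq .
      qed
      ultimately show "a n * (Q_est X e n \<omega> - q) = k n * Y n \<omega> + R n \<omega>" by (simp add: R_def)
    qed
  qed
  have a_top: "(\<lambda>n. inverse (a n)) \<longlonglongrightarrow> 0"
  proof -
    have "filterlim (\<lambda>n. sqrt ((real n)\<^sup>2 * e n ^ DIM('v))) at_top sequentially"
      by (rule filterlim_compose[OF sqrt_at_top many])
    from filterlim_tendsto_pos_mult_at_top[OF r_lim zero_less_one this]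
    have "filterlim (\<lambda>n. r n * sqrt ((real n)\<^sup>2 * e n ^ DIM('v))) at_top sequentially" .
    moreover have "\<forall>\<^sub>F n in sequentially. r n * sqrt ((real n)\<^sup>2 * e n ^ DIM('v)) = a n"
      using eventually_ge_at_top[of 1]
    proof eventually_elim
      case (elim n)
      then show ?case using a_eq[of n] by (simp add: real_sqrt_mult)
    qed
    ultimately have "filterlim a at_top sequentially" by (simp cong: filterlim_cong)
    then show ?thesis by (rule tendsto_inverse_0_at_top)
  qed
  have a_ne: "\<forall>\<^sub>F n in sequentially. a n \<noteq> 0"
    using order_tendstoD(1)[OF r_lim zero_less_one] by eventually_elim (auto simp: r_def)
  have Q_lim: "tendsto_prob (Q_est X e) q"
  proof -
    have "tendsto_prob (\<lambda>n \<omega>. inverse (a n) * k n * Y n \<omega>) 0"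
      using tendsto_prob_mult_tight[OF tendsto_prob_const[of "\<lambda>n. inverse (a n) * k n" 0] Y_meas Y_clt]
        tendsto_mult[OF a_top k_lim] by simp
    from tendsto_prob_add[OF tendsto_prob_add[OF this tendsto_prob_mult[OF tendsto_prob_const[OF a_top] R_lim]]
        tendsto_prob_const[OF tendsto_const[of q]]]
    have "tendsto_prob (\<lambda>n \<omega>. inverse (a n) * k n * Y n \<omega> + inverse (a n) * R n \<omega> + q) q" by simp
    then show ?thesis
    proof (rule tendsto_prob_eventually[OF _ Q_est_measurable])
      show "\<forall>\<^sub>F n in sequentially. \<forall>\<omega>\<in>space M. Q_est X e n \<omega> = inverse (a n) * k n * Y n \<omega> + inverse (a n) * R n \<omega> + q"
        using decomp a_ne
      proof eventually_elim
        case (elim n)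
        show ?case
        proof
          fix \<omega>
          have "inverse (a n) * k n * Y n \<omega> + inverse (a n) * R n \<omega> = inverse (a n) * (a n * (Q_est X e n \<omega> - q))"
            using elim(1) by (simp add: algebra_simps)
          also have "\<dots> = Q_est X e n \<omega> - q"
            using elim(2) by (simp flip: mult.assoc)
          finally show "Q_est X e n \<omega> = inverse (a n) * k n * Y n \<omega> + inverse (a n) * R n \<omega> + q"
            by simp
        qed
      qed
    qed
  qed
  have u_meas [measurable]: "random_variable borel (u_est X e n)" for n unfolding u_est_def by measurable
  have u_lim: "tendsto_prob (u_est X e) \<kappa>"
    unfolding u_est_def[abs_def] \<kappa>_def
    by (rule tendsto_prob_isCont[OF tendsto_prob_max_one_over[OF Q_lim q], where g = "\<lambda>x. sqrt (2 * x / b1 DIM('v))"])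
       (use b in \<open>auto intro!: continuous_intros\<close>)
  define A where "A n \<omega> = k n / u_est X e n \<omega>" for n \<omega>
  define D where "D n \<omega> = R n \<omega> / u_est X e n \<omega>" for n \<omega>
  have A_lim: "tendsto_prob A 1"
    using tendsto_prob_divide[OF tendsto_prob_const[OF k_lim] u_lim] \<kappa> by (simp add: A_def[abs_def])
  have D_lim: "tendsto_prob D 0"
    using tendsto_prob_divide[OF R_lim u_lim] \<kappa> by (simp add: D_def[abs_def])
  note [measurable] = tendsto_probD_measurable[OF A_lim] tendsto_probD_measurable[OF D_lim]
  have T_eq: "\<forall>\<^sub>F n in sequentially. \<forall>\<omega>. a n * (Q_est X e n \<omega> - q) / u_est X e n \<omega> = A n \<omega> * Y n \<omega> + D n \<omega>"
    using decomp by eventually_elim (simp add: A_def D_def add_divide_distrib)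
  show "conv_to_std_normal M (\<lambda>n \<omega>. a n * (Q_est X e n \<omega> - q2 p) / u_est X e n \<omega>)"
    unfolding q_def[symmetric]
  proof (rule conv_to_std_normal_eventually)
    show "conv_to_std_normal M (\<lambda>n \<omega>. A n \<omega> * Y n \<omega> + D n \<omega>)"
      by (rule slutsky_std_normal[OF Y_meas Y_clt A_lim _ D_lim]) simp
    show "\<forall>\<^sub>F n in sequentially. \<forall>\<omega>\<in>space M. a n * (Q_est X e n \<omega> - q) / u_est X e n \<omega> = A n \<omega> * Y n \<omega> + D n \<omega>"
      using T_eq by eventually_elim simp
  qed measurable
  define S where "S n \<omega> = log_slope q (Q_est X e n \<omega>, 1 / real n)" for n \<omega>
  have S_meas [measurable]: "random_variable borel (S n)" for n
    unfolding S_def log_slope_def fst_conv snd_conv by measurable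
  have S_lim: "tendsto_prob S (- 1)"
    using tendsto_prob_isCont2[OF Q_lim tendsto_prob_const[OF lim_1_over_n] isCont_log_slope[OF q]] S_meas
    unfolding S_def by (simp add: log_slope_def)
  have AS: "tendsto_prob (\<lambda>n \<omega>. A n \<omega> * S n \<omega>) (- 1)" and DS: "tendsto_prob (\<lambda>n \<omega>. D n \<omega> * S n \<omega>) 0"
    using tendsto_prob_mult[OF A_lim S_lim] tendsto_prob_mult[OF D_lim S_lim] by simp_all
  show "conv_to_std_normal M (\<lambda>n \<omega>. a n * (Q_est X e n \<omega> * (H_est X e n \<omega> - h2 p)) / u_est X e n \<omega>)"
  proof (rule conv_to_std_normal_eventually)
    show "conv_to_std_normal M (\<lambda>n \<omega>. (A n \<omega> * S n \<omega>) * Y n \<omega> + D n \<omega> * S n \<omega>)"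
      by (rule slutsky_std_normal[OF Y_meas Y_clt AS _ DS]) simp
    show "\<forall>\<^sub>F n in sequentially. \<forall>\<omega>\<in>space M.
        a n * (Q_est X e n \<omega> * (H_est X e n \<omega> - h2 p)) / u_est X e n \<omega> = (A n \<omega> * S n \<omega>) * Y n \<omega> + D n \<omega> * S n \<omega>"
      using T_eq order_tendstoD(2)[OF lim_1_over_n q]
    proof eventually_elim
      case (elim n)
      show ?case
      proof
        fix \<omega>
        have "Q_est X e n \<omega> * (H_est X e n \<omega> - h2 p) = (Q_est X e n \<omega> - q) * S n \<omega>"
          using elim(2) unfolding S_def log_slope_def H_est_def h2_def q_def[symmetric] fst_conv snd_conv
          by (auto simp: max_def)
        then have "a n * (Q_est X e n \<omega> * (H_est X e n \<omega> - h2 p)) / u_est X e n \<omega>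
            = (a n * (Q_est X e n \<omega> - q) / u_est X e n \<omega>) * S n \<omega>" by simp
        also have "\<dots> = (A n \<omega> * S n \<omega>) * Y n \<omega> + D n \<omega> * S n \<omega>"
          using elim(1) by (simp add: algebra_simps)
        finally show "a n * (Q_est X e n \<omega> * (H_est X e n \<omega> - h2 p)) / u_est X e n \<omega>
            = (A n \<omega> * S n \<omega>) * Y n \<omega> + D n \<omega> * S n \<omega>" .
      qed
    qed
    show "random_variable borel (\<lambda>\<omega>. a n * (Q_est X e n \<omega> * (H_est X e n \<omega> - h2 p)) / u_est X e n \<omega>)" for n
      unfolding H_est_def by measurable
  qed measurable
qed

end

end

section \<open>The central limit theorems at the two rates\<close>

lemma conv_to_std_normal_cong_eventually:
  assumes "conv_to_std_normal M Y" "\<forall>\<^sub>F n in sequentially. Y n = Z n"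
  shows "conv_to_std_normal M Z"
  unfolding conv_to_std_normal_def weak_conv_m_def weak_conv_def
proof (intro allI impI)
  fix x assume "isCont (cdf std_normal_distribution) x"
  then have "(\<lambda>n. cdf (distr M borel (Y n)) x) \<longlonglongrightarrow> cdf std_normal_distribution x"
    using assms(1) unfolding conv_to_std_normal_def weak_conv_m_def weak_conv_def by blast
  moreover have "\<forall>\<^sub>F n in sequentially. cdf (distr M borel (Y n)) x = cdf (distr M borel (Z n)) x"
    using assms(2) by eventually_elim simp
  ultimately show "(\<lambda>n. cdf (distr M borel (Z n)) x) \<longlonglongrightarrow> cdf std_normal_distribution x"
    by (rule Lim_transform_eventually)
qed

text \<open>Both regimes of the theorem have this form: the norming sequence \<open>a\<close> determines the bandwidth
  \<open>(a / n)^(2 / d)\<close>, and the two limits say that close pairs are sparse and that the bias is negligible.\<close>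

lemma (in stationary_m_dependent) conv_to_std_normal_estimators_rate:
  fixes \<epsilon> a :: "nat \<Rightarrow> real"
  assumes \<epsilon>_pos: "\<And>n. 1 \<le> n \<Longrightarrow> 0 < \<epsilon> n" and \<epsilon>_lim: "\<epsilon> \<longlonglongrightarrow> 0"
    and many: "filterlim (\<lambda>n. (real n)\<^sup>2 * \<epsilon> n ^ DIM('v)) at_top sequentially"
    and \<alpha>: "0 < \<alpha>" and K: "0 < K" and smooth: "p \<in> H2_class \<alpha> K"
    and a_pos: "\<And>n. 1 \<le> n \<Longrightarrow> 0 < a n"
    and equiv: "\<epsilon> \<sim>[sequentially] (\<lambda>n. (a n / real n) powr (2 / real DIM('v)))"
    and sparse: "(\<lambda>n. (a n)\<^sup>2 / real n) \<longlonglongrightarrow> 0"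
    and bias: "(\<lambda>n. a n * (a n / real n) powr (4 * \<alpha> / real DIM('v))) \<longlonglongrightarrow> 0"
  shows "conv_to_std_normal M (\<lambda>n \<omega>. a n * (Q_est X \<epsilon> n \<omega> - q2 p) / u_est X \<epsilon> n \<omega>)"
    and "conv_to_std_normal M (\<lambda>n \<omega>. a n * (Q_est X \<epsilon> n \<omega> * (H_est X \<epsilon> n \<omega> - h2 p)) / u_est X \<epsilon> n \<omega>)"
proof -
  define d where "d = real DIM('v)"
  have d: "0 < d" by (simp add: d_def)
  (* a positive value at 0 makes the scale positive everywhere and changes no limit *)
  define e where "e n = (if n = 0 then 1 else \<epsilon> n)" for n
  have e_eq: "\<forall>\<^sub>F n in sequentially. e n = \<epsilon> n"
    using eventually_ge_at_top[of 1] by eventually_elim (simp add: e_def)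
  have e_pos: "0 < e n" for n using \<epsilon>_pos[of n] by (simp add: e_def)
  have e_lim: "e \<longlonglongrightarrow> 0"
    by (rule Lim_transform_eventually[OF \<epsilon>_lim]) (use e_eq in \<open>simp add: eq_commute\<close>)
  have many': "filterlim (\<lambda>n. (real n)\<^sup>2 * e n ^ DIM('v)) at_top sequentially"
    by (rule filterlim_mono_eventually[OF many order_refl order_refl])
       (use e_eq in \<open>auto elim: eventually_mono\<close>)
  define g where "g n = (a n / real n) powr (2 / d)" for n
  define \<rho> where "\<rho> n = e n / g n" for n
  have g_pos: "0 < g n" if "1 \<le> n" for n using a_pos[OF that] that by (simp add: g_def)
  have \<rho>_pos: "0 < \<rho> n" if "1 \<le> n" for n using g_pos[OF that] e_pos by (simp add: \<rho>_def)
  have e_split: "e n = \<rho> n * g n" if "1 \<le> n" for n using g_pos[OF that] by (simp add: \<rho>_def)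
  have \<rho>_lim: "\<rho> \<longlonglongrightarrow> 1"
  proof -
    have "\<forall>\<^sub>F n in sequentially. \<epsilon> n \<noteq> 0 \<or> (a n / real n) powr (2 / real DIM('v)) \<noteq> 0"
      using eventually_ge_at_top[of 1]
    proof eventually_elim
      case (elim n)
      then show ?case using \<epsilon>_pos[of n] by simp
    qed
    then have "(\<lambda>n. \<epsilon> n / g n) \<longlonglongrightarrow> 1"
      unfolding g_def d_def by (rule asymp_equivD_strong[OF equiv])
    moreover have "\<forall>\<^sub>F n in sequentially. \<epsilon> n / g n = \<rho> n"
      using e_eq by eventually_elim (simp add: \<rho>_def)
    ultimately show ?thesis by (rule Lim_transform_eventually)
  qed
  have \<rho>_powr: "(\<lambda>n. \<rho> n powr s) \<longlonglongrightarrow> 1" for s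
    using tendsto_powr[OF \<rho>_lim tendsto_const[of s]] by simp
  have e_power: "e n ^ DIM('v) = \<rho> n powr d * (a n / real n)\<^sup>2" if n: "1 \<le> n" for n
  proof -
    have "e n ^ DIM('v) = e n powr d" using e_pos[of n] by (simp add: d_def powr_realpow)
    also have "\<dots> = \<rho> n powr d * g n powr d"
      unfolding e_split[OF n] using \<rho>_pos[OF n] g_pos[OF n] by (simp add: powr_mult)
    also have "g n powr d = (a n / real n)\<^sup>2"
      using d a_pos[OF n] n by (simp add: g_def powr_powr powr_numeral)
    finally show ?thesis .
  qed
  have sparse': "(\<lambda>n. real n * e n ^ DIM('v)) \<longlonglongrightarrow> 0"
  proof (rule Lim_transform_eventually)
    show "(\<lambda>n. \<rho> n powr d * ((a n)\<^sup>2 / real n)) \<longlonglongrightarrow> 0"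
      using tendsto_mult[OF \<rho>_powr sparse] by simp
    show "\<forall>\<^sub>F n in sequentially. \<rho> n powr d * ((a n)\<^sup>2 / real n) = real n * e n ^ DIM('v)"
      using eventually_ge_at_top[of 1]
      by eventually_elim (simp add: e_power power2_eq_square field_simps)
  qed
  have rate: "(\<lambda>n. a n / (real n * sqrt (e n ^ DIM('v)))) \<longlonglongrightarrow> 1"
  proof (rule Lim_transform_eventually)
    show "(\<lambda>n. inverse (sqrt (\<rho> n powr d))) \<longlonglongrightarrow> 1"
      using tendsto_inverse[OF tendsto_real_sqrt[OF \<rho>_powr[of d]]] by simp
    show "\<forall>\<^sub>F n in sequentially. inverse (sqrt (\<rho> n powr d)) = a n / (real n * sqrt (e n ^ DIM('v)))"
      using eventually_ge_at_top[of 1]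
    proof eventually_elim
      case (elim n)
      have "sqrt (e n ^ DIM('v)) = sqrt (\<rho> n powr d) * (a n / real n)"
        unfolding e_power[OF elim] real_sqrt_mult using a_pos[OF elim] by simp
      then show ?case using a_pos[OF elim] elim by (simp add: field_simps)
    qed
  qed
  have bias': "(\<lambda>n. a n * (e n powr \<alpha>)\<^sup>2) \<longlonglongrightarrow> 0"
  proof (rule Lim_transform_eventually)
    show "(\<lambda>n. \<rho> n powr (2 * \<alpha>) * (a n * (a n / real n) powr (4 * \<alpha> / real DIM('v)))) \<longlonglongrightarrow> 0"
      using tendsto_mult[OF \<rho>_powr bias] by simp
    show "\<forall>\<^sub>F n in sequentially. \<rho> n powr (2 * \<alpha>) * (a n * (a n / real n) powr (4 * \<alpha> / real DIM('v))) = a n * (e n powr \<alpha>)\<^sup>2"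
      using eventually_ge_at_top[of 1]
    proof eventually_elim
      case (elim n)
      have "(e n powr \<alpha>)\<^sup>2 = e n powr (2 * \<alpha>)"
        by (simp add: power2_eq_square flip: powr_add)
      also have "\<dots> = \<rho> n powr (2 * \<alpha>) * g n powr (2 * \<alpha>)"
        unfolding e_split[OF elim] using \<rho>_pos[OF elim] g_pos[OF elim] by (simp add: powr_mult)
      also have "g n powr (2 * \<alpha>) = (a n / real n) powr (4 * \<alpha> / real DIM('v))"
        by (simp add: g_def d_def powr_powr)
      finally show ?case by simp
    qed
  qed
  note conv = conv_to_std_normal_estimators[OF e_pos e_lim sparse' many' \<alpha> K smooth rate bias']
  have same: "\<forall>\<^sub>F n in sequentially. Q_est X e n = Q_est X \<epsilon> n \<and> u_est X e n = u_est X \<epsilon> n \<and> H_est X e n = H_est X \<epsilon> n"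
    using e_eq
  proof eventually_elim
    case (elim n)
    then have "Q_est X e n = Q_est X \<epsilon> n" by (simp add: fun_eq_iff Q_est_def N_stat_def)
    then show ?case by (simp add: fun_eq_iff u_est_def H_est_def)
  qed
  show "conv_to_std_normal M (\<lambda>n \<omega>. a n * (Q_est X \<epsilon> n \<omega> - q2 p) / u_est X \<epsilon> n \<omega>)"
    by (rule conv_to_std_normal_cong_eventually[OF conv(1)]) (use same in eventually_elim, simp)
  show "conv_to_std_normal M (\<lambda>n \<omega>. a n * (Q_est X \<epsilon> n \<omega> * (H_est X \<epsilon> n \<omega> - h2 p)) / u_est X \<epsilon> n \<omega>)"
    by (rule conv_to_std_normal_cong_eventually[OF conv(2)]) (use same in eventually_elim, simp)
qed

theorem theorem6:
  fixes M :: "'s measure"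
    and X :: "nat \<Rightarrow> 's \<Rightarrow> real ^ 'd"
    and m :: nat
    and p :: "real ^ 'd \<Rightarrow> real"
    and \<alpha> K :: real
    and \<epsilon> :: "nat \<Rightarrow> real"
  assumes "prob_space M"
    and "\<And>i. 1 \<le> i \<Longrightarrow> X i \<in> borel_measurable M"
    and "strictly_stationary M X"
    and "m_dependent m M X"
    and "\<And>i. 1 \<le> i \<Longrightarrow> has_density M (X i) p"
    and "assumption_A M X p"
    and "0 < \<alpha>" and "\<alpha> \<le> 1" and "0 < K"
    and "p \<in> H2_class \<alpha> K"
    and "\<And>n. 1 \<le> n \<Longrightarrow> 0 < \<epsilon> n"
    and "\<epsilon> \<longlonglongrightarrow> 0"
    and "filterlim (\<lambda>n. (real n)\<^sup>2 * \<epsilon> n ^ CARD('d)) at_top sequentially"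
  shows
    "(\<forall>\<beta> c. 0 < \<beta> \<and> \<beta> < 1 \<and> \<alpha> > real CARD('d) / 4 * (\<beta> / (2 - \<beta>)) \<and> 0 < c \<and>
        \<epsilon> \<sim>[sequentially] (\<lambda>n. c * real n powr (- (2 - \<beta>) / real CARD('d))) \<longrightarrow>
        conv_to_std_normal M (\<lambda>n \<omega>.
          real n powr (\<beta> / 2) * c powr (real CARD('d) / 2) *
          (Q_est X \<epsilon> n \<omega> - q2 p) / u_est X \<epsilon> n \<omega>) \<and>
        conv_to_std_normal M (\<lambda>n \<omega>.
          real n powr (\<beta> / 2) * c powr (real CARD('d) / 2) *
          (Q_est X \<epsilon> n \<omega> * (H_est X \<epsilon> n \<omega> - h2 p)) / u_est X \<epsilon> n \<omega>))
     \<and>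
     (\<forall>L. slowly_varying L \<and>
        \<epsilon> \<sim>[sequentially]
          (\<lambda>n. L (real n) powr (2 / real CARD('d)) * real n powr (- 2 / real CARD('d))) \<longrightarrow>
        conv_to_std_normal M (\<lambda>n \<omega>.
          L (real n) * (Q_est X \<epsilon> n \<omega> - q2 p) / u_est X \<epsilon> n \<omega>) \<and>
        conv_to_std_normal M (\<lambda>n \<omega>.
          L (real n) * (Q_est X \<epsilon> n \<omega> * (H_est X \<epsilon> n \<omega> - h2 p)) / u_est X \<epsilon> n \<omega>))"
proof -
  interpret stationary_m_dependent M X m p
    using assms by (simp add: stationary_m_dependent_def stationary_m_dependent_axioms_def)
  define d where "d = real CARD('d)"
  have d: "0 < d" by (simp add: d_def)
  have dim: "DIM(real ^ 'd) = CARD('d)" by simp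
  note rate = conv_to_std_normal_estimators_rate[unfolded dim, OF assms(11,12,13,7,9,10), folded d_def]
  have part1: "conv_to_std_normal M (\<lambda>n \<omega>.
          real n powr (\<beta> / 2) * c powr (d / 2) * (Q_est X \<epsilon> n \<omega> - q2 p) / u_est X \<epsilon> n \<omega>) \<and>
        conv_to_std_normal M (\<lambda>n \<omega>.
          real n powr (\<beta> / 2) * c powr (d / 2) * (Q_est X \<epsilon> n \<omega> * (H_est X \<epsilon> n \<omega> - h2 p)) / u_est X \<epsilon> n \<omega>)"
    if \<beta>: "0 < \<beta>" "\<beta> < 1" and \<alpha>\<beta>: "\<alpha> > d / 4 * (\<beta> / (2 - \<beta>))" and c: "0 < c"
      and equiv: "\<epsilon> \<sim>[sequentially] (\<lambda>n. c * real n powr (- (2 - \<beta>) / d))" for \<beta> c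
  proof -
    define a where "a n = real n powr (\<beta> / 2) * c powr (d / 2)" for n :: nat
    have quot: "a n / real n = c powr (d / 2) * real n powr (- (2 - \<beta>) / 2)" if "1 \<le> n" for n
    proof -
      have "real n powr (- (2 - \<beta>) / 2) = real n powr (\<beta> / 2 - 1)"
        by (rule arg_cong[of _ _ "\<lambda>x. real n powr x"]) (simp add: field_simps)
      also have "\<dots> = real n powr (\<beta> / 2) / real n"
        using that powr_diff[of "real n" "\<beta> / 2" 1] by simp
      finally have "real n powr (- (2 - \<beta>) / 2) = real n powr (\<beta> / 2) / real n" .
      then show ?thesis by (simp only: a_def) simp
    qed
    have quot_powr: "(a n / real n) powr s = c powr (d * s / 2) * real n powr (- (2 - \<beta>) * s / 2)" if "1 \<le> n" for n s
      unfolding quot[OF that] using c that by (simp add: powr_mult powr_powr mult_ac)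
    have equiv': "\<epsilon> \<sim>[sequentially] (\<lambda>n. (a n / real n) powr (2 / d))"
    proof (rule asymp_equiv_trans[OF equiv], rule asymp_equiv_refl_ev)
      show "\<forall>\<^sub>F n in sequentially. c * real n powr (- (2 - \<beta>) / d) = (a n / real n) powr (2 / d)"
        using eventually_ge_at_top[of 1]
      proof eventually_elim
        case (elim n)
        have "- (2 - \<beta>) * (2 / d) / 2 = - (2 - \<beta>) / d" "d * (2 / d) / 2 = 1" using d by (simp_all add: divide_simps)
        then show ?case using quot_powr[OF elim, of "2 / d"] c by (simp only:) simp
      qed
    qed
    have sparse: "(\<lambda>n. (a n)\<^sup>2 / real n) \<longlonglongrightarrow> 0"
    proof (rule Lim_transform_eventually)
      show "(\<lambda>n. (c powr (d / 2))\<^sup>2 * real n powr (- (1 - \<beta>))) \<longlonglongrightarrow> 0"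
        using \<beta> by (intro tendsto_mult_right_zero tendsto_neg_powr filterlim_real_sequentially) auto
      show "\<forall>\<^sub>F n in sequentially. (c powr (d / 2))\<^sup>2 * real n powr (- (1 - \<beta>)) = (a n)\<^sup>2 / real n"
        using eventually_ge_at_top[of 1]
      proof eventually_elim
        case (elim n)
        have "(real n powr (\<beta> / 2))\<^sup>2 = real n powr \<beta>" by (simp add: power2_eq_square flip: powr_add)
        moreover have "real n powr (- (1 - \<beta>)) = real n powr \<beta> / real n"
          using elim powr_diff[of "real n" \<beta> 1] by simp
        ultimately show ?case by (simp add: a_def power_mult_distrib)
      qed
    qed
    have bias: "(\<lambda>n. a n * (a n / real n) powr (4 * \<alpha> / d)) \<longlonglongrightarrow> 0"
    proof (rule Lim_transform_eventually)
      define s where "s = (2 - \<beta>) * (4 * \<alpha> / d) / 2 - \<beta> / 2"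
      have "\<beta> < 4 * \<alpha> / d * (2 - \<beta>)" using \<alpha>\<beta> \<beta> d by (simp add: field_simps)
      moreover have "s = (4 * \<alpha> / d * (2 - \<beta>) - \<beta>) / 2"
        unfolding s_def by (simp only: diff_divide_distrib mult.commute[of "2 - \<beta>"])
      ultimately have s: "0 < s" by simp
      then show "(\<lambda>n. c powr (d / 2) * c powr (2 * \<alpha>) * real n powr (- s)) \<longlonglongrightarrow> 0"
        by (intro tendsto_mult_right_zero tendsto_neg_powr filterlim_real_sequentially) simp
      show "\<forall>\<^sub>F n in sequentially. c powr (d / 2) * c powr (2 * \<alpha>) * real n powr (- s) = a n * (a n / real n) powr (4 * \<alpha> / d)"
        using eventually_ge_at_top[of 1]
      proof eventually_elim
        case (elim n)
        have "- ((2 - \<beta>) * z / 2 - \<beta> / 2) = \<beta> / 2 + - (2 - \<beta>) * z / 2" for z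
          by (simp add: field_simps)
        then have "real n powr (- s) = real n powr (\<beta> / 2) * real n powr (- (2 - \<beta>) * (4 * \<alpha> / d) / 2)"
          unfolding s_def by (simp only: powr_add)
        then show ?case unfolding quot_powr[OF elim] using d by (simp add: a_def)
      qed
    qed
    have "0 < a n" if "1 \<le> n" for n using that c by (simp add: a_def)
    from rate[OF _ this equiv' sparse bias] show ?thesis unfolding a_def by blast
  qed
  have part2: "conv_to_std_normal M (\<lambda>n \<omega>. L (real n) * (Q_est X \<epsilon> n \<omega> - q2 p) / u_est X \<epsilon> n \<omega>) \<and>
        conv_to_std_normal M (\<lambda>n \<omega>. L (real n) * (Q_est X \<epsilon> n \<omega> * (H_est X \<epsilon> n \<omega> - h2 p)) / u_est X \<epsilon> n \<omega>)"
    if L: "slowly_varying L" and equiv: "\<epsilon> \<sim>[sequentially] (\<lambda>n. L (real n) powr (2 / d) * real n powr (- 2 / d))" for L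
  proof -
    have Lpos: "0 < L (real n)" if "1 \<le> n" for n using L that by (simp add: slowly_varying_def)
    have small: "(\<lambda>n. L (real n) / real n powr \<delta>) \<longlonglongrightarrow> 0" if "0 < \<delta>" for \<delta>
      using filterlim_compose[OF slowly_varying_powr_bound[OF L that] filterlim_real_sequentially] .
    have equiv': "\<epsilon> \<sim>[sequentially] (\<lambda>n. (L (real n) / real n) powr (2 / d))"
    proof (rule asymp_equiv_trans[OF equiv], rule asymp_equiv_refl_ev)
      show "\<forall>\<^sub>F n in sequentially. L (real n) powr (2 / d) * real n powr (- 2 / d) = (L (real n) / real n) powr (2 / d)"
        using eventually_ge_at_top[of 1]
      proof eventually_elim
        case (elim n)
        then show ?case using Lpos[OF elim] by (simp add: powr_divide powr_minus_divide)
      qed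
    qed
    have sparse: "(\<lambda>n. (L (real n))\<^sup>2 / real n) \<longlonglongrightarrow> 0"
    proof (rule Lim_transform_eventually)
      show "(\<lambda>n. (L (real n) / real n powr (1 / 2))\<^sup>2) \<longlonglongrightarrow> 0"
        using tendsto_power[OF small[of "1 / 2"], of 2] by simp
      show "\<forall>\<^sub>F n in sequentially. (L (real n) / real n powr (1 / 2))\<^sup>2 = (L (real n))\<^sup>2 / real n"
        by (simp add: power_divide powr_half_sqrt)
    qed
    have bias: "(\<lambda>n. L (real n) * (L (real n) / real n) powr (4 * \<alpha> / d)) \<longlonglongrightarrow> 0"
    proof (rule Lim_transform_eventually)
      define s where "s = 4 * \<alpha> / d"
      have s: "0 < s" using assms(7) d by (simp add: s_def)
      have "\<forall>\<^sub>F n in sequentially. 0 \<le> L (real n) / real n powr (s / (1 + s))"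
        using eventually_ge_at_top[of 1]
      proof eventually_elim
        case (elim n)
        then show ?case using Lpos[OF elim] by simp
      qed
      then show "(\<lambda>n. (L (real n) / real n powr (s / (1 + s))) powr (1 + s)) \<longlonglongrightarrow> 0"
        using s by (intro tendsto_zero_powrI[OF small tendsto_const]) auto
      show "\<forall>\<^sub>F n in sequentially. (L (real n) / real n powr (s / (1 + s))) powr (1 + s)
          = L (real n) * (L (real n) / real n) powr (4 * \<alpha> / d)"
        using eventually_ge_at_top[of 1]
      proof eventually_elim
        case (elim n)
        have "(L (real n) / real n powr (s / (1 + s))) powr (1 + s) = L (real n) powr (1 + s) / real n powr s"
          using Lpos[OF elim] s by (simp add: powr_divide powr_powr)
        also have "\<dots> = L (real n) * (L (real n) / real n) powr s"
          using Lpos[OF elim] by (simp add: powr_divide powr_add)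
        finally show ?case by (simp add: s_def)
      qed
    qed
    from rate[OF _ Lpos equiv' sparse bias] show ?thesis by blast
  qed
  show ?thesis
    using part1 part2 unfolding d_def by (intro conjI allI impI; elim conjE) blast+
qed

end
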